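(* Let $d\ge 3$ be an integer and let $\xi$ be a random variable with support in $[0,1]$. Let $\xi_1,\dots,\xi_d$ be i.i.d. copies of $\xi$. Assume that $\mathbb{P}(\xi\in\{0,1\})=0$, that the support of $\xi$ contains at least two distinct points of $(0,1)$, and that $$\mathbb{E}\log\left|\prod_{i=1}^d(1-\xi_i)-(-1)^d\prod_{i=1}^d\xi_i\right|>-\infty .$$ Let $(L_n)_{n\ge0}$, $L_n=A_1^{(n)}\cdots A_d^{(n)}$, be the polygons obtained from a non-degenerate convex $d$-gon $L_0$ by consecutive random subdivision with splitting variable $\xi$. Then $L_n$ converges almost surely, as $n\to\infty$, to a random point $P$ inside the initial polygon $L_0$ (that is, all the vertices $A_j^{(n)}$ converge to $P$), and almost surely $$\lim_{n\to\infty}\frac1n\log\left(\max_{1\le j\le d}\|PA_j^{(n)}\|\right)=\mu_1,$$ where $\mu_1$ is the top Lyapunov exponent of the random matrix product $T^{(n)}$.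
   Context: Subdivision procedure. Let $L_0=A_1^{(0)}A_2^{(0)}\cdots A_d^{(0)}$ be a non-degenerate convex polygon with $d$ sides in the plane. Let $\xi_j^{(n)}$, $1\le j\le d$, $n\ge 1$, be i.i.d. copies of $\xi$. Given $L_{n}=A_1^{(n)}\cdots A_d^{(n)}$ (with $A_{d+1}^{(n)}=A_1^{(n)}$), let $A_j^{(n+1)}$ be the point of the segment $A_j^{(n)}A_{j+1}^{(n)}$ with $|A_j^{(n)}A_j^{(n+1)}|/|A_j^{(n)}A_{j+1}^{(n)}|=\xi_j^{(n+1)}$, and set $L_{n+1}=A_1^{(n+1)}\cdots A_d^{(n+1)}$. Matrices. For real numbers $t_1,\dots,t_d$ let $T(t_1,\dots,t_d)$ be the $(d-1)\times(d-1)$ matrix defined by $(Tx)_j=(1-t_j)x_j+t_{j+1}x_{j+1}$ for $1\le j\le d-2$ and $(Tx)_{d-1}=(1-t_{d-1})x_{d-1}-t_d(x_1+\dots+x_{d-1})$, for $x\in\mathbb{R}^{d-1}$. Let $T_n=T(\xi_1^{(n)},\dots,\xi_d^{(n)})$ and $T^{(n)}=T_nT_{n-1}\cdots T_1$. Top Lyapunov exponent: $\mu_1=\lim_{n\to\infty}\mathbb{E}\left(\frac1n\log\sigma_1^{(n)}\right)$, where $\sigma_1^{(n)}$ is the largest singular value of $T^{(n)}$. $\|PA\|$ denotes the Euclidean distance between $P$ and $A$. *)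

theory Defs
  imports "HOL-Probability.Probability" "Jordan_Normal_Form.Char_Poly"
begin

subsection \<open>Random variables\<close>

definition rv_support :: "'a measure \<Rightarrow> ('a \<Rightarrow> real) \<Rightarrow> real set" where
  "rv_support M X = {x. \<forall>U. open U \<and> x \<in> U \<longrightarrow> measure M {\<omega> \<in> space M. X \<omega> \<in> U} > 0}"

definition iid_copies :: "'a measure \<Rightarrow> ('a \<Rightarrow> real) \<Rightarrow> ('i \<Rightarrow> 'a \<Rightarrow> real) \<Rightarrow> 'i set \<Rightarrow> bool" where
  "iid_copies M \<xi> X I \<longleftrightarrow>
     prob_space.indep_vars M (\<lambda>_. borel) X I \<and>
     (\<forall>i\<in>I. distr M borel (X i) = distr M borel \<xi>)"

text \<open>The library has \<open>ln 0 = 0\<close> on the reals; here the value at \<open>0\<close> is \<open>-\<infinity>\<close>.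
  Only non-negative arguments are relevant.\<close>

definition elog :: "real \<Rightarrow> ereal" where
  "elog x = (if x \<le> 0 then -\<infinity> else ereal (ln x))"

text \<open>Expectation as the difference of the expectations of the positive and negative parts
  (\<^const>\<open>e2ennreal\<close> truncates negative values to \<open>0\<close>).  It is meaningful whenever one of the
  two is finite, which is automatic for functions that are bounded above on a probability space.\<close>

definition ereal_expectation :: "'a measure \<Rightarrow> ('a \<Rightarrow> ereal) \<Rightarrow> ereal" where
  "ereal_expectation M f =
     enn2ereal (\<integral>\<^sup>+\<omega>. e2ennreal (f \<omega>) \<partial>M) - enn2ereal (\<integral>\<^sup>+\<omega>. e2ennreal (- f \<omega>) \<partial>M)"


subsection \<open>Polygons and their subdivision\<close>

text \<open>All cyclic indices run over \<open>{0..<d}\<close>, so the successor of \<open>j\<close> is \<open>Suc j mod d\<close>.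
  The sequence \<open>A 0, \<dots>, A (d - 1)\<close> lists the vertices of a convex polygon in cyclic order:
  the vertices of the convex hull are exactly these \<open>d\<close> distinct points, and the segments
  joining consecutive ones are its sides.\<close>

definition nondegenerate_convex_polygon :: "nat \<Rightarrow> (nat \<Rightarrow> real^2) \<Rightarrow> bool" where
  "nondegenerate_convex_polygon d A \<longleftrightarrow>
     inj_on A {..<d} \<and>
     {x. x extreme_point_of (convex hull (A ` {..<d}))} = A ` {..<d} \<and>
     (\<forall>j<d. closed_segment (A j) (A (Suc j mod d)) edge_of (convex hull (A ` {..<d}))) \<and>
     interior (convex hull (A ` {..<d})) \<noteq> {}"

definition subdivide :: "nat \<Rightarrow> (nat \<Rightarrow> real) \<Rightarrow> (nat \<Rightarrow> real^2) \<Rightarrow> (nat \<Rightarrow> real^2)" where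
  "subdivide d t A = (\<lambda>j. (1 - t j) *\<^sub>R A j + t j *\<^sub>R A (Suc j mod d))"

lemma division_point_unique:
  fixes A B Q :: "real^2"
  assumes "A \<noteq> B" "0 \<le> t" "t \<le> 1"
  shows "Q \<in> closed_segment A B \<and> dist A Q / dist A B = t \<longleftrightarrow> Q = (1 - t) *\<^sub>R A + t *\<^sub>R B"
proof -
  have *: "dist A ((1 - u) *\<^sub>R A + u *\<^sub>R B) / dist A B = u" if "0 \<le> u" for u
  proof -
    have "A - ((1 - u) *\<^sub>R A + u *\<^sub>R B) = u *\<^sub>R (A - B)"
      by (simp add: algebra_simps)
    then show ?thesis
      using assms(1) that by (simp add: dist_norm)
  qed
  show ?thesis
    using * assms by (auto simp: closed_segment_def)
qed

text \<open>\<open>x n j\<close> is the splitting ratio used on the \<open>j\<close>-th side in the step from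
  \<open>L\<^sub>n\<^sub>-\<^sub>1\<close> to \<open>L\<^sub>n\<close>, so \<open>x 0\<close> is not used.\<close>

primrec polygon_seq :: "nat \<Rightarrow> (nat \<Rightarrow> real^2) \<Rightarrow> (nat \<Rightarrow> nat \<Rightarrow> real) \<Rightarrow> nat \<Rightarrow> nat \<Rightarrow> real^2" where
  "polygon_seq d A0 x 0 = A0"
| "polygon_seq d A0 x (Suc n) = subdivide d (x (Suc n)) (polygon_seq d A0 x n)"


subsection \<open>Matrices and the top Lyapunov exponent\<close>

text \<open>The map \<open>x \<mapsto> T(t\<^sub>1, \<dots>, t\<^sub>d) x\<close>, with all indices lowered by one.  It describes how
  the first \<open>d - 1\<close> side vectors of a closed polygon (the last one being minus their sum)
  change under one subdivision.\<close>

definition step_mat :: "nat \<Rightarrow> (nat \<Rightarrow> real) \<Rightarrow> real mat" where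
  "step_mat d t = mat (d - 1) (d - 1) (\<lambda>(i, k).
     if i = d - 2 then (if k = i then 1 - t i else 0) - t (d - 1)
     else if k = i then 1 - t i
     else if k = Suc i then t (Suc i)
     else 0)"

lemma step_mat_mult_vec:
  assumes "x \<in> carrier_vec (d - 1)" "j < d - 1" "d \<ge> 2"
  shows "vec_index (mult_mat_vec (step_mat d t) x) j =
    (if j = d - 2 then (1 - t j) * vec_index x j - t (d - 1) * (\<Sum>k<d - 1. vec_index x k)
     else (1 - t j) * vec_index x j + t (Suc j) * vec_index x (Suc j))"
proof -
  have eq: "vec_index (mult_mat_vec (step_mat d t) x) j =
      (\<Sum>k<d - 1. (step_mat d t $$ (j, k)) * vec_index x k)"
    using assms by (simp add: step_mat_def scalar_prod_def atLeast0LessThan)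
  show ?thesis
  proof (cases "j = d - 2")
    case True
    have "(\<Sum>k<d - 1. (step_mat d t $$ (j, k)) * vec_index x k) =
        (\<Sum>k<d - 1. (if k = j then (1 - t j) * vec_index x k else 0) - t (d - 1) * vec_index x k)"
      using assms True by (intro sum.cong) (auto simp: step_mat_def algebra_simps)
    also have "\<dots> = (1 - t j) * vec_index x j - t (d - 1) * (\<Sum>k<d - 1. vec_index x k)"
      using assms by (simp add: sum_subtractf sum_distrib_left)
    finally show ?thesis using eq True by simp
  next
    case False
    then have "Suc j < d - 1" using assms by linarith
    have "(\<Sum>k<d - 1. (step_mat d t $$ (j, k)) * vec_index x k) =
        (\<Sum>k<d - 1. (if k = j then (1 - t j) * vec_index x k else 0) +
                    (if k = Suc j then t (Suc j) * vec_index x k else 0))"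
      using assms False by (intro sum.cong) (auto simp: step_mat_def)
    also have "\<dots> = (1 - t j) * vec_index x j + t (Suc j) * vec_index x (Suc j)"
      using assms \<open>Suc j < d - 1\<close> by (simp add: sum.distrib)
    finally show ?thesis using eq False by simp
  qed
qed

primrec step_mat_prod :: "nat \<Rightarrow> (nat \<Rightarrow> nat \<Rightarrow> real) \<Rightarrow> nat \<Rightarrow> real mat" where
  "step_mat_prod d x 0 = 1\<^sub>m (d - 1)"
| "step_mat_prod d x (Suc n) = step_mat d (x (Suc n)) * step_mat_prod d x n"

text \<open>The singular values of \<open>B\<close> are the square roots of the eigenvalues of \<open>B\<^sup>T B\<close>.\<close>

definition largest_singular_value :: "real mat \<Rightarrow> real" where
  "largest_singular_value B = Max (sqrt ` {k. eigenvalue (transpose_mat B * B) k})"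

definition has_top_Lyapunov_exponent :: "'a measure \<Rightarrow> (nat \<Rightarrow> 'a \<Rightarrow> real mat) \<Rightarrow> real \<Rightarrow> bool" where
  "has_top_Lyapunov_exponent M T \<mu> \<longleftrightarrow>
     (\<lambda>n. ereal_expectation M (\<lambda>\<omega>. elog (largest_singular_value (T n \<omega>)) / ereal (real n)))
       \<longlonglongrightarrow> ereal \<mu>"

end

theory Submission
  imports Defs "Jordan_Normal_Form.Schur_Decomposition"
begin

text \<open>
  Subdivision acts linearly and in the same way on every real function on the vertices: on the two
  coordinates of the polygon, and on the test functions whose images make up the columns of
  \<open>T\<^sup>(\<^sup>n\<^sup>)\<close>.  The theorem splits into a deterministic comparison of the polygon with
  \<open>T\<^sup>(\<^sup>n\<^sup>)\<close> and an ergodic theorem for the norms of the latter.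

  \<^emph>\<open>Comparison.\<close>  A convex polygon stays convex when it is subdivided, and a strictly
  convex one stays convex when its coordinates are perturbed slightly by an arbitrary function \<open>f\<close>
  on the vertices.  Apply the first fact to the polygons provided by the second, at time \<open>0\<close>: for
  all times, \<open>n\<close>-fold subdivision \<open>f\<^sub>n\<close> of \<open>f\<close> perturbs \<open>L\<^sub>n\<close> without destroying convexity, where
  the admissible size of the perturbation does not depend on \<open>n\<close>.  In terms of signed areas of
  triangles, exchanging a coordinate for \<open>f\<^sub>n\<close> enlarges an area at most by a fixed factor \<open>C\<close>.  By
  Cramer's rule \<open>f\<^sub>n\<close> is, on each triangle of vertices, an affine function of the position whose
  gradient has entries of size at most \<open>C\<close> (lemma \<open>dominated_edge\<close>).  Hence
  \<open>\<parallel>T\<^sup>(\<^sup>n\<^sup>)\<parallel>\<close> is at most a constant times the diameter of \<open>L\<^sub>n\<close>.  The converse inequality is clear, so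
  that for every realisation the diameter and the norm have the same exponential rate
  (lemma \<open>polygon_diameter_comparable\<close>).

  \<^emph>\<open>Ergodic theorem.\<close>  It remains to see that \<open>(1/n) log \<parallel>T\<^sup>(\<^sup>n\<^sup>)\<parallel>\<close> converges almost surely to the
  limit of its expectations.  The logarithms of the norms of the partial products form a
  subadditive array.  For the lower bound suppose that the lower rate is below some number with
  positive probability; by a zero-one law this happens almost surely, and then a long time interval
  can be covered, up to a small proportion, by blocks of bounded length on which the rate is small,
  which bounds the expected rate as well (\<open>subadditive_returns_bound\<close>, an argument of Katznelson
  and Weiss).  Applied to additive arrays this contains a law of large numbers, and the upper bound
  follows from it by averaging over blocks of fixed length (\<open>subadditive_limsup\<close>).  The limit is
  finite because one subdivision shrinks no vector by more than the determinant of its matrix, up to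
  a constant (\<open>edge_expansion\<close>), and the logarithm of that determinant is integrable.

  \<^emph>\<open>Convergence to a point.\<close>  With positive probability the ratios of \<open>d - 1\<close> successive
  steps all lie in \<open>[\<eta>, 1 - \<eta>]\<close> for some \<open>\<eta> > 0\<close>; such a window shrinks the oscillation of every
  function on the vertices by a fixed factor (\<open>osc_contraction\<close>), and windows of this kind recur
  almost surely (\<open>recurrent_windows\<close>).  The limit point is interior because \<open>L\<^sub>2\<close> already lies in
  the interior of \<open>L\<^sub>0\<close> (\<open>polygon_seq_interior\<close>).
\<close>

section \<open>Singular values and the entry norm\<close>

text \<open>A norm comparable with the largest singular value that is at the same time submultiplicative and
  visibly a measurable function of the entries.\<close>

definition entry_norm :: "real mat \<Rightarrow> real" where
  "entry_norm B = (\<Sum>i<dim_row B. \<Sum>k<dim_col B. \<bar>B $$ (i, k)\<bar>)"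

lemma entry_norm_nonneg: "0 \<le> entry_norm B"
  by (simp add: entry_norm_def sum_nonneg)

lemma entry_norm_mult:
  assumes "A \<in> carrier_mat nr n" "B \<in> carrier_mat n nc"
  shows "entry_norm (A * B) \<le> entry_norm A * entry_norm B"
proof -
  have "entry_norm (A * B) = (\<Sum>i<nr. \<Sum>k<nc. \<bar>\<Sum>j<n. A $$ (i, j) * B $$ (j, k)\<bar>)"
    using assms by (simp add: entry_norm_def scalar_prod_def atLeast0LessThan)
  also have "\<dots> \<le> (\<Sum>i<nr. \<Sum>k<nc. \<Sum>j<n. \<bar>A $$ (i, j)\<bar> * \<bar>B $$ (j, k)\<bar>)"
    by (intro sum_mono order.trans[OF sum_abs]) (simp add: abs_mult)
  also have "\<dots> = (\<Sum>i<nr. \<Sum>j<n. \<bar>A $$ (i, j)\<bar> * (\<Sum>k<nc. \<bar>B $$ (j, k)\<bar>))"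
    by (subst sum.swap) (simp add: sum_distrib_left)
  also have "\<dots> \<le> (\<Sum>i<nr. \<Sum>j<n. \<bar>A $$ (i, j)\<bar> * entry_norm B)"
    using assms by (intro sum_mono mult_left_mono)
      (auto simp: entry_norm_def intro!: member_le_sum sum_nonneg)
  also have "\<dots> = entry_norm A * entry_norm B"
    using assms by (simp add: entry_norm_def sum_distrib_right)
  finally show ?thesis .
qed

abbreviation complex_mat :: "real mat \<Rightarrow> complex mat" where
  "complex_mat \<equiv> map_mat complex_of_real"

lemma eigenvalue_complex_mat:
  assumes "A \<in> carrier_mat n n"
  shows "eigenvalue (complex_mat A) (complex_of_real r) \<longleftrightarrow> eigenvalue A r"
proof -
  have "char_poly (complex_mat A) = map_poly complex_of_real (char_poly A)"
    by (rule of_real_hom.char_poly_hom[OF assms])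
  then show ?thesis
    using assms by (simp add: eigenvalue_root_char_poly[of _ n])
qed

text \<open>From \<open>B\<^sup>T B v = a v\<close> one gets \<open>a \<parallel>v\<parallel>\<^sup>2 = \<parallel>B v\<parallel>\<^sup>2\<close>, so that \<open>a\<close> is real and non-negative, and a bound
  for the coordinates of \<open>B v\<close> is a bound for \<open>a\<close>.  Complex eigenvectors are included because the
  eigenvalues are produced below by a triangular form over the complex numbers.\<close>

lemma gram_eigenvalue_complex:
  assumes B: "B \<in> carrier_mat n n"
    and ev: "eigenvalue (complex_mat (transpose_mat B * B)) a"
  shows "a = complex_of_real (Re a) \<and> 0 \<le> Re a \<and> Re a \<le> (entry_norm B)\<^sup>2"
proof -
  let ?G = "complex_mat (transpose_mat B * B)"
  have G: "?G \<in> carrier_mat n n" using B by simp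
  from ev obtain v where v: "eigenvector ?G v a" by (auto simp: eigenvalue_def)
  then have vc: "v \<in> carrier_vec n" and v0: "v \<noteq> 0\<^sub>v n" and eq: "mult_mat_vec ?G v = a \<cdot>\<^sub>v v"
    using G by (auto simp: eigenvector_def)
  define z where "z i = vec_index v i" for i
  define w where "w k = (\<Sum>j<n. of_real (B $$ (k, j)) * z j)" for k
  define s where "s = (\<Sum>i<n. (cmod (z i))\<^sup>2)"
  have eq': "(\<Sum>j<n. (\<Sum>k<n. of_real (B $$ (k, i)) * of_real (B $$ (k, j))) * z j) = a * z i"
    if "i < n" for i
  proof -
    have "vec_index (mult_mat_vec ?G v) i = vec_index (a \<cdot>\<^sub>v v) i" using eq by simp
    then show ?thesis using that B vc
      by (simp add: scalar_prod_def z_def atLeast0LessThan)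
  qed
  have wz: "(\<Sum>k<n. of_real (B $$ (k, i)) * w k) = a * z i" if "i < n" for i
    unfolding eq'[OF that, symmetric] w_def sum_distrib_left sum_distrib_right
    by (subst sum.swap) (simp add: mult.assoc)
  have "(\<Sum>i<n. cnj (z i) * (a * z i)) = (\<Sum>i<n. cnj (z i) * (\<Sum>k<n. of_real (B $$ (k, i)) * w k))"
    by (simp add: wz)
  also have "\<dots> = (\<Sum>k<n. cnj (w k) * w k)"
  proof -
    have "cnj (w k) * w k = (\<Sum>i<n. cnj (z i) * (of_real (B $$ (k, i)) * w k))" for k
    proof -
      have "cnj (w k) = (\<Sum>i<n. cnj (z i) * of_real (B $$ (k, i)))"
        by (simp add: w_def mult.commute)
      then show ?thesis by (simp add: sum_distrib_right mult.assoc)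
    qed
    then show ?thesis
      unfolding sum_distrib_left by (subst sum.swap) simp
  qed
  finally have id: "a * of_real s = of_real (\<Sum>k<n. (cmod (w k))\<^sup>2)"
    by (simp add: s_def sum_distrib_left mult_ac flip: complex_norm_square)
  obtain i where i: "i < n" "z i \<noteq> 0"
  proof -
    have "\<exists>i<n. z i \<noteq> 0"
    proof (rule ccontr)
      assume "\<not> ?thesis"
      then have "v = 0\<^sub>v n" using vc by (intro eq_vecI) (auto simp: z_def)
      then show False using v0 by simp
    qed
    then show ?thesis using that by blast
  qed
  have s: "s > 0"
    unfolding s_def by (rule sum_pos2[of _ i]) (use i in auto)
  define q where "q = (\<Sum>k<n. (cmod (w k))\<^sup>2)"
  have a: "a = of_real (q / s)"
    using id s by (simp add: q_def field_simps)
  have q0: "q \<ge> 0" by (simp add: q_def sum_nonneg)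
  have "q \<le> (\<Sum>k<n. (\<Sum>j<n. \<bar>B $$ (k, j)\<bar>)\<^sup>2 * s)"
    unfolding q_def
  proof (rule sum_mono)
    fix k
    have zs: "cmod (z j) \<le> sqrt s" if "j < n" for j
      using that unfolding s_def by (intro real_le_rsqrt member_le_sum) auto
    have "cmod (w k) \<le> (\<Sum>j<n. \<bar>B $$ (k, j)\<bar> * cmod (z j))"
      unfolding w_def by (rule order.trans[OF norm_sum]) (simp add: norm_mult)
    also have "\<dots> \<le> (\<Sum>j<n. \<bar>B $$ (k, j)\<bar>) * sqrt s"
      unfolding sum_distrib_right by (intro sum_mono mult_left_mono zs) auto
    finally have "(cmod (w k))\<^sup>2 \<le> ((\<Sum>j<n. \<bar>B $$ (k, j)\<bar>) * sqrt s)\<^sup>2"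
      by (intro power_mono) auto
    then show "(cmod (w k))\<^sup>2 \<le> (\<Sum>j<n. \<bar>B $$ (k, j)\<bar>)\<^sup>2 * s"
      using s by (simp add: power_mult_distrib)
  qed
  also have "\<dots> \<le> (entry_norm B)\<^sup>2 * s"
  proof -
    have "(\<Sum>k<n. (\<Sum>j<n. \<bar>B $$ (k, j)\<bar>)\<^sup>2) \<le> (\<Sum>k<n. (\<Sum>j<n. \<bar>B $$ (k, j)\<bar>) * entry_norm B)"
      unfolding power2_eq_square using B
      by (intro sum_mono mult_left_mono)
        (auto simp: entry_norm_def intro!: member_le_sum sum_nonneg)
    also have "\<dots> = (entry_norm B)\<^sup>2"
      using B by (simp add: entry_norm_def power2_eq_square sum_distrib_right)
    finally show ?thesis using s by (simp flip: sum_distrib_right)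
  qed
  finally have "q / s \<le> (entry_norm B)\<^sup>2" using s by (simp add: field_simps)
  then show ?thesis using a q0 s by simp
qed

lemma trace_similar:
  fixes P B Q :: "'a :: comm_ring_1 mat"
  assumes "P \<in> carrier_mat n n" "B \<in> carrier_mat n n" "Q \<in> carrier_mat n n" "Q * P = 1\<^sub>m n"
  shows "(\<Sum>i<n. (P * B * Q) $$ (i, i)) = (\<Sum>i<n. B $$ (i, i))"
proof -
  have swap: "(\<Sum>i<n. (X * Y) $$ (i, i)) = (\<Sum>i<n. (Y * X) $$ (i, i))"
    if "X \<in> carrier_mat n n" "Y \<in> carrier_mat n n" for X Y :: "'a mat"
    using that by (simp add: scalar_prod_def atLeast0LessThan, subst sum.swap)
      (simp add: mult.commute)
  have "(\<Sum>i<n. (P * B * Q) $$ (i, i)) = (\<Sum>i<n. (Q * (P * B)) $$ (i, i))"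
    using assms by (intro swap) auto
  also have "Q * (P * B) = B"
    using assms by (simp flip: assoc_mult_mat[of Q n n P n B n])
  finally show ?thesis .
qed

text \<open>The sum of the squared entries of \<open>B\<close> is the trace of \<open>B\<^sup>T B\<close>, hence the sum of the \<open>n\<close> diagonal
  entries of a triangular form, which are eigenvalues; one of them is at least the mean.\<close>

lemma gram_eigenvalue_ge:
  assumes B: "B \<in> carrier_mat n n" and n: "n > 0"
  obtains k where "eigenvalue (transpose_mat B * B) k"
    "(\<Sum>i<n. \<Sum>j<n. (B $$ (i, j))\<^sup>2) \<le> real n * k"
proof -
  let ?R = "transpose_mat B * B"
  let ?G = "complex_mat ?R"
  have R: "?R \<in> carrier_mat n n" and G: "?G \<in> carrier_mat n n" using B by auto
  obtain es where es: "char_poly ?G = (\<Prod>a\<leftarrow>es. [:- a, 1:])"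
    using char_poly_factorized[OF G] by blast
  define U where "U = schur_upper_triangular ?G es"
  note schur = schur_upper_triangular[OF G es, folded U_def]
  obtain m P Q where PQ: "{?G, U, P, Q} \<subseteq> carrier_mat m m" "Q * P = 1\<^sub>m m" "?G = P * U * Q"
    using similar_matD[OF schur(3)] by blast
  have mn: "m = n" using PQ(1) G by auto
  have tr: "(\<Sum>i<n. ?G $$ (i, i)) = (\<Sum>i<n. U $$ (i, i))"
    using trace_similar[of P n U Q] PQ mn by auto
  have ev: "eigenvalue ?G (U $$ (i, i))" if "i < n" for i
  proof -
    have "char_poly ?G = (\<Prod>a\<leftarrow>diag_mat U. [:- a, 1:])"
      using char_poly_similar[OF schur(3)] char_poly_upper_triangular[OF schur(1,2)] by simp
    moreover have "U $$ (i, i) \<in> set (diag_mat U)"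
      using schur(1) that by (auto simp: diag_mat_def)
    ultimately show ?thesis
      by (auto simp: eigenvalue_root_char_poly[OF G] poly_prod_list prod_list_zero_iff)
  qed
  define r where "r i = Re (U $$ (i, i))" for i
  have U: "U $$ (i, i) = of_real (r i)" if "i < n" for i
    using gram_eigenvalue_complex[OF B ev[OF that]] by (simp add: r_def)
  have "complex_of_real (\<Sum>i<n. \<Sum>j<n. (B $$ (i, j))\<^sup>2) = (\<Sum>i<n. ?G $$ (i, i))"
    using B by (simp add: scalar_prod_def atLeast0LessThan power2_eq_square, subst sum.swap) simp
  also have "\<dots> = complex_of_real (\<Sum>i<n. r i)"
    unfolding tr using U by simp
  finally have sum: "(\<Sum>i<n. \<Sum>j<n. (B $$ (i, j))\<^sup>2) = (\<Sum>i<n. r i)"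
    using of_real_eq_iff by blast
  have "Max (r ` {..<n}) \<in> r ` {..<n}" using n by (intro Max_in) auto
  then obtain i where i: "i < n" "Max (r ` {..<n}) = r i" by auto
  have "(\<Sum>i<n. r i) \<le> (\<Sum>j<n. r i)"
    by (intro sum_mono) (auto simp flip: i(2))
  moreover have "eigenvalue ?R (r i)"
    using ev[OF i(1)] U[OF i(1)] eigenvalue_complex_mat[OF R] by simp
  ultimately show ?thesis using that sum by simp
qed

lemma largest_singular_value_bounds:
  assumes B: "B \<in> carrier_mat n n" and n: "n > 0"
  shows "largest_singular_value B \<le> entry_norm B"
    and "entry_norm B \<le> (real n)\<^sup>2 * largest_singular_value B"
proof -
  let ?R = "transpose_mat B * B"
  have R: "?R \<in> carrier_mat n n" using B by auto
  let ?E = "{k. eigenvalue ?R k}"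
  have fin: "finite ?E"
  proof -
    have "char_poly ?R \<noteq> 0" using degree_monic_char_poly[OF R] by auto
    then show ?thesis by (simp add: eigenvalue_root_char_poly[OF R] poly_roots_finite)
  qed
  obtain k where k: "eigenvalue ?R k" "(\<Sum>i<n. \<Sum>j<n. (B $$ (i, j))\<^sup>2) \<le> real n * k"
    using gram_eigenvalue_ge[OF assms] by blast
  have bd: "0 \<le> l \<and> l \<le> (entry_norm B)\<^sup>2" if "eigenvalue ?R l" for l
    using gram_eigenvalue_complex[OF B, of "of_real l"] that eigenvalue_complex_mat[OF R] by simp
  show "largest_singular_value B \<le> entry_norm B"
    unfolding largest_singular_value_def using k fin bd
    by (subst Max_le_iff) (auto intro!: real_le_lsqrt simp: entry_norm_nonneg)
  have "(entry_norm B)\<^sup>2 = (\<Sum>p\<in>{..<n}\<times>{..<n}. \<bar>B $$ p\<bar>)\<^sup>2"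
    using B by (simp add: entry_norm_def sum.cartesian_product case_prod_unfold)
  also have "\<dots> \<le> (real n)\<^sup>2 * (\<Sum>p\<in>{..<n}\<times>{..<n}. (B $$ p)\<^sup>2)"
    using sum_squared_le_sum_of_squares[of "\<lambda>p. \<bar>B $$ p\<bar>" "{..<n}\<times>{..<n}"] by (simp add: power2_eq_square mult.commute)
  also have "\<dots> \<le> (real n)\<^sup>2 * (real n * k)"
    using k(2) by (intro mult_left_mono) (simp_all add: sum.cartesian_product case_prod_unfold)
  also have "\<dots> \<le> (real n)\<^sup>2 * ((real n)\<^sup>2 * k)"
    using n bd[OF k(1)] by (intro mult_left_mono mult_right_mono) (auto simp: power2_eq_square)
  also have "\<dots> = ((real n)\<^sup>2 * sqrt k)\<^sup>2"
    using bd[OF k(1)] by (simp add: power_mult_distrib power2_eq_square[of "(real n)\<^sup>2"])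
  finally have "entry_norm B \<le> (real n)\<^sup>2 * sqrt k"
    by (rule power2_le_imp_le) (use bd[OF k(1)] in auto)
  also have "\<dots> \<le> (real n)\<^sup>2 * largest_singular_value B"
    unfolding largest_singular_value_def using k(1) fin by (intro mult_left_mono Max_ge) auto
  finally show "entry_norm B \<le> (real n)\<^sup>2 * largest_singular_value B" .
qed

section \<open>Convexity and domination under subdivision\<close>

text \<open>Twice the signed area of the triangle formed by the vertices \<open>i\<close>, \<open>j\<close>, \<open>k\<close> of the planar polygon
  with coordinate functions \<open>a\<close> and \<open>b\<close>.  The two coordinates are separate arguments so that one of
  them can be replaced by another function on the vertices.\<close>

definition turn :: "(nat \<Rightarrow> real) \<Rightarrow> (nat \<Rightarrow> real) \<Rightarrow> nat \<Rightarrow> nat \<Rightarrow> nat \<Rightarrow> real" where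
  "turn a b i j k = (a j - a i) * (b k - b i) - (a k - a i) * (b j - b i)"

text \<open>Strict convexity with counterclockwise order.  All triples are required to turn left, since left
  turns at the vertices alone would also allow polygons that wind several times.\<close>

definition ccw :: "nat \<Rightarrow> (nat \<Rightarrow> real) \<Rightarrow> (nat \<Rightarrow> real) \<Rightarrow> bool" where
  "ccw d a b \<longleftrightarrow> (\<forall>i j k. i < j \<longrightarrow> j < k \<longrightarrow> k < d \<longrightarrow> 0 < turn a b i j k)"

lemma turn_cyclic: "turn a b j k i = turn a b i j k"
  by (simp add: turn_def algebra_simps)

lemma turn_swap: "turn b a i j k = - turn a b i j k"
  by (simp add: turn_def algebra_simps)

lemma ccw_turn_nonneg:
  assumes "ccw d a b" "i \<le> j" "j \<le> k" "k < d"
  shows "0 \<le> turn a b i j k"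
proof (cases "i = j \<or> j = k")
  case True
  then show ?thesis by (auto simp: turn_def)
next
  case False
  then show ?thesis using assms by (auto simp: ccw_def intro!: less_imp_le)
qed

definition split_step :: "nat \<Rightarrow> (nat \<Rightarrow> real) \<Rightarrow> (nat \<Rightarrow> real) \<Rightarrow> nat \<Rightarrow> real" where
  "split_step d t f = (\<lambda>j. (1 - t j) * f j + t j * f (Suc j mod d))"

primrec split_seq :: "nat \<Rightarrow> (nat \<Rightarrow> nat \<Rightarrow> real) \<Rightarrow> (nat \<Rightarrow> real) \<Rightarrow> nat \<Rightarrow> nat \<Rightarrow> real" where
  "split_seq d x f 0 = f"
| "split_seq d x f (Suc n) = split_step d (x (Suc n)) (split_seq d x f n)"

lemma polygon_seq_component:
  "vec_nth (polygon_seq d A x n j) c = split_seq d x (\<lambda>j. vec_nth (A j) c) n j"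
  by (induction n arbitrary: j) (simp_all add: subdivide_def split_step_def)

lemma split_seq_add:
  "split_seq d x f (n + m) = split_seq d (\<lambda>k. x (n + k)) (split_seq d x f n) m"
  by (induction m) simp_all

lemma split_seq_lincomb:
  "split_seq d x (\<lambda>j. p * f j + q * g j) n = (\<lambda>j. p * split_seq d x f n j + q * split_seq d x g n j)"
  by (induction n) (simp_all add: split_step_def algebra_simps)

text \<open>The signed area is affine in each of the three points, so that the new area is a combination of
  eight old ones with non-negative weights.  Replacing some of \<open>i < j < k\<close> by their successors keeps
  the weak cyclic order, hence none of the eight is negative, and the triple \<open>i\<close>, \<open>j\<close>, \<open>k\<close> itself
  enters with positive weight.\<close>

lemma ccw_split_step:
  assumes ccw: "ccw d a b" and t: "\<And>j. j < d \<Longrightarrow> 0 < t j \<and> t j < 1"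
  shows "ccw d (split_step d t a) (split_step d t b)"
  unfolding ccw_def
proof (intro allI impI)
  fix i j k assume ijk: "i < j" "j < k" "k < d"
  define W where "W p q r = turn a b p q r" for p q r
  let ?i = "Suc i" and ?j = "Suc j" and ?k = "Suc k mod d"
  have mods: "Suc i mod d = Suc i" "Suc j mod d = Suc j" using ijk by auto
  have W: "0 \<le> W p q r" if "p \<in> {i, ?i}" "q \<in> {j, ?j}" "r \<in> {k, ?k}" for p q r
  proof (cases "r = k \<or> Suc k < d")
    case True
    then show ?thesis using that ijk unfolding W_def
      by (intro ccw_turn_nonneg[OF ccw]) auto
  next
    case False
    \<comment> \<open>The successor of the last vertex is vertex \<open>0\<close>; the triple has to be rotated to be in order.\<close>
    then have "Suc k = d" using ijk by simp
    then have "r = 0" using False that by auto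
    then have "0 \<le> turn a b 0 p q" using that ijk
      by (intro ccw_turn_nonneg[OF ccw]) auto
    then show ?thesis using turn_cyclic[of a b p q 0] \<open>r = 0\<close>
      by (simp add: W_def turn_cyclic)
  qed
  have pos: "0 < W i j k" using ccw ijk by (simp add: W_def ccw_def)
  have "turn (split_step d t a) (split_step d t b) i j k =
    (1 - t k) * ((1 - t j) * ((1 - t i) * W i j k + t i * W ?i j k)
                 + t j * ((1 - t i) * W i ?j k + t i * W ?i ?j k))
    + t k * ((1 - t j) * ((1 - t i) * W i j ?k + t i * W ?i j ?k)
                 + t j * ((1 - t i) * W i ?j ?k + t i * W ?i ?j ?k))"
  proof -
    define T where "T x1 y1 x2 y2 x3 y3 = (x2 - x1) * (y3 - y1) - (x3 - x1) * (y2 - y1)"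
      for x1 y1 x2 y2 x3 y3 :: real
    have T1: "T ((1-s)*x1+s*z1) ((1-s)*y1+s*w1) x2 y2 x3 y3 =
        (1-s) * T x1 y1 x2 y2 x3 y3 + s * T z1 w1 x2 y2 x3 y3"
      for s x1 y1 x2 y2 x3 y3 z1 w1 by (simp add: T_def algebra_simps)
    have T2: "T x1 y1 ((1-s)*x2+s*z1) ((1-s)*y2+s*w1) x3 y3 =
        (1-s) * T x1 y1 x2 y2 x3 y3 + s * T x1 y1 z1 w1 x3 y3"
      for s x1 y1 x2 y2 x3 y3 z1 w1 by (simp add: T_def algebra_simps)
    have T3: "T x1 y1 x2 y2 ((1-s)*x3+s*z1) ((1-s)*y3+s*w1) =
        (1-s) * T x1 y1 x2 y2 x3 y3 + s * T x1 y1 x2 y2 z1 w1"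
      for s x1 y1 x2 y2 x3 y3 z1 w1 by (simp add: T_def algebra_simps)
    have tT: "turn f g p q r = T (f p) (g p) (f q) (g q) (f r) (g r)" for f g p q r
      by (simp add: turn_def T_def)
    show ?thesis unfolding W_def tT split_step_def mods T1 T2 T3 ..
  qed
  also have "\<dots> > 0"
  proof -
    have t': "0 < t i" "t i < 1" "0 < t j" "t j < 1" "0 < t k" "t k < 1"
      using t ijk by auto
    have "0 < (1 - t k) * ((1 - t j) * ((1 - t i) * W i j k + t i * W ?i j k)
                 + t j * ((1 - t i) * W i ?j k + t i * W ?i ?j k))"
      using t' pos W by (intro mult_pos_pos add_pos_nonneg mult_nonneg_nonneg add_nonneg_nonneg) auto
    moreover have "0 \<le> t k * ((1 - t j) * ((1 - t i) * W i j ?k + t i * W ?i j ?k)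
                 + t j * ((1 - t i) * W i ?j ?k + t i * W ?i ?j ?k))"
      using t' W by (intro mult_nonneg_nonneg add_nonneg_nonneg) auto
    ultimately show ?thesis by linarith
  qed
  finally show "0 < turn (split_step d t a) (split_step d t b) i j k" .
qed

lemma ccw_split_seq:
  assumes "ccw d a b" "\<And>n j. j < d \<Longrightarrow> 0 < x (Suc n) j \<and> x (Suc n) j < 1"
  shows "ccw d (split_seq d x a n) (split_seq d x b n)"
  by (induction n) (auto intro!: ccw_split_step assms simp: assms)

text \<open>The polygon remains convex when either coordinate is perturbed by \<open>f / C\<close> in either direction.
  Expressed in this way, domination is inherited under subdivision with the same \<open>C\<close>, because
  convexity is and because subdivision is linear.\<close>

definition dominated :: "nat \<Rightarrow> real \<Rightarrow> (nat \<Rightarrow> real) \<Rightarrow> (nat \<Rightarrow> real) \<Rightarrow> (nat \<Rightarrow> real) \<Rightarrow> bool" where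
  "dominated d C a b f \<longleftrightarrow> ccw d a b \<and>
     (\<forall>s\<in>{1, -1}. ccw d (\<lambda>j. C * a j + s * f j) b \<and> ccw d a (\<lambda>j. C * b j + s * f j))"

lemma dominated_iff:
  "dominated d C a b f \<longleftrightarrow> (\<forall>i j k. i < j \<longrightarrow> j < k \<longrightarrow> k < d \<longrightarrow>
     0 < turn a b i j k \<and> \<bar>turn f b i j k\<bar> < C * turn a b i j k \<and> \<bar>turn a f i j k\<bar> < C * turn a b i j k)"
proof -
  have 1: "turn (\<lambda>j. C * a j + s * f j) b i j k = C * turn a b i j k + s * turn f b i j k" for s i j k
    by (simp add: turn_def algebra_simps)
  have 2: "turn a (\<lambda>j. C * b j + s * f j) i j k = C * turn a b i j k + s * turn a f i j k" for s i j k
    by (simp add: turn_def algebra_simps)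
  show ?thesis (is "?L \<longleftrightarrow> ?R")
  proof
    assume L: ?L
    show ?R
    proof (intro allI impI)
      fix i j k assume ijk: "i < j" "j < k" "k < d"
      have "0 < turn a b i j k" using L ijk by (simp add: dominated_def ccw_def)
      moreover have "0 < C * turn a b i j k + s * turn f b i j k"
        "0 < C * turn a b i j k + s * turn a f i j k" if "s \<in> {1, -1}" for s
      proof -
        have "ccw d (\<lambda>j. C * a j + s * f j) b" "ccw d a (\<lambda>j. C * b j + s * f j)"
          using L that unfolding dominated_def by blast+
        then show "0 < C * turn a b i j k + s * turn f b i j k"
          "0 < C * turn a b i j k + s * turn a f i j k"
          using ijk by (simp_all add: ccw_def flip: 1 2)
      qed
      from this[of 1] this[of "-1"] have "\<bar>turn f b i j k\<bar> < C * turn a b i j k"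
        "\<bar>turn a f i j k\<bar> < C * turn a b i j k" by auto
      ultimately show "0 < turn a b i j k \<and> \<bar>turn f b i j k\<bar> < C * turn a b i j k \<and>
        \<bar>turn a f i j k\<bar> < C * turn a b i j k" by blast
    qed
  next
    assume R: ?R
    have "0 < C * turn a b i j k + s * turn f b i j k" "0 < C * turn a b i j k + s * turn a f i j k"
      if "i < j" "j < k" "k < d" "s \<in> {1, -1}" for i j k s
    proof -
      have "\<bar>turn f b i j k\<bar> < C * turn a b i j k" "\<bar>turn a f i j k\<bar> < C * turn a b i j k"
        using R that by simp_all
      then show "0 < C * turn a b i j k + s * turn f b i j k"
        "0 < C * turn a b i j k + s * turn a f i j k" using that(4) by auto
    qed
    then have "ccw d (\<lambda>j. C * a j + s * f j) b" "ccw d a (\<lambda>j. C * b j + s * f j)"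
      if "s \<in> {1, -1}" for s
      unfolding ccw_def 1 2 using that by (metis (no_types))+
    moreover have "ccw d a b" using R by (simp add: ccw_def)
    ultimately show ?L unfolding dominated_def by blast
  qed
qed

text \<open>Small perturbations of a strictly convex polygon are convex: \<open>C\<close> only has to exceed finitely many
  quotients of areas.\<close>

lemma dominated_exists:
  assumes "ccw d a b"
  shows "\<exists>C. \<forall>C'\<ge>C. dominated d C' a b f"
proof -
  define q where "q = (\<lambda>(i, j, k). (\<bar>turn f b i j k\<bar> + \<bar>turn a f i j k\<bar>) / \<bar>turn a b i j k\<bar>)"
  define C where "C = 1 + (\<Sum>p\<in>{..<d}\<times>{..<d}\<times>{..<d}. q p)"
  have "dominated d C' a b f" if C': "C' \<ge> C" for C'
    unfolding dominated_iff
  proof (intro allI impI)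
    fix i j k assume ijk: "i < j" "j < k" "k < d"
    have pos: "0 < turn a b i j k" using assms ijk by (simp add: ccw_def)
    have "q (i, j, k) \<le> (\<Sum>p\<in>{..<d}\<times>{..<d}\<times>{..<d}. q p)"
      using ijk by (intro member_le_sum) (auto simp: q_def)
    then have "q (i, j, k) < C'" using C' by (simp add: C_def)
    then have "\<bar>turn f b i j k\<bar> + \<bar>turn a f i j k\<bar> < C' * turn a b i j k"
      using pos by (simp add: q_def field_simps)
    then show "0 < turn a b i j k \<and> \<bar>turn f b i j k\<bar> < C' * turn a b i j k \<and>
        \<bar>turn a f i j k\<bar> < C' * turn a b i j k" using pos by linarith
  qed
  then show ?thesis by blast
qed

lemma dominated_split_seq:
  assumes "dominated d C a b f" "\<And>n j. j < d \<Longrightarrow> 0 < x (Suc n) j \<and> x (Suc n) j < 1"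
  shows "dominated d C (split_seq d x a n) (split_seq d x b n) (split_seq d x f n)"
proof -
  note ccw = ccw_split_seq[where d = d and x = x and n = n, OF _ assms(2)]
  have "ccw d (split_seq d x (\<lambda>j. C * a j + s * f j) n) (split_seq d x b n)"
       "ccw d (split_seq d x a n) (split_seq d x (\<lambda>j. C * b j + s * f j) n)" if "s \<in> {1, -1}" for s
    using assms(1) that unfolding dominated_def by (blast intro: ccw)+
  moreover have "ccw d (split_seq d x a n) (split_seq d x b n)"
    using assms(1) unfolding dominated_def by (blast intro: ccw)
  ultimately show ?thesis unfolding dominated_def split_seq_lincomb by blast
qed

text \<open>The edge \<open>i\<close> belongs to a triangle of vertices.  On that triangle \<open>f\<close> is an affine function of the
  two coordinates, and by Cramer's rule its partial derivatives are the quotients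
  \<open>turn f b / turn a b\<close> and \<open>turn a f / turn a b\<close>, which domination bounds by \<open>C\<close>.\<close>

lemma dominated_edge:
  assumes dom: "dominated d C a b f" and d: "d \<ge> 3" and i: "Suc i < d"
  shows "\<bar>f (Suc i) - f i\<bar> \<le> C * (\<bar>a (Suc i) - a i\<bar> + \<bar>b (Suc i) - b i\<bar>)"
proof -
  obtain l m r where lmr: "l < m" "m < r" "r < d" "{i, Suc i} \<subseteq> {l, m, r}"
  proof (cases "Suc (Suc i) < d")
    case True
    then show ?thesis using that[of i "Suc i" "Suc (Suc i)"] by auto
  next
    case False
    then show ?thesis using that[of 0 i "Suc i"] i d by auto
  qed
  define w where "w = turn a b l m r"
  have cramer: "(f q - f p) * w = turn f b l m r * (a q - a p) + turn a f l m r * (b q - b p)"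
    if "p \<in> {l, m, r}" "q \<in> {l, m, r}" for p q
    using that unfolding w_def turn_def by (auto simp: algebra_simps)
  have w: "0 < w" "\<bar>turn f b l m r\<bar> \<le> C * w" "\<bar>turn a f l m r\<bar> \<le> C * w"
    using dom lmr unfolding dominated_iff w_def by (auto intro: less_imp_le)
  have "\<bar>f (Suc i) - f i\<bar> * w = \<bar>(f (Suc i) - f i) * w\<bar>"
    using w by (simp add: abs_mult)
  also have "\<dots> \<le> \<bar>turn f b l m r\<bar> * \<bar>a (Suc i) - a i\<bar> + \<bar>turn a f l m r\<bar> * \<bar>b (Suc i) - b i\<bar>"
    using lmr(4) by (subst cramer) (auto simp flip: abs_mult intro: abs_triangle_ineq)
  also have "\<dots> \<le> C * w * \<bar>a (Suc i) - a i\<bar> + C * w * \<bar>b (Suc i) - b i\<bar>"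
    using w by (intro add_mono mult_right_mono) auto
  also have "\<dots> = C * (\<bar>a (Suc i) - a i\<bar> + \<bar>b (Suc i) - b i\<bar>) * w"
    by (simp add: algebra_simps)
  finally show ?thesis using w(1) by simp
qed

section \<open>Convex polygons\<close>

text \<open>Seen from vertex \<open>i\<close>, all later vertices lie to the left of vertex \<open>i + 1\<close>, that is in a half-plane.
  There the relation of lying to the left is transitive, by the Pluecker relation between the
  signed areas, so that it extends from consecutive vertices to all pairs.\<close>

lemma ccw_of_sides:
  assumes side: "\<And>i k. Suc i < d \<Longrightarrow> k < d \<Longrightarrow> k \<noteq> i \<Longrightarrow> k \<noteq> Suc i \<Longrightarrow> 0 < turn a b i (Suc i) k"
  shows "ccw d a b"
  unfolding ccw_def
proof (intro allI impI)
  fix i j k assume "i < j" "j < k" "k < d"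
  have next_pos: "0 < turn a b i m (Suc m)" if "i < m" "Suc m < d" for m
    using side[of m i] that turn_cyclic[of a b m "Suc m" i] by (simp add: turn_cyclic)
  have "k < d \<longrightarrow> 0 < turn a b i j k"
    using \<open>j < k\<close>
  proof (induction k)
    case 0
    then show ?case by simp
  next
    case (Suc l)
    show ?case
    proof
      assume l: "Suc l < d"
      show "0 < turn a b i j (Suc l)"
      proof (cases "j = l")
        case True
        then show ?thesis using next_pos[of j] \<open>i < j\<close> l by simp
      next
        case False
        then have jl: "j < l" "0 < turn a b i j l" using Suc l by auto
        show ?thesis
        proof (cases "j = Suc i")
          case True
          then show ?thesis using side[of i "Suc l"] l jl by auto
        next
          case False
          then have j: "Suc i < j" using \<open>i < j\<close> by simp
          let ?u = "\<lambda>m. turn a b i (Suc i) m"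
          have u: "0 < ?u j" "0 < ?u l" "0 < ?u (Suc l)"
            using side[of i] j jl l by auto
          have "?u l * turn a b i j (Suc l) = ?u j * turn a b i l (Suc l) + ?u (Suc l) * turn a b i j l"
            by (simp add: turn_def algebra_simps)
          also have "\<dots> > 0"
            using u jl next_pos[of l] \<open>i < j\<close> l by (intro add_pos_pos mult_pos_pos) auto
          finally show ?thesis using u(2) by (simp add: zero_less_mult_iff)
        qed
      qed
    qed
  qed
  then show "0 < turn a b i j k" using \<open>k < d\<close> by blast
qed

text \<open>The line through a side supports the polygon and, vertices being extreme points, contains no third
  vertex.  So the other vertices lie strictly on one side of it, and two adjacent sides agree on
  which side this is because they span a common triangle.\<close>

lemma nondegenerate_convex_polygon_ccw:
  assumes d: "d \<ge> 3" and A: "nondegenerate_convex_polygon d A"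
  defines "a \<equiv> \<lambda>j. vec_nth (A j) 1" and "b \<equiv> \<lambda>j. vec_nth (A j) 2"
  shows "ccw d a b \<or> ccw d b a"
proof -
  let ?H = "convex hull (A ` {..<d})"
  have inj: "inj_on A {..<d}"
    and ext: "{x. x extreme_point_of ?H} = A ` {..<d}"
    and edge: "\<And>j. j < d \<Longrightarrow> closed_segment (A j) (A (Suc j mod d)) edge_of ?H"
    using A unfolding nondegenerate_convex_polygon_def by auto
  have poly: "polyhedron ?H"
    by (intro polyhedron_convex_hull) auto
  have side: "\<exists>c. \<forall>k<d. k \<noteq> j \<longrightarrow> k \<noteq> Suc j \<longrightarrow> 0 < c * turn a b j (Suc j) k"
    if j: "Suc j < d" for j
  proof -
    let ?E = "closed_segment (A j) (A (Suc j))"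
    have "?E face_of ?H" using edge[of j] j by (simp add: edge_of_def)
    then have "?E exposed_face_of ?H" using exposed_face_of_polyhedron[OF poly] by simp
    then obtain u m where um: "?H \<subseteq> {x. u \<bullet> x \<le> m}" "?E = ?H \<inter> {x. u \<bullet> x = m}"
      unfolding exposed_face_of_def by blast
    have on: "u \<bullet> A j = m" "u \<bullet> A (Suc j) = m" using um(2) by auto
    have off: "u \<bullet> A k < m" if k: "k < d" "k \<noteq> j" "k \<noteq> Suc j" for k
    proof (rule ccontr)
      assume "\<not> u \<bullet> A k < m"
      moreover have H: "A k \<in> ?H" using k by (intro hull_inc) auto
      ultimately have "A k \<in> ?E" using um by force
      moreover have "A k \<noteq> A j" "A k \<noteq> A (Suc j)"
        using inj k j by (auto dest: inj_onD)
      ultimately have "A k \<in> open_segment (A j) (A (Suc j))" by (simp add: open_segment_def)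
      moreover have "A k extreme_point_of ?H" using ext k by blast
      moreover have "A j \<in> ?H" "A (Suc j) \<in> ?H" using j by (auto intro!: hull_inc)
      ultimately show False unfolding extreme_point_of_def by blast
    qed
    define u1 u2 where "u1 = vec_nth u 1" and "u2 = vec_nth u 2"
    have inner: "u \<bullet> A k = u1 * a k + u2 * b k" for k
      by (simp add: inner_vec_def sum_2 u1_def u2_def a_def b_def)
    define e1 e2 where "e1 = a (Suc j) - a j" and "e2 = b (Suc j) - b j"
    have "0 < (u1 * e2 - u2 * e1) * turn a b j (Suc j) k"
      if k: "k < d" "k \<noteq> j" "k \<noteq> Suc j" for k
    proof -
      have perp: "u1 * e1 + u2 * e2 = 0"
        using on unfolding inner e1_def e2_def by (simp add: algebra_simps)
      have neg: "u1 * (a k - a j) + u2 * (b k - b j) < 0"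
        using on off[OF k] unfolding inner by (simp add: algebra_simps)
      have "A (Suc j) \<noteq> A j" using inj j by (auto dest: inj_onD)
      then have "e1 \<noteq> 0 \<or> e2 \<noteq> 0"
        by (auto simp: e1_def e2_def a_def b_def Finite_Cartesian_Product.vec_eq_iff forall_2)
      then have e: "0 < e1\<^sup>2 + e2\<^sup>2" by (simp add: sum_power2_gt_zero_iff)
      \<comment> \<open>The normal \<open>u\<close> is perpendicular to the side \<open>e\<close>, so that \<open>u \<bullet> v\<close> determines the cross product
        of \<open>e\<close> with \<open>v\<close> up to a factor of fixed sign (Lagrange's identity).\<close>
      have "(u1 * e2 - u2 * e1) * turn a b j (Suc j) k =
        (u1 * e1 + u2 * e2) * (e1 * (a k - a j) + e2 * (b k - b j))
        - (e1\<^sup>2 + e2\<^sup>2) * (u1 * (a k - a j) + u2 * (b k - b j))"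
        unfolding turn_def e1_def[symmetric] e2_def[symmetric]
        by (simp add: algebra_simps power2_eq_square)
      also have "\<dots> > 0" using e neg by (simp add: perp mult_pos_neg)
      finally show ?thesis .
    qed
    then show ?thesis by blast
  qed
  define c where "c j = (SOME c. \<forall>k<d. k \<noteq> j \<longrightarrow> k \<noteq> Suc j \<longrightarrow> 0 < c * turn a b j (Suc j) k)" for j
  have c: "0 < c j * turn a b j (Suc j) k" if "Suc j < d" "k < d" "k \<noteq> j" "k \<noteq> Suc j" for j k
    using someI_ex[OF side[OF that(1)]] that unfolding c_def by blast
  have sgn: "Suc j < d \<Longrightarrow> 0 < c j * c 0" for j
  proof (induction j)
    case 0
    have "c 0 \<noteq> 0" using c[of 0 2] d by auto
    then show ?case by (simp add: zero_less_mult_iff) linarith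
  next
    case (Suc j)
    define w where "w = turn a b j (Suc j) (Suc (Suc j))"
    have "0 < c j * w" using c[of j "Suc (Suc j)"] Suc.prems by (simp add: w_def)
    moreover have "0 < c (Suc j) * w"
      using c[of "Suc j" j] Suc.prems turn_cyclic[of a b "Suc j" "Suc (Suc j)" j]
      by (simp add: w_def turn_def algebra_simps)
    ultimately show ?case using Suc by (auto simp: zero_less_mult_iff)
  qed
  show ?thesis
  proof (cases "c 0 > 0")
    case True
    have "ccw d a b"
    proof (rule ccw_of_sides)
      fix i k assume ik: "Suc i < d" "k < d" "k \<noteq> i" "k \<noteq> Suc i"
      show "0 < turn a b i (Suc i) k"
        using c[OF ik] sgn[OF ik(1)] True by (auto simp: zero_less_mult_iff)
    qed
    then show ?thesis ..
  next
    case False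
    have "ccw d b a"
    proof (rule ccw_of_sides)
      fix i k assume ik: "Suc i < d" "k < d" "k \<noteq> i" "k \<noteq> Suc i"
      show "0 < turn b a i (Suc i) k"
        using c[OF ik] sgn[OF ik(1)] False turn_swap[of b a i "Suc i" k]
        by (auto simp: zero_less_mult_iff)
    qed
    then show ?thesis ..
  qed
qed

section \<open>The matrices of the subdivision\<close>

lemma step_mat_carrier [simp]: "step_mat d t \<in> carrier_mat (d - 1) (d - 1)"
  by (simp add: step_mat_def)

lemma step_mat_prod_carrier [simp]: "step_mat_prod d x n \<in> carrier_mat (d - 1) (d - 1)"
proof (induction n)
  case (Suc n)
  show ?case unfolding step_mat_prod.simps by (rule mult_carrier_mat[OF step_mat_carrier Suc])
qed simp

lemma step_mat_prod_add:
  "step_mat_prod d x (n + m) = step_mat_prod d (\<lambda>k. x (n + k)) m * step_mat_prod d x n"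
proof (induction m)
  case 0
  show ?case using left_mult_one_mat[OF step_mat_prod_carrier[of d x n]] by simp
next
  case (Suc m)
  then show ?case
    by (simp add: assoc_mult_mat[OF step_mat_carrier step_mat_prod_carrier step_mat_prod_carrier])
qed

text \<open>The differences along the first \<open>d - 1\<close> sides evolve by the matrices, whichever function on the
  vertices they come from.\<close>

lemma step_mat_prod_edges:
  assumes d: "d \<ge> 2"
  shows "mult_mat_vec (step_mat_prod d x n) (Matrix.vec (d - 1) (\<lambda>k. f (Suc k) - f k)) =
    Matrix.vec (d - 1) (\<lambda>k. split_seq d x f n (Suc k) - split_seq d x f n k)"
proof (induction n)
  case 0
  then show ?case by simp
next
  case (Suc n)
  define F where "F = split_seq d x f n"
  let ?t = "x (Suc n)"
  let ?e = "Matrix.vec (d - 1) (\<lambda>k. F (Suc k) - F k)"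
  have "mult_mat_vec (step_mat_prod d x (Suc n)) (Matrix.vec (d - 1) (\<lambda>k. f (Suc k) - f k)) =
    mult_mat_vec (step_mat d ?t) ?e"
    using Suc by (simp add: F_def
      assoc_mult_mat_vec[OF step_mat_carrier step_mat_prod_carrier])
  also have "\<dots> = Matrix.vec (d - 1) (\<lambda>k. split_step d ?t F (Suc k) - split_step d ?t F k)"
  proof (rule eq_vecI)
    fix j assume "j < dim_vec (Matrix.vec (d - 1) (\<lambda>k. split_step d ?t F (Suc k) - split_step d ?t F k))"
    then have j: "j < d - 1" by simp
    have tel: "(\<Sum>k<m. F (Suc k) - F k) = F m - F 0" for m
      by (rule sum_lessThan_telescope)
    show "vec_index (mult_mat_vec (step_mat d ?t) ?e) j =
      vec_index (Matrix.vec (d - 1) (\<lambda>k. split_step d ?t F (Suc k) - split_step d ?t F k)) j"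
    proof (cases "j = d - 2")
      case True
      then have "Suc j = d - 1" "Suc (Suc j) = d" using d j by auto
      then show ?thesis using j d True
        by (subst step_mat_mult_vec) (auto simp: split_step_def tel algebra_simps simp del: sum_subtractf)
    next
      case False
      then have "Suc (Suc j) < d" using j by simp
      then show ?thesis using j d False
        by (subst step_mat_mult_vec) (auto simp: split_step_def algebra_simps)
    qed
  qed (simp add: step_mat_def)
  finally show ?case by (simp add: F_def)
qed

lemma step_mat_prod_cong:
  assumes "d \<ge> 2" "\<And>k j. j < d \<Longrightarrow> x (Suc k) j = y (Suc k) j"
  shows "step_mat_prod d x n = step_mat_prod d y n"
proof -
  have "step_mat d (x (Suc k)) = step_mat d (y (Suc k))" for k
    unfolding step_mat_def using assms by (intro cong_mat) auto
  then show ?thesis by (induction n) simp_all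
qed

text \<open>The function whose differences along the first \<open>d - 1\<close> sides are the \<open>k\<close>-th unit vector.\<close>

definition unit_edge :: "nat \<Rightarrow> nat \<Rightarrow> real" where
  "unit_edge k j = (if k < j then 1 else 0)"

lemma step_mat_prod_index:
  assumes "d \<ge> 2" "i < d - 1" "k < d - 1"
  shows "step_mat_prod d x n $$ (i, k) =
    split_seq d x (unit_edge k) n (Suc i) - split_seq d x (unit_edge k) n i"
proof -
  have "Matrix.vec (d - 1) (\<lambda>l. unit_edge k (Suc l) - unit_edge k l) = unit_vec (d - 1) k"
    by (intro eq_vecI) (auto simp: unit_edge_def unit_vec_def)
  then have "mult_mat_vec (step_mat_prod d x n) (unit_vec (d - 1) k) =
    Matrix.vec (d - 1) (\<lambda>l. split_seq d x (unit_edge k) n (Suc l) - split_seq d x (unit_edge k) n l)"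
    using step_mat_prod_edges[OF assms(1), of x n "unit_edge k"] by simp
  moreover have "vec_index (mult_mat_vec (step_mat_prod d x n) (unit_vec (d - 1) k)) i =
      step_mat_prod d x n $$ (i, k)"
    using assms step_mat_prod_carrier[of d x n] by (simp add: scalar_prod_right_unit)
  ultimately show ?thesis using assms(2) by simp
qed

lemma entry_norm_step_mat_prod:
  assumes "d \<ge> 2"
  shows "entry_norm (step_mat_prod d x n) = (\<Sum>k<d-1. \<Sum>i<d-1.
     \<bar>split_seq d x (unit_edge k) n (Suc i) - split_seq d x (unit_edge k) n i\<bar>)"
  using step_mat_prod_carrier[of d x n] assms
  by (subst sum.swap) (simp add: entry_norm_def step_mat_prod_index)

lemma edge_le_entry_norm:
  assumes "d \<ge> 2" "i < d - 1" and K: "\<And>k. k < d - 1 \<Longrightarrow> \<bar>f (Suc k) - f k\<bar> \<le> K"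
  shows "\<bar>split_seq d x f n (Suc i) - split_seq d x f n i\<bar> \<le> entry_norm (step_mat_prod d x n) * K"
proof -
  let ?B = "step_mat_prod d x n"
  note dims = carrier_matD[OF step_mat_prod_carrier[of d x n]]
  have K0: "0 \<le> K" using K[OF assms(2)] by linarith
  have "split_seq d x f n (Suc i) - split_seq d x f n i =
    vec_index (mult_mat_vec ?B (Matrix.vec (d - 1) (\<lambda>k. f (Suc k) - f k))) i"
    unfolding step_mat_prod_edges[OF assms(1)] using assms(2) by simp
  also have "\<dots> = (\<Sum>k<d-1. ?B $$ (i, k) * (f (Suc k) - f k))"
    using assms(2) dims by (simp add: scalar_prod_def atLeast0LessThan)
  also have "\<bar>\<dots>\<bar> \<le> (\<Sum>k<d-1. \<bar>?B $$ (i, k)\<bar> * K)"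
    by (rule order.trans[OF sum_abs]) (auto intro!: sum_mono mult_left_mono K simp: abs_mult)
  also have "\<dots> \<le> entry_norm ?B * K"
    unfolding sum_distrib_right[symmetric] entry_norm_def dims
    by (rule mult_right_mono[OF _ K0], rule member_le_sum[of i _ "\<lambda>i. \<Sum>k<d-1. \<bar>?B $$ (i, k)\<bar>"])
      (use assms(2) in \<open>auto intro: sum_nonneg\<close>)
  finally show ?thesis .
qed

section \<open>Expansion of edges\<close>

lemma bij_betw_cyclic_shift: "bij_betw (\<lambda>i. (j + i) mod d) {..<d} {..<d :: nat}"
proof (cases "d = 0")
  case False
  have "inj_on (\<lambda>i. (j + i) mod d) {..<d}"
  proof (rule linorder_inj_onI)
    fix i k assume ik: "i < k" "i \<in> {..<d}" "k \<in> {..<d}"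
    show "(j + i) mod d \<noteq> (j + k) mod d"
    proof
      assume "(j + i) mod d = (j + k) mod d"
      then have "d dvd (j + k) - (j + i)"
        using ik mod_eq_dvd_iff_nat[of "j + i" "j + k" d] by simp
      then show False using ik by (auto dest: dvd_imp_le)
    qed
  qed auto
  moreover have "(\<lambda>i. (j + i) mod d) ` {..<d} \<subseteq> {..<d}" using False by auto
  ultimately show ?thesis
    by (simp add: bij_betw_def endo_inj_surj)
qed (simp add: bij_betw_def)

text \<open>The determinant of \<open>step_mat d t\<close>.\<close>

definition split_det :: "nat \<Rightarrow> (nat \<Rightarrow> real) \<Rightarrow> real" where
  "split_det d t = (\<Prod>i<d. 1 - t i) - (- 1) ^ d * (\<Prod>i<d. t i)"

lemma abs_split_det_le_1:
  assumes "d > 0" "\<And>j. j < d \<Longrightarrow> 0 \<le> t j \<and> t j \<le> 1"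
  shows "\<bar>split_det d t\<bar> \<le> 1"
proof -
  have le: "(\<Prod>i<d. t i) \<le> t 0" "(\<Prod>i<d. 1 - t i) \<le> 1 - t 0"
    using assms by (auto simp: prod.remove[of "{..<d}" 0] intro!: mult_left_le prod_le_1)
  have nn: "0 \<le> (\<Prod>i<d. t i)" "0 \<le> (\<Prod>i<d. 1 - t i)"
    using assms by (auto intro!: prod_nonneg)
  have "\<bar>split_det d t\<bar> \<le> \<bar>\<Prod>i<d. 1 - t i\<bar> + \<bar>(- 1) ^ d * (\<Prod>i<d. t i)\<bar>"
    unfolding split_det_def by (rule abs_triangle_ineq4)
  also have "\<dots> = (\<Prod>i<d. 1 - t i) + (\<Prod>i<d. t i)" using nn by (simp add: abs_mult power_abs)
  finally show ?thesis using le by linarith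
qed

text \<open>Let \<open>E\<^sub>j\<close> be the differences of \<open>F\<close> and \<open>y\<^sub>j = (1 - t\<^sub>j) E\<^sub>j + t\<^sub>j\<^sub>+\<^sub>1 E\<^sub>j\<^sub>+\<^sub>1\<close> those of its subdivision.
  Solving for \<open>E\<^sub>j\<close> successively in terms of \<open>E\<^sub>j\<^sub>+\<^sub>1\<close>, \<open>E\<^sub>j\<^sub>+\<^sub>2\<close> and so on, once around the polygon,
  expresses \<open>split_det d t * E\<^sub>j\<close> by the \<open>y\<^sub>i\<close> with coefficients in \<open>[-1, 1]\<close>.  The factor \<open>2\<close> comes from
  the last side, whose difference is minus the sum of the others.\<close>

lemma edge_expansion:
  fixes t F :: "nat \<Rightarrow> real"
  assumes d: "d \<ge> 2" and t: "\<And>j. j < d \<Longrightarrow> 0 \<le> t j \<and> t j \<le> 1" and j: "j < d - 1"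
  shows "\<bar>split_det d t\<bar> * \<bar>F (Suc j) - F j\<bar> \<le>
    2 * (\<Sum>i<d-1. \<bar>split_step d t F (Suc i) - split_step d t F i\<bar>)"
proof -
  have d0: "0 < d" using d by simp
  define \<tau> where "\<tau> k = t (k mod d)" for k
  define E where "E k = F (Suc k mod d) - F (k mod d)" for k
  define G where "G = split_step d t F"
  define y where "y k = (1 - \<tau> k) * E k + \<tau> (Suc k) * E (Suc k)" for k
  have \<tau>: "0 \<le> \<tau> k" "\<tau> k \<le> 1" for k using t[of "k mod d"] d0 by (auto simp: \<tau>_def)
  have y: "y k = G (Suc k mod d) - G (k mod d)" for k
    by (simp add: y_def G_def split_step_def E_def \<tau>_def mod_Suc_eq algebra_simps)
  have P: "0 \<le> (\<Prod>i<k. \<tau> (j + Suc i)) \<and> (\<Prod>i<k. \<tau> (j + Suc i)) \<le> 1" for k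
    using \<tau> by (auto intro: prod_nonneg prod_le_1)
  have main: "\<bar>(\<Prod>i<k. 1 - \<tau> (j + i)) * E j - (- 1) ^ k * (\<Prod>i<k. \<tau> (j + Suc i)) * E (j + k)\<bar>
      \<le> (\<Sum>i<k. \<bar>y (j + i)\<bar>)" for k
  proof (induction k)
    case 0
    then show ?case by simp
  next
    case (Suc k)
    let ?X = "\<lambda>k. (\<Prod>i<k. 1 - \<tau> (j + i)) * E j - (- 1) ^ k * (\<Prod>i<k. \<tau> (j + Suc i)) * E (j + k)"
    have "?X (Suc k) = (1 - \<tau> (j + k)) * ?X k + (- 1) ^ k * (\<Prod>i<k. \<tau> (j + Suc i)) * y (j + k)"
      by (simp add: y_def algebra_simps)
    also have "\<bar>\<dots>\<bar> \<le> \<bar>1 - \<tau> (j + k)\<bar> * \<bar>?X k\<bar> + \<bar>\<Prod>i<k. \<tau> (j + Suc i)\<bar> * \<bar>y (j + k)\<bar>"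
      by (rule order.trans[OF abs_triangle_ineq]) (simp add: abs_mult power_abs)
    also have "\<dots> \<le> 1 * \<bar>?X k\<bar> + 1 * \<bar>y (j + k)\<bar>"
      using \<tau>[of "j + k"] P[of k] by (intro add_mono mult_right_mono) auto
    finally show ?case using Suc by simp
  qed
  have shift: "(\<Prod>i<d. g ((k + i) mod d)) = (\<Prod>i<d. g i)" for g :: "nat \<Rightarrow> real" and k
    by (rule prod.reindex_bij_betw[OF bij_betw_cyclic_shift])
  have sshift: "(\<Sum>i<d. g ((k + i) mod d)) = (\<Sum>i<d. g i)" for g :: "nat \<Rightarrow> real" and k
    by (rule sum.reindex_bij_betw[OF bij_betw_cyclic_shift])
  have "(\<Prod>i<d. 1 - \<tau> (j + i)) = (\<Prod>i<d. 1 - t i)" "(\<Prod>i<d. \<tau> (j + Suc i)) = (\<Prod>i<d. t i)"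
    using shift[of "\<lambda>i. 1 - t i" j] shift[of t "Suc j"] by (simp_all add: \<tau>_def)
  moreover have Ej: "E (j + d) = E j" by (simp add: E_def flip: add_Suc)
  ultimately have "(\<Prod>i<d. 1 - \<tau> (j + i)) * E j - (- 1) ^ d * (\<Prod>i<d. \<tau> (j + Suc i)) * E (j + d)
      = split_det d t * E j" by (simp add: split_det_def algebra_simps)
  then have "\<bar>split_det d t\<bar> * \<bar>E j\<bar> \<le> (\<Sum>i<d. \<bar>y (j + i)\<bar>)"
    using main[of d] by (simp add: abs_mult)
  also have "\<dots> = (\<Sum>i<d. \<bar>y i\<bar>)"
    using sshift[of "\<lambda>i. \<bar>y i\<bar>" j] by (simp add: y mod_Suc_eq)
  also have "\<dots> = (\<Sum>i<d-1. \<bar>y i\<bar>) + \<bar>y (d - 1)\<bar>"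
    using d sum.lessThan_Suc[of "\<lambda>i. \<bar>y i\<bar>" "d - 1"] by simp
  also have "\<bar>y (d - 1)\<bar> \<le> (\<Sum>i<d-1. \<bar>y i\<bar>)"
  proof -
    have "(\<Sum>i<d-1. y i) = (\<Sum>i<d-1. G (Suc i) - G i)" by (intro sum.cong) (auto simp: y)
    also have "\<dots> = G (d - 1) - G 0" by (rule sum_lessThan_telescope)
    also have "\<dots> = - y (d - 1)" using d by (simp add: y)
    finally have "\<bar>y (d - 1)\<bar> = \<bar>\<Sum>i<d-1. y i\<bar>" by simp
    then show ?thesis using sum_abs[of y "{..<d-1}"] by simp
  qed
  finally have "\<bar>split_det d t\<bar> * \<bar>E j\<bar> \<le> 2 * (\<Sum>i<d-1. \<bar>y i\<bar>)" by simp
  moreover have "E j = F (Suc j) - F j" using j by (simp add: E_def)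
  moreover have "(\<Sum>i<d-1. \<bar>y i\<bar>) = (\<Sum>i<d-1. \<bar>G (Suc i) - G i\<bar>)"
    by (intro sum.cong) (auto simp: y)
  ultimately show ?thesis by (simp add: G_def)
qed

lemma entry_norm_expansion:
  assumes d: "d \<ge> 2" and t: "\<And>j. j < d \<Longrightarrow> 0 \<le> x (Suc n) j \<and> x (Suc n) j \<le> 1"
  shows "\<bar>split_det d (x (Suc n))\<bar> * entry_norm (step_mat_prod d x n) \<le>
    2 * real d * entry_norm (step_mat_prod d x (Suc n))"
proof -
  let ?F = "\<lambda>n k. split_seq d x (unit_edge k) n"
  let ?S = "\<lambda>k. \<Sum>i<d-1. \<bar>?F (Suc n) k (Suc i) - ?F (Suc n) k i\<bar>"
  have "\<bar>split_det d (x (Suc n))\<bar> * entry_norm (step_mat_prod d x n) =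
    (\<Sum>k<d-1. \<Sum>i<d-1. \<bar>split_det d (x (Suc n))\<bar> * \<bar>?F n k (Suc i) - ?F n k i\<bar>)"
    by (simp only: entry_norm_step_mat_prod[OF d] sum_distrib_left)
  also have "\<dots> \<le> (\<Sum>k<d-1. \<Sum>i<d-1. 2 * ?S k)"
    using edge_expansion[OF d t] by (intro sum_mono) auto
  also have "\<dots> = 2 * real (d - 1) * (\<Sum>k<d-1. ?S k)"
  proof -
    have "(\<Sum>k<d-1. \<Sum>i<d-1. 2 * ?S k) = (\<Sum>k<d-1. 2 * real (d - 1) * ?S k)"
      by (simp only: sum_constant card_lessThan mult_ac)
    then show ?thesis by (simp only: sum_distrib_left)
  qed
  also have "\<dots> \<le> 2 * real d * (\<Sum>k<d-1. ?S k)"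
    by (intro mult_right_mono sum_nonneg) auto
  also have "(\<Sum>k<d-1. ?S k) = entry_norm (step_mat_prod d x (Suc n))"
    by (simp only: entry_norm_step_mat_prod[OF d])
  finally show ?thesis .
qed

lemma entry_norm_step_mat_prod_ge:
  assumes d: "d \<ge> 2" and t: "\<And>n j. j < d \<Longrightarrow> 0 \<le> x (Suc n) j \<and> x (Suc n) j \<le> 1"
  shows "(\<Prod>k<n. \<bar>split_det d (x (Suc k))\<bar> / (2 * real d)) \<le> entry_norm (step_mat_prod d x n)"
proof (induction n)
  case 0
  have "1 \<le> real (d - 1)" using d by simp
  also have "\<dots> = entry_norm (step_mat_prod d x 0)"
    by (simp add: entry_norm_def if_distrib[of abs] cong: if_cong)
  finally show ?case by simp
next
  case (Suc n)
  let ?c = "\<bar>split_det d (x (Suc n))\<bar>"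
  have "(\<Prod>k<Suc n. \<bar>split_det d (x (Suc k))\<bar> / (2 * real d)) \<le>
      entry_norm (step_mat_prod d x n) * (?c / (2 * real d))"
    using Suc by (simp only: prod.lessThan_Suc) (intro mult_right_mono, auto)
  also have "\<dots> \<le> entry_norm (step_mat_prod d x (Suc n))"
    using entry_norm_expansion[OF d, of x n] t d by (simp add: field_simps)
  finally show ?case .
qed

section \<open>Contraction of oscillations\<close>

lemma split_step_between:
  assumes "\<And>j. j < d \<Longrightarrow> 0 \<le> t j \<and> t j \<le> 1" "\<And>j. j < d \<Longrightarrow> m \<le> F j \<and> F j \<le> M" "j < d"
  shows "m \<le> split_step d t F j \<and> split_step d t F j \<le> M"
proof -
  have "Suc j mod d < d" using assms(3) by simp
  then have F: "m \<le> F j" "F j \<le> M" "m \<le> F (Suc j mod d)" "F (Suc j mod d) \<le> M"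
    and t: "0 \<le> t j" "0 \<le> 1 - t j"
    using assms by auto
  have "(1 - t j) * m + t j * m \<le> split_step d t F j"
    unfolding split_step_def using F t by (intro add_mono mult_left_mono) auto
  moreover have "split_step d t F j \<le> (1 - t j) * M + t j * M"
    unfolding split_step_def using F t by (intro add_mono mult_left_mono) auto
  ultimately show ?thesis by (simp add: algebra_simps)
qed

lemma split_seq_between:
  assumes "\<And>n j. j < d \<Longrightarrow> 0 \<le> x (Suc n) j \<and> x (Suc n) j \<le> 1"
    "\<And>j. j < d \<Longrightarrow> m \<le> f j \<and> f j \<le> M" "j < d"
  shows "m \<le> split_seq d x f n j \<and> split_seq d x f n j \<le> M"
  using assms(3)
proof (induction n arbitrary: j)
  case (Suc n)
  show ?case unfolding split_seq.simps
    by (rule split_step_between[OF assms(1) Suc.IH Suc.prems])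
qed (use assms in auto)

lemma entry_norm_step_mat_prod_le:
  assumes d: "d \<ge> 2" and t: "\<And>n j. j < d \<Longrightarrow> 0 \<le> x (Suc n) j \<and> x (Suc n) j \<le> 1"
  shows "entry_norm (step_mat_prod d x n) \<le> (real d)\<^sup>2"
proof -
  have "\<bar>split_seq d x (unit_edge k) n (Suc i) - split_seq d x (unit_edge k) n i\<bar> \<le> 1"
    if "i < d - 1" for i k
  proof -
    have "0 \<le> split_seq d x (unit_edge k) n j \<and> split_seq d x (unit_edge k) n j \<le> 1" if "j < d" for j
      using t _ that by (rule split_seq_between) (auto simp: unit_edge_def)
    from this[of i] this[of "Suc i"] that show ?thesis by (auto simp: less_diff_conv)
  qed
  then have "entry_norm (step_mat_prod d x n) \<le> (\<Sum>k<d-1. \<Sum>i<d-1. 1)"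
    unfolding entry_norm_step_mat_prod[OF d] by (intro sum_mono) auto
  also have "\<dots> = real (d - 1) * real (d - 1)" by (simp only: sum_constant card_lessThan mult_1_right)
  also have "\<dots> \<le> (real d)\<^sup>2" unfolding power2_eq_square by (intro mult_mono) auto
  finally show ?thesis .
qed

text \<open>The norm of a function on the vertices modulo constants that subdivision never increases.\<close>

definition osc :: "nat \<Rightarrow> (nat \<Rightarrow> real) \<Rightarrow> real" where
  "osc d f = Max (f ` {..<d}) - Min (f ` {..<d})"

lemma osc_le:
  assumes "d > 0" "\<And>j. j < d \<Longrightarrow> m \<le> f j \<and> f j \<le> M"
  shows "osc d f \<le> M - m"
proof -
  have "Max (f ` {..<d}) \<le> M" "m \<le> Min (f ` {..<d})"
    using assms by (subst Max_le_iff Min_ge_iff; fastforce)+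
  then show ?thesis by (simp add: osc_def)
qed

lemma range_bounds: "j < d \<Longrightarrow> Min (f ` {..<d}) \<le> f j \<and> f j \<le> Max (f ` {..<d :: nat})" for f :: "nat \<Rightarrow> real"
  by auto

lemma diff_le_osc: "i < d \<Longrightarrow> j < d \<Longrightarrow> \<bar>f i - f j\<bar> \<le> osc d f"
  using range_bounds[of i d f] range_bounds[of j d f] unfolding osc_def by linarith

lemma osc_le_edges:
  assumes "d > 0"
  shows "osc d f \<le> (\<Sum>i<d-1. \<bar>f (Suc i) - f i\<bar>)"
proof -
  have *: "\<bar>f j - f i\<bar> \<le> (\<Sum>i<d-1. \<bar>f (Suc i) - f i\<bar>)" if "i \<le> j" "j < d" for i j
  proof -
    have "f j - f i = (\<Sum>k\<in>{i..<j}. f (Suc k) - f k)" using that by (simp add: sum_Suc_diff')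
    also have "\<bar>\<dots>\<bar> \<le> (\<Sum>k\<in>{i..<j}. \<bar>f (Suc k) - f k\<bar>)" by (rule sum_abs)
    also have "\<dots> \<le> (\<Sum>k<d-1. \<bar>f (Suc k) - f k\<bar>)"
      using that by (intro sum_mono2) auto
    finally show ?thesis .
  qed
  have "Max (f ` {..<d}) \<in> f ` {..<d}" "Min (f ` {..<d}) \<in> f ` {..<d}"
    using assms by (auto intro!: Max_in Min_in)
  then obtain i j where ij: "i < d" "j < d" "Max (f ` {..<d}) = f i" "Min (f ` {..<d}) = f j" by auto
  show ?thesis using *[of i j] *[of j i] ij unfolding osc_def by (cases "i \<le> j") auto
qed

lemma osc_split_seq_antimono:
  assumes d: "d > 0" and t: "\<And>n j. j < d \<Longrightarrow> 0 \<le> x (Suc n) j \<and> x (Suc n) j \<le> 1"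
  shows "decseq (\<lambda>n. osc d (split_seq d x f n))"
proof (rule decseq_SucI)
  fix n
  show "osc d (split_seq d x f (Suc n)) \<le> osc d (split_seq d x f n)"
    unfolding osc_def[of d "split_seq d x f n"]
    unfolding split_seq.simps by (rule osc_le[OF d split_step_between[OF t range_bounds]])
qed

text \<open>Let the maximum be attained at vertex \<open>p\<close>.  In each step it is passed on to the preceding vertex,
  keeping at least the fraction \<open>\<eta>\<close> of its excess over the minimum.  After \<open>d - 1\<close> steps every vertex
  has received such a share, which lifts the minimum.\<close>

lemma osc_contraction:
  assumes d: "d > 0" and t: "\<And>n j. j < d \<Longrightarrow> 0 \<le> x (Suc n) j \<and> x (Suc n) j \<le> 1"
    and \<eta>: "0 \<le> \<eta>" "\<And>k j. k < d - 1 \<Longrightarrow> j < d \<Longrightarrow> \<eta> \<le> x (Suc k) j \<and> x (Suc k) j \<le> 1 - \<eta>"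
  shows "osc d (split_seq d x f (d - 1)) \<le> (1 - \<eta> ^ (d - 1)) * osc d f"
proof -
  let ?F = "split_seq d x f"
  define m where "m = Min (f ` {..<d})"
  define M where "M = Max (f ` {..<d})"
  have "M \<in> f ` {..<d}" unfolding M_def using d by (intro Max_in) auto
  then obtain p where p: "p < d" "f p = M" by auto
  define \<Delta> where "\<Delta> = M - m"
  have btw: "m \<le> ?F k j \<and> ?F k j \<le> M" if "j < d" for k j
    unfolding m_def M_def by (rule split_seq_between[where x = x and f = f, OF t range_bounds that])
  have \<Delta>: "0 \<le> \<Delta>" using btw[OF d, of 0] by (simp add: \<Delta>_def)
  have main: "k \<le> d - 1 \<Longrightarrow> j < d \<Longrightarrow> r \<le> k \<Longrightarrow> (j + r) mod d = p \<Longrightarrow> m + \<eta> ^ k * \<Delta> \<le> ?F k j"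
    for k j r
  proof (induction k arbitrary: j r)
    case 0
    then show ?case using p by (simp add: \<Delta>_def)
  next
    case (Suc k)
    let ?t = "x (Suc k) j" and ?j = "Suc j mod d"
    have tj: "\<eta> \<le> ?t" "\<eta> \<le> 1 - ?t" "0 \<le> ?t" "0 \<le> 1 - ?t"
      using \<eta>(2)[of k j] t[of j k] Suc.prems by auto
    have jd: "?j < d" using d by simp
    have e0: "0 \<le> \<eta> ^ k * \<Delta>" using \<eta> \<Delta> by simp
    have eq: "?F (Suc k) j = (1 - ?t) * ?F k j + ?t * ?F k ?j"
      by (simp add: split_step_def)
    show ?case
    proof (cases "r = 0")
      case True
      then have "m + \<eta> ^ k * \<Delta> \<le> ?F k j" using Suc.IH[of j 0] Suc.prems by simp
      then have "(1 - ?t) * (m + \<eta> ^ k * \<Delta>) + ?t * m \<le> ?F (Suc k) j"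
        unfolding eq using tj btw[OF jd] by (intro add_mono mult_left_mono) auto
      moreover have "\<eta> * (\<eta> ^ k * \<Delta>) \<le> (1 - ?t) * (\<eta> ^ k * \<Delta>)"
        using tj e0 by (intro mult_right_mono)
      ultimately show ?thesis by (simp add: algebra_simps)
    next
      case False
      then have "Suc j + (r - 1) = j + r" by simp
      then have "(?j + (r - 1)) mod d = p"
        using Suc.prems mod_add_left_eq[of "Suc j" d "r - 1"] by metis
      then have "m + \<eta> ^ k * \<Delta> \<le> ?F k ?j"
        using Suc.IH[OF _ jd, of "r - 1"] Suc.prems by simp
      then have "(1 - ?t) * m + ?t * (m + \<eta> ^ k * \<Delta>) \<le> ?F (Suc k) j"
        unfolding eq using tj btw[OF Suc.prems(2)] by (intro add_mono mult_left_mono) auto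
      moreover have "\<eta> * (\<eta> ^ k * \<Delta>) \<le> ?t * (\<eta> ^ k * \<Delta>)"
        using tj e0 by (intro mult_right_mono)
      ultimately show ?thesis by (simp add: algebra_simps)
    qed
  qed
  have "m + \<eta> ^ (d - 1) * \<Delta> \<le> ?F (d - 1) j" if j: "j < d" for j
  proof (rule main[of "d - 1" j "(p + d - j) mod d"])
    have "(j + (p + d - j) mod d) mod d = (p + d) mod d"
      using j by (simp add: mod_add_right_eq)
    then show "(j + (p + d - j) mod d) mod d = p" using p by simp
    show "(p + d - j) mod d \<le> d - 1" using d by (simp add: less_imp_le_nat Suc_leI flip: less_Suc_eq_le)
  qed (use j in auto)
  then have "osc d (?F (d - 1)) \<le> M - (m + \<eta> ^ (d - 1) * \<Delta>)"
    using btw by (intro osc_le[OF d]) auto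
  also have "\<dots> = (1 - \<eta> ^ (d - 1)) * osc d f"
    by (simp add: osc_def \<Delta>_def algebra_simps flip: m_def M_def)
  finally show ?thesis .
qed

text \<open>The oscillations decrease to some limit; if it were positive, a sufficiently late contracting
  window would bring them below it.\<close>

lemma osc_tendsto_zero:
  assumes d: "d > 0" and t: "\<And>n j. j < d \<Longrightarrow> 0 \<le> x (Suc n) j \<and> x (Suc n) j \<le> 1"
    and \<eta>: "0 < \<eta>"
    and good: "\<And>N. \<exists>k\<ge>N. \<forall>i<d-1. \<forall>j<d. \<eta> \<le> x (Suc (k + i)) j \<and> x (Suc (k + i)) j \<le> 1 - \<eta>"
  shows "(\<lambda>n. osc d (split_seq d x f n)) \<longlonglongrightarrow> 0"
proof -
  let ?o = "\<lambda>n. osc d (split_seq d x f n)"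
  have dec: "decseq ?o" by (rule osc_split_seq_antimono[where x = x, OF d t])
  have nn: "0 \<le> ?o n" for n using diff_le_osc[OF d d, of "split_seq d x f n"] by simp
  obtain L where L: "?o \<longlonglongrightarrow> L" "\<And>n. L \<le> ?o n"
    using decseq_convergent[OF dec, of 0] nn by blast
  define \<delta> where "\<delta> = \<eta> ^ (d - 1)"
  have \<delta>: "0 < \<delta>" using \<eta> by (simp add: \<delta>_def)
  have "L \<le> 0"
  proof (rule ccontr)
    assume "\<not> L \<le> 0"
    then have "L < L + \<delta> * L / 2" using \<delta> by simp
    then have "\<forall>\<^sub>F n in sequentially. ?o n < L + \<delta> * L / 2" by (rule order_tendstoD(2)[OF L(1)])
    then obtain N where N: "\<And>n. n \<ge> N \<Longrightarrow> ?o n < L + \<delta> * L / 2" by (auto simp: eventually_sequentially)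
    obtain k where k: "k \<ge> N" "\<forall>i<d-1. \<forall>j<d. \<eta> \<le> x (Suc (k + i)) j \<and> x (Suc (k + i)) j \<le> 1 - \<eta>"
      using good by blast
    have "?o (k + (d - 1)) \<le> (1 - \<delta>) * ?o k"
      unfolding split_seq_add \<delta>_def
    proof (rule osc_contraction[OF d])
      show "0 \<le> x (k + Suc n) j \<and> x (k + Suc n) j \<le> 1" if "j < d" for n j
        using t[OF that, of "k + n"] by simp
    qed (use k \<eta> in auto)
    moreover have "\<eta> \<le> 1 - \<eta>" if "d - 1 > 0" using k(2) d that by fastforce
    then have "\<delta> \<le> 1" using \<eta> by (cases "d - 1 > 0") (auto simp: \<delta>_def intro!: power_le_one)
    then have "(1 - \<delta>) * ?o k \<le> (1 - \<delta>) * (L + \<delta> * L / 2)"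
      using N[OF k(1)] by (intro mult_left_mono) auto
    moreover have "(1 - \<delta>) * (L + \<delta> * L / 2) < L"
    proof -
      have "(1 - \<delta>) * (L + \<delta> * L / 2) = L - \<delta> * L / 2 - \<delta> * \<delta> * L / 2" by (simp add: field_simps)
      moreover have "0 < \<delta> * L" "0 < \<delta> * \<delta> * L" using \<delta> \<open>\<not> L \<le> 0\<close> by auto
      ultimately show ?thesis by linarith
    qed
    ultimately show False using L(2)[of "k + (d - 1)"] by linarith
  qed
  moreover have "0 \<le> L" using nn by (intro LIMSEQ_le_const[OF L(1)]) auto
  ultimately show ?thesis using L(1) by simp
qed

section \<open>Comparison of the polygon with the matrix product\<close>

text \<open>The ranges of the successive functions are nested intervals whose lengths are the oscillations.\<close>

lemma split_seq_converges:
  fixes f :: "nat \<Rightarrow> real"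
  assumes d: "d > 0" and t: "\<And>n j. j < d \<Longrightarrow> 0 \<le> x (Suc n) j \<and> x (Suc n) j \<le> 1"
    and osc: "(\<lambda>n. osc d (split_seq d x f n)) \<longlonglongrightarrow> 0"
  shows "\<exists>c. (\<forall>j<d. (\<lambda>n. split_seq d x f n j) \<longlonglongrightarrow> c) \<and>
    (\<forall>n. \<forall>j<d. \<bar>c - split_seq d x f n j\<bar> \<le> osc d (split_seq d x f n))"
proof -
  let ?F = "split_seq d x f"
  have btw: "Min (?F n ` {..<d}) \<le> ?F m j \<and> ?F m j \<le> Max (?F n ` {..<d})" if "n \<le> m" "j < d" for n m j
  proof -
    have "?F m = split_seq d (\<lambda>k. x (n + k)) (?F n) (m - n)"
      using split_seq_add[of d x f n "m - n"] that by simp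
    moreover have "0 \<le> x (n + Suc k) i \<and> x (n + Suc k) i \<le> 1" if "i < d" for k i
      using t[OF that, of "n + k"] by simp
    ultimately show ?thesis
      using split_seq_between[where x = "\<lambda>k. x (n + k)" and f = "?F n", OF _ range_bounds that(2)]
      by presburger
  qed
  have diff: "\<bar>?F m i - ?F n j\<bar> \<le> osc d (?F n)" if "n \<le> m" "i < d" "j < d" for n m i j
    using btw[of n m i] btw[of n n j] that unfolding osc_def by linarith
  have "Cauchy (\<lambda>n. ?F n 0)"
  proof (rule metric_CauchyI)
    fix e :: real assume "0 < e"
    then have "\<forall>\<^sub>F n in sequentially. osc d (?F n) < e / 2"
      using order_tendstoD(2)[OF osc, of "e / 2"] by simp
    then obtain N where N: "osc d (?F N) < e / 2"
      by (auto simp: eventually_sequentially)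
    have "dist (?F m 0) (?F n 0) < e" if "m \<ge> N" "n \<ge> N" for m n
      using diff[of N m 0 0] diff[of N n 0 0] that d N unfolding dist_real_def by linarith
    then show "\<exists>M. \<forall>m\<ge>M. \<forall>n\<ge>M. dist (?F m 0) (?F n 0) < e" by blast
  qed
  then obtain c where c: "(\<lambda>n. ?F n 0) \<longlonglongrightarrow> c"
    using Cauchy_convergent[of "\<lambda>n. ?F n 0"] by (auto simp: convergent_def)
  have bd: "\<bar>c - ?F n j\<bar> \<le> osc d (?F n)" if j: "j < d" for n j
  proof (rule LIMSEQ_le_const2)
    show "(\<lambda>m. \<bar>?F m 0 - ?F n j\<bar>) \<longlonglongrightarrow> \<bar>c - ?F n j\<bar>"
      by (intro tendsto_intros c)
    show "\<exists>N. \<forall>m\<ge>N. \<bar>?F m 0 - ?F n j\<bar> \<le> osc d (?F n)"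
    proof (intro exI allI impI)
      fix m assume "n \<le> m"
      then show "\<bar>?F m 0 - ?F n j\<bar> \<le> osc d (?F n)" using diff d j by simp
    qed
  qed
  have "(\<lambda>n. ?F n j) \<longlonglongrightarrow> c" if "j < d" for j
  proof (rule LIM_zero_cancel, rule Lim_null_comparison[OF _ osc])
    show "\<forall>\<^sub>F n in sequentially. norm (?F n j - c) \<le> osc d (?F n)"
      using bd[OF that] by (simp add: abs_minus_commute)
  qed
  with bd show ?thesis by blast
qed

lemma ccw_not_collinear:
  fixes A :: "nat \<Rightarrow> real^2"
  assumes "turn (\<lambda>j. vec_nth (A j) 1) (\<lambda>j. vec_nth (A j) 2) i j k \<noteq> 0"
  shows "\<not> collinear {A i, A j, A k}"
proof
  assume "collinear {A i, A j, A k}"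
  then obtain u where u: "\<And>p q. p \<in> {A i, A j, A k} \<Longrightarrow> q \<in> {A i, A j, A k} \<Longrightarrow> \<exists>c. p - q = c *\<^sub>R u"
    unfolding collinear_def by blast
  obtain c1 c2 where "A j - A i = c1 *\<^sub>R u" "A k - A i = c2 *\<^sub>R u"
    using u[of "A j" "A i"] u[of "A k" "A i"] by auto
  from arg_cong[OF this(1), of "\<lambda>v. vec_nth v l" for l] arg_cong[OF this(2), of "\<lambda>v. vec_nth v l" for l]
  have "vec_nth (A j) l - vec_nth (A i) l = c1 * vec_nth u l"
    "vec_nth (A k) l - vec_nth (A i) l = c2 * vec_nth u l" for l
    by simp_all
  then show False using assms by (simp add: turn_def)
qed

lemma polygon_seq_in_hull:
  assumes t: "\<And>n j. j < d \<Longrightarrow> 0 \<le> x (Suc n) j \<and> x (Suc n) j \<le> 1" and j: "j < d"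
    and S: "convex S" "\<And>j. j < d \<Longrightarrow> polygon_seq d A x n j \<in> S"
  shows "polygon_seq d A x (n + m) j \<in> S"
  using j
proof (induction m arbitrary: j)
  case (Suc m)
  have "Suc j mod d < d" using Suc.prems by simp
  then show ?case using Suc.IH Suc.prems t[of j "n + m"] S(1)
    by (simp add: subdivide_def convexD_alt)
qed (use S in simp)

text \<open>After two subdivisions every vertex is a strictly positive combination of three consecutive
  original vertices, which are not collinear.\<close>

lemma polygon_seq_interior:
  fixes A :: "nat \<Rightarrow> real^2"
  defines "a \<equiv> \<lambda>j. vec_nth (A j) 1" and "b \<equiv> \<lambda>j. vec_nth (A j) 2"
  assumes d: "d \<ge> 3" and ccw: "ccw d a b \<or> ccw d b a"
    and t: "\<And>n j. j < d \<Longrightarrow> 0 < x (Suc n) j \<and> x (Suc n) j < 1" and j: "j < d"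
  shows "polygon_seq d A x 2 j \<in> interior (convex hull (A ` {..<d}))"
proof -
  define k l where "k = Suc j mod d" and "l = Suc k mod d"
  have kl: "k < d" "l < d" using d by (auto simp: k_def l_def)
  have nz: "turn a b p q r \<noteq> 0" if "p < q" "q < r" "r < d" for p q r
    using ccw
  proof
    assume "ccw d a b"
    then have "0 < turn a b p q r" using that by (simp add: ccw_def)
    then show ?thesis by simp
  next
    assume "ccw d b a"
    then have "0 < turn b a p q r" using that by (simp add: ccw_def)
    then show ?thesis by (simp add: turn_swap[of b a])
  qed
  have "turn a b j k l \<noteq> 0"
  proof -
    consider "Suc (Suc j) < d" | "Suc (Suc j) = d" | "Suc j = d" using j by linarith
    then show ?thesis
    proof cases
      case 1
      then show ?thesis using nz[of j "Suc j" "Suc (Suc j)"] by (simp add: k_def l_def)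
    next
      case 2
      then have "k = Suc j" "l = 0" by (auto simp: k_def l_def)
      then show ?thesis using nz[of 0 j "Suc j"] 2 d turn_cyclic[of a b j "Suc j" 0] by (auto simp: turn_def algebra_simps)
    next
      case 3
      then have "k = 0" "l = 1" using d by (auto simp: k_def l_def)
      then show ?thesis using nz[of 0 1 j] 3 d by (auto simp: turn_def algebra_simps)
    qed
  qed
  then have nc: "\<not> collinear {A j, A k, A l}" unfolding a_def b_def by (rule ccw_not_collinear)
  define s u v where "s = x 2 j" and "u = x 1 j" and "v = x 1 k"
  have pos: "0 < s" "s < 1" "0 < u" "u < 1" "0 < v" "v < 1"
    using t[of j 1] t[of j 0] t[of k 0] j kl by (auto simp: s_def u_def v_def numeral_2_eq_2)
  have "polygon_seq d A x 2 j = ((1 - s) * (1 - u)) *\<^sub>R A j +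
      ((1 - s) * u + s * (1 - v)) *\<^sub>R A k + (s * v) *\<^sub>R A l"
    by (simp add: numeral_2_eq_2 subdivide_def s_def u_def v_def k_def l_def algebra_simps)
  moreover have "0 < (1 - s) * (1 - u)" "0 < (1 - s) * u + s * (1 - v)" "0 < s * v"
    using pos by (auto intro!: add_pos_pos mult_pos_pos)
  moreover have "(1 - s) * (1 - u) + ((1 - s) * u + s * (1 - v)) + s * v = 1"
    by (simp add: algebra_simps)
  ultimately have "\<exists>p q r. 0 < p \<and> 0 < q \<and> 0 < r \<and> p + q + r = 1 \<and>
      p *\<^sub>R A j + q *\<^sub>R A k + r *\<^sub>R A l = polygon_seq d A x 2 j"
    by (intro exI[of _ "(1 - s) * (1 - u)"] exI[of _ "(1 - s) * u + s * (1 - v)"]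
        exI[of _ "s * v"] conjI) simp_all
  then have "polygon_seq d A x 2 j \<in> interior (convex hull {A j, A k, A l})"
    by (simp add: interior_convex_hull_3_minimal[OF nc])
  also have "\<dots> \<subseteq> interior (convex hull (A ` {..<d}))"
    using j kl by (intro interior_mono hull_mono) auto
  finally show ?thesis .
qed

text \<open>The upper estimate of the norm is domination, applied to the functions \<open>unit_edge k\<close>; the lower one
  holds because the edges of \<open>L\<^sub>n\<close> are the images of the edges of \<open>L\<^sub>0\<close>, and
  because \<open>P\<close> is no farther from a vertex than the oscillations of the coordinates allow.\<close>

lemma polygon_diameter_comparable:
  fixes A :: "nat \<Rightarrow> real^2"
  assumes d: "d \<ge> 3" and A: "nondegenerate_convex_polygon d A"
    and t: "\<And>n j. j < d \<Longrightarrow> 0 < x (Suc n) j \<and> x (Suc n) j < 1"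
    and osc: "\<And>f. (\<lambda>n. osc d (split_seq d x f n)) \<longlonglongrightarrow> 0"
  shows "\<exists>P C. P \<in> interior (convex hull (A ` {..<d})) \<and>
    (\<forall>j<d. (\<lambda>n. polygon_seq d A x n j) \<longlonglongrightarrow> P) \<and> 0 < C \<and>
    (\<forall>n. entry_norm (step_mat_prod d x n) \<le> C * Max ((\<lambda>j. dist P (polygon_seq d A x n j)) ` {..<d}) \<and>
         Max ((\<lambda>j. dist P (polygon_seq d A x n j)) ` {..<d}) \<le> C * entry_norm (step_mat_prod d x n))"
proof -
  have d0: "d > 0" and d2: "d \<ge> 2" using d by auto
  have t': "0 \<le> x (Suc n) j \<and> x (Suc n) j \<le> 1" if "j < d" for n j
    using t[OF that, of n] by auto
  define g where "g i j = vec_nth (A j) i" for i :: 2 and j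
  let ?g = "\<lambda>i n. split_seq d x (g i) n"
  have comp: "vec_nth (polygon_seq d A x n j) i = ?g i n j" for n j i
    unfolding g_def by (rule polygon_seq_component)
  have "\<forall>i. \<exists>c. (\<forall>j<d. (\<lambda>n. ?g i n j) \<longlonglongrightarrow> c) \<and>
    (\<forall>n. \<forall>j<d. \<bar>c - ?g i n j\<bar> \<le> osc d (?g i n))"
    using split_seq_converges[OF d0, of x, OF t' osc] by blast
  then obtain p where p: "\<And>i j. j < d \<Longrightarrow> (\<lambda>n. ?g i n j) \<longlonglongrightarrow> p i"
      "\<And>i n j. j < d \<Longrightarrow> \<bar>p i - ?g i n j\<bar> \<le> osc d (?g i n)"
    by metis
  define P :: "real^2" where "P = (\<chi> i. p i)"
  define D where "D n = Max ((\<lambda>j. dist P (polygon_seq d A x n j)) ` {..<d})" for n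
  let ?N = "\<lambda>n. entry_norm (step_mat_prod d x n)"
  have lim: "(\<lambda>n. polygon_seq d A x n j) \<longlonglongrightarrow> P" if "j < d" for j
    by (rule vec_tendstoI) (use p(1)[OF that] in \<open>simp add: comp P_def\<close>)
  have ccw: "ccw d (g 1) (g 2) \<or> ccw d (g 2) (g 1)"
    using nondegenerate_convex_polygon_ccw[OF d A] unfolding g_def .
  have "P \<in> interior (convex hull (A ` {..<d}))"
  proof -
    let ?H = "convex hull (polygon_seq d A x 2 ` {..<d})"
    have "P \<in> ?H"
    proof (rule closed_sequentially)
      show "closed ?H" by (intro compact_imp_closed compact_convex_hull finite_imp_compact) auto
      show "(\<lambda>m. polygon_seq d A x (2 + m) 0) \<longlonglongrightarrow> P"
        using LIMSEQ_ignore_initial_segment[OF lim[OF d0], of 2] by (simp add: add.commute)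
      show "polygon_seq d A x (2 + m) 0 \<in> ?H" for m
        by (rule polygon_seq_in_hull[where x = x, OF t' d0 convex_convex_hull])
          (auto intro: hull_inc)
    qed
    also have "?H \<subseteq> interior (convex hull (A ` {..<d}))"
    proof (intro hull_minimal convex_interior convex_convex_hull image_subsetI)
      fix j assume "j \<in> {..<d}"
      then show "polygon_seq d A x 2 j \<in> interior (convex hull (A ` {..<d}))"
        by (intro polygon_seq_interior[where x = x and A = A, OF d ccw[unfolded g_def] t]) simp_all
    qed
    finally show ?thesis .
  qed
  have distD: "dist P (polygon_seq d A x n j) \<le> D n" if "j < d" for n j
    unfolding D_def using that by (intro Max_ge) auto
  have compD: "\<bar>p i - ?g i n j\<bar> \<le> D n" if "j < d" for i n j
  proof -
    have "\<bar>p i - ?g i n j\<bar> = \<bar>vec_nth (P - polygon_seq d A x n j) i\<bar>" by (simp add: comp P_def)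
    also have "\<dots> \<le> dist P (polygon_seq d A x n j)" unfolding dist_norm by (rule component_le_norm_cart)
    finally show ?thesis using distD[OF that, of n] by simp
  qed
  have edgeD: "\<bar>?g i n (Suc j) - ?g i n j\<bar> \<le> 2 * D n" if "Suc j < d" for i n j
    using compD[of j i n] compD[of "Suc j" i n] that by linarith
  have D0: "0 \<le> D n" for n using distD[OF d0, of n] zero_le_dist order.trans by blast
  \<comment> \<open>A function on the vertices varies along each side by at most a fixed multiple of the
    diameter, whichever orientation the polygon has.\<close>
  have "\<exists>C. \<forall>n i. Suc i < d \<longrightarrow> \<bar>split_seq d x f n (Suc i) - split_seq d x f n i\<bar> \<le> C * D n" for f
  proof -
    obtain i i' C where dom: "dominated d C (g i) (g i') f" "0 \<le> C"
    proof -
      have "\<exists>i i'. ccw d (g i) (g i')" using ccw by (elim disjE) (rule exI, rule exI, assumption)+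
      then obtain i i' where "ccw d (g i) (g i')" by (elim exE)
      from dominated_exists[OF this, of f] obtain C where "\<forall>C'\<ge>C. dominated d C' (g i) (g i') f" ..
      then have "dominated d (max 0 C) (g i) (g i') f" by simp
      then show thesis using that by simp
    qed
    have "\<bar>split_seq d x f n (Suc k) - split_seq d x f n k\<bar> \<le> 4 * C * D n" if k: "Suc k < d" for n k
    proof -
      have "\<bar>split_seq d x f n (Suc k) - split_seq d x f n k\<bar> \<le>
          C * (\<bar>?g i n (Suc k) - ?g i n k\<bar> + \<bar>?g i' n (Suc k) - ?g i' n k\<bar>)"
        by (rule dominated_edge[OF dominated_split_seq[where x = x, OF dom(1) t] d k])
      also have "\<dots> \<le> C * (2 * D n + 2 * D n)"
        using edgeD[OF k] dom(2) by (intro mult_left_mono add_mono) auto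
      finally show ?thesis by simp
    qed
    then show ?thesis by blast
  qed
  then obtain C where C: "\<And>f n i. Suc i < d \<Longrightarrow>
      \<bar>split_seq d x f n (Suc i) - split_seq d x f n i\<bar> \<le> C f * D n" by metis
  define C1 where "C1 = (\<Sum>k<d-1. \<Sum>i<d-1. C (unit_edge k))"
  have lower: "?N n \<le> C1 * D n" for n
    unfolding entry_norm_step_mat_prod[OF d2] C1_def sum_distrib_right
    by (intro sum_mono C) auto
  define K where "K i = (\<Sum>k<d-1. \<bar>g i (Suc k) - g i k\<bar>)" for i
  have K: "\<bar>g i (Suc k) - g i k\<bar> \<le> K i" if "k < d - 1" for i k
    unfolding K_def using that by (intro member_le_sum) auto
  have oscK: "osc d (?g i n) \<le> real d * (?N n * K i)" for i n
  proof -
    have "osc d (?g i n) \<le> (\<Sum>k<d-1. \<bar>?g i n (Suc k) - ?g i n k\<bar>)" by (rule osc_le_edges[OF d0])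
    also have "\<dots> \<le> (\<Sum>k<d-1. ?N n * K i)"
      by (intro sum_mono edge_le_entry_norm[OF d2] K) auto
    also have "\<dots> = real (d - 1) * (?N n * K i)" by (simp only: sum_constant card_lessThan)
    also have "\<dots> \<le> real d * (?N n * K i)"
      by (intro mult_right_mono mult_nonneg_nonneg entry_norm_nonneg) (auto simp: K_def sum_nonneg)
    finally show ?thesis .
  qed
  define C2 where "C2 = real d * K 1 + real d * K 2"
  have upper: "D n \<le> C2 * ?N n" for n
  proof -
    have "dist P (polygon_seq d A x n j) \<le> C2 * ?N n" if "j < d" for j
    proof -
      have "dist P (polygon_seq d A x n j) \<le> (\<Sum>i\<in>UNIV. \<bar>vec_nth (P - polygon_seq d A x n j) i\<bar>)"
        unfolding dist_norm by (rule norm_le_l1_cart)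
      also have "\<dots> = \<bar>p 1 - ?g 1 n j\<bar> + \<bar>p 2 - ?g 2 n j\<bar>" by (simp add: sum_2 comp P_def)
      also have "\<dots> \<le> real d * (?N n * K 1) + real d * (?N n * K 2)"
        using p(2)[OF that] oscK by (meson add_mono order.trans)
      finally show ?thesis by (simp add: C2_def algebra_simps)
    qed
    then show ?thesis unfolding D_def using d0 by (subst Max_le_iff) auto
  qed
  define C3 where "C3 = max 1 (max C1 C2)"
  have "?N n \<le> C3 * D n" "D n \<le> C3 * ?N n" for n
  proof -
    have "C1 \<le> C3" "C2 \<le> C3" by (simp_all add: C3_def)
    then show "?N n \<le> C3 * D n" "D n \<le> C3 * ?N n"
      using order.trans[OF lower mult_right_mono[OF _ D0]]
        order.trans[OF upper mult_right_mono[OF _ entry_norm_nonneg]] by simp_all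
  qed
  moreover have "0 < C3" by (simp add: C3_def)
  ultimately show ?thesis using \<open>P \<in> interior _\<close> lim unfolding D_def by blast
qed

section \<open>Subadditive arrays of numbers\<close>

lemma subadditive_linear_bound:
  fixes g :: "nat \<Rightarrow> nat \<Rightarrow> real"
  assumes sub: "\<And>i n m. g i (n + m) \<le> g i n + g (i + n) m"
    and one: "\<And>i. g i 1 \<le> C"
  shows "n \<ge> 1 \<Longrightarrow> g i n \<le> real n * C"
proof (induction n rule: nat_induct_at_least)
  case base
  then show ?case using one by simp
next
  case (Suc n)
  have "g i (n + 1) \<le> g i n + g (i + n) 1" by (rule sub)
  also have "\<dots> \<le> real n * C + C" by (intro add_mono Suc one)
  finally show ?case by (simp add: algebra_simps)
qed

text \<open>Walk through \<open>[i, i + N)\<close> from the left: from a good index jump over a block of length at most \<open>K\<close> on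
  which the rate is below \<open>\<beta>\<close>, from a bad index advance by one step at cost \<open>C\<close>.  The additional \<open>K\<close>
  pays for a last block that would leave the interval.\<close>

lemma subadditive_covering:
  fixes g :: "nat \<Rightarrow> nat \<Rightarrow> real" and K :: nat
  assumes sub: "\<And>i n m. g i (n + m) \<le> g i n + g (i + n) m"
    and one: "\<And>i. g i 1 \<le> C" and \<beta>: "\<beta> \<le> C"
  defines "bad \<equiv> \<lambda>i. \<forall>n\<in>{1..K}. real n * \<beta> \<le> g i n"
  shows "N \<ge> 1 \<Longrightarrow> g i N \<le> real N * \<beta> + (C - \<beta>) * (real K + (\<Sum>k<N. of_bool (bad (i + k))))"
proof (induction N arbitrary: i rule: less_induct)
  case (less N)
  define c where "c = C - \<beta>"
  have c: "0 \<le> c" using \<beta> by (simp add: c_def)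
  have split: "(\<Sum>k<n. of_bool (bad (i + k))) + (\<Sum>k<N - n. of_bool (bad (i + n + k))) =
    (\<Sum>k<N. of_bool (bad (i + k)) :: real)" if "n \<le> N" for n
  proof -
    have "(\<Sum>k<n + m. of_bool (bad (i + k)) :: real) =
      (\<Sum>k<n. of_bool (bad (i + k))) + (\<Sum>k<m. of_bool (bad (i + n + k)))" for m
      by (induction m) (simp_all add: add.assoc)
    from this[of "N - n"] show ?thesis using that by simp
  qed
  have nn: "0 \<le> (\<Sum>k<n. of_bool (bad (j + k)) :: real)" for n j by (simp add: sum_nonneg)
  show ?case
  proof (cases "bad i")
    case True
    show ?thesis
    proof (cases "N = 1")
      case True
      moreover have "0 \<le> c * real K" using c by simp
      ultimately show ?thesis using one[of i] \<open>bad i\<close> by (simp add: c_def algebra_simps)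
    next
      case False
      have "g i N \<le> g i 1 + g (i + 1) (N - 1)" using sub[of i 1 "N - 1"] less.prems by simp
      also have "\<dots> \<le> C + (real (N - 1) * \<beta> + c * (real K + (\<Sum>k<N - 1. of_bool (bad (i + 1 + k)))))"
        unfolding c_def using less.prems False by (intro add_mono one less.IH) auto
      also have "\<dots> = real N * \<beta> + c * (real K + (1 + (\<Sum>k<N - 1. of_bool (bad (i + 1 + k)))))"
        using less.prems by (simp add: c_def of_nat_diff algebra_simps)
      also have "1 + (\<Sum>k<N - 1. of_bool (bad (i + 1 + k))) = (\<Sum>k<N. of_bool (bad (i + k)) :: real)"
        using split[of 1] less.prems True by simp
      finally show ?thesis by (simp add: c_def)
    qed
  next
    case False
    then obtain n where n: "1 \<le> n" "n \<le> K" "g i n < real n * \<beta>"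
      by (auto simp: bad_def not_le)
    consider "n < N" | "n = N" | "N < n" by linarith
    then show ?thesis
    proof cases
      case 1
      have "g i N \<le> g i n + g (i + n) (N - n)" using sub[of i n "N - n"] 1 by simp
      also have "\<dots> \<le> real n * \<beta> + (real (N - n) * \<beta> + c * (real K + (\<Sum>k<N - n. of_bool (bad (i + n + k)))))"
        unfolding c_def using n 1 by (intro add_mono less.IH) auto
      also have "\<dots> = real N * \<beta> + c * (real K + (\<Sum>k<N - n. of_bool (bad (i + n + k))))"
        using 1 by (simp add: of_nat_diff algebra_simps)
      also have "\<dots> \<le> real N * \<beta> + c * (real K + (\<Sum>k<N. of_bool (bad (i + k))))"
        using split[of n] nn[of i n] 1 c by (intro add_left_mono mult_left_mono) auto
      finally show ?thesis by (simp add: c_def)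
    next
      case 2
      then have "g i N \<le> real N * \<beta>" using n by simp
      also have "\<dots> \<le> real N * \<beta> + c * (real K + (\<Sum>k<N. of_bool (bad (i + k))))"
        using c nn[of i N] by simp
      finally show ?thesis by (simp add: c_def)
    next
      case 3
      have "g i N \<le> real N * C" by (rule subadditive_linear_bound[OF sub one less.prems])
      also have "\<dots> = real N * \<beta> + c * real N" by (simp add: c_def algebra_simps)
      also have "\<dots> \<le> real N * \<beta> + c * (real K + (\<Sum>k<N. of_bool (bad (i + k))))"
        using c nn[of i N] 3 n by (intro add_left_mono mult_left_mono) auto
      finally show ?thesis by (simp add: c_def)
    qed
  qed
qed

text \<open>Sum \<open>g 0 (i + m) - g 0 i \<le> g i m\<close> over \<open>i\<close>.  The left-hand side telescopes to \<open>m\<close> terms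
  \<open>g 0 (n + r)\<close>, each of which is \<open>g 0 (n + m)\<close> up to a bounded error.\<close>

lemma subadditive_averaging:
  fixes g :: "nat \<Rightarrow> nat \<Rightarrow> real"
  assumes sub: "\<And>i n m. g i (n + m) \<le> g i n + g (i + n) m"
    and one: "\<And>i. g i 1 \<le> C"
  shows "\<exists>B. \<forall>n. real m * g 0 (n + m) \<le> (\<Sum>i<n. g i m) + B"
proof -
  define B where "B = real m * (real m * \<bar>C\<bar>) + (\<Sum>r<m. g 0 r)"
  have "real m * g 0 (n + m) \<le> (\<Sum>i<n. g i m) + B" for n
  proof -
    have tel: "(\<Sum>i<n. g 0 (i + m) - g 0 i) = (\<Sum>r<m. g 0 (n + r)) - (\<Sum>r<m. g 0 r)"
    proof (induction n)
      case (Suc n)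
      have "(\<Sum>r<m. g 0 (n + Suc r) - g 0 (n + r)) = g 0 (n + m) - g 0 (n + 0)"
        by (rule sum_lessThan_telescope)
      then show ?case using Suc by (simp add: sum_subtractf algebra_simps)
    qed simp
    have "g 0 (n + m) \<le> g 0 (n + r) + real m * \<bar>C\<bar>" if r: "r < m" for r
    proof -
      have "g 0 (n + r + (m - r)) \<le> g 0 (n + r) + g (0 + (n + r)) (m - r)" by (rule sub)
      also have "g (0 + (n + r)) (m - r) \<le> real (m - r) * C"
        by (rule subadditive_linear_bound[OF sub one]) (use r in simp)
      also have "\<dots> \<le> real (m - r) * \<bar>C\<bar>" by (intro mult_left_mono) auto
      also have "\<dots> \<le> real m * \<bar>C\<bar>" by (intro mult_right_mono) auto
      finally show ?thesis using r by simp
    qed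
    then have "(\<Sum>r<m. g 0 (n + m)) \<le> (\<Sum>r<m. g 0 (n + r) + real m * \<bar>C\<bar>)"
      by (intro sum_mono) auto
    then have "real m * g 0 (n + m) \<le> (\<Sum>r<m. g 0 (n + r)) + real m * (real m * \<bar>C\<bar>)"
      by (simp add: sum.distrib)
    moreover have "(\<Sum>i<n. g 0 (i + m) - g 0 i) \<le> (\<Sum>i<n. g i m)"
      using sub[of 0] by (intro sum_mono) (simp add: algebra_simps)
    ultimately show ?thesis using tel by (simp add: B_def)
  qed
  then show ?thesis by blast
qed

lemma eventually_linear_bound:
  fixes u :: "nat \<Rightarrow> real"
  assumes m: "m \<ge> 1" and u: "\<forall>\<^sub>F n in sequentially. real m * u (n + m) \<le> real n * \<eta> + B"
    and \<eta>: "\<eta> < real m * \<gamma>"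
  shows "\<forall>\<^sub>F n in sequentially. u n \<le> real n * \<gamma>"
proof -
  define e where "e = real m * \<gamma> - \<eta>"
  have e: "e > 0" using \<eta> by (simp add: e_def)
  have "\<forall>\<^sub>F n in sequentially. (B - real m * (real m * \<gamma>)) / e \<le> real n"
    using filterlim_real_sequentially by (simp add: filterlim_at_top)
  then have "\<forall>\<^sub>F n in sequentially. u (n + m) \<le> real (n + m) * \<gamma>"
    using u
  proof eventually_elim
    case (elim n)
    have "B - real m * (real m * \<gamma>) \<le> real n * e" using elim(1) e by (simp add: field_simps)
    then have "real n * \<eta> + B \<le> real m * (real (n + m) * \<gamma>)" by (simp add: e_def algebra_simps)
    then have "real m * u (n + m) \<le> real m * (real (n + m) * \<gamma>)" using elim(2) by linarith
    then show ?case using m by simp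
  qed
  then show ?thesis by (rule eventually_sequentially_seg[THEN iffD1])
qed

section \<open>A subadditive ergodic theorem for i.i.d. sequences\<close>

text \<open>The space \<open>S\<close> of values is arbitrary, since the sequence of interest consists of rows of splitting
  ratios.\<close>

locale iid_sequence = prob_space M for M :: "'a measure" +
  fixes S :: "'s measure" and Z :: "nat \<Rightarrow> 'a \<Rightarrow> 's"
  assumes indep: "indep_vars (\<lambda>_. S) Z UNIV"
    and ident: "\<And>n. distr M S (Z n) = distr M S (Z 0)"
begin

abbreviation seqs :: "(nat \<Rightarrow> 's) measure" where
  "seqs \<equiv> \<Pi>\<^sub>M _\<in>UNIV. S"

definition orbit :: "nat \<Rightarrow> 'a \<Rightarrow> nat \<Rightarrow> 's" where
  "orbit i \<omega> = (\<lambda>k. Z (i + k) \<omega>)"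

lemma Z_measurable [measurable]: "Z n \<in> measurable M S"
  using indep by (simp add: indep_vars_def2)

lemma orbit_measurable [measurable]: "orbit i \<in> measurable M seqs"
  unfolding orbit_def by (rule measurable_PiM_single') (auto simp: measurable_space[OF Z_measurable])

text \<open>The law of an i.i.d. sequence is a product measure, and a shift merely renames its factors.\<close>

lemma distr_orbit: "distr M seqs (orbit i) = distr M seqs (orbit 0)"
proof -
  let ?D = "\<lambda>_::nat. distr M S (Z 0)"
  have D: "prob_space (distr M S (Z 0))" by (rule prob_space_distr) simp
  have "distr M seqs (\<lambda>x. \<lambda>i\<in>UNIV. Z i x) = (\<Pi>\<^sub>M i\<in>UNIV. distr M S (Z i))"
    using indep by (subst indep_vars_iff_distr_eq_PiM[symmetric]) auto
  then have 0: "distr M seqs (orbit 0) = PiM UNIV ?D"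
    unfolding orbit_def using PiM_cong[OF refl ident, of UNIV] by (simp add: restrict_def)
  have "distr M seqs (orbit i) = distr (distr M seqs (orbit 0)) seqs (\<lambda>z. \<lambda>n\<in>UNIV. z (i + n))"
  proof -
    have m: "(\<lambda>z. \<lambda>n\<in>UNIV. z (i + n)) \<in> measurable seqs seqs" by (rule measurable_restrict) simp
    show ?thesis unfolding distr_distr[OF m orbit_measurable]
      by (simp add: comp_def orbit_def[abs_def] restrict_def)
  qed
  also have "\<dots> = distr (PiM UNIV ?D) (PiM UNIV ?D) (\<lambda>z. \<lambda>n\<in>UNIV. z (i + n))"
    unfolding 0 by (intro distr_cong sets_PiM_cong) auto
  also have "\<dots> = PiM UNIV ?D"
    using distr_PiM_reindex[of UNIV ?D "\<lambda>n. i + n" UNIV] D by (auto simp: inj_on_def)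
  finally show ?thesis using 0 by simp
qed

lemma prob_orbit:
  assumes [measurable]: "Measurable.pred seqs Q"
  shows "prob {\<omega>\<in>space M. Q (orbit i \<omega>)} = prob {\<omega>\<in>space M. Q (orbit 0 \<omega>)}"
proof -
  have "prob {\<omega>\<in>space M. Q (orbit i \<omega>)} = measure (distr M seqs (orbit i)) {z\<in>space seqs. Q z}" for i
    by (subst measure_distr) (auto intro!: arg_cong[where f = prob] measurable_space[OF orbit_measurable])
  then show ?thesis by (simp add: distr_orbit[of i])
qed

lemma integrable_orbit:
  assumes [measurable]: "f \<in> borel_measurable seqs"
  shows "integrable M (\<lambda>\<omega>. f (orbit i \<omega>)) \<longleftrightarrow> integrable M (\<lambda>\<omega>. f (orbit 0 \<omega>) :: real)"
  using integrable_distr_eq[OF orbit_measurable assms, of i] integrable_distr_eq[OF orbit_measurable assms, of 0]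
  by (simp add: distr_orbit[of i])

lemma expectation_orbit:
  assumes [measurable]: "f \<in> borel_measurable seqs"
  shows "expectation (\<lambda>\<omega>. f (orbit i \<omega>)) = expectation (\<lambda>\<omega>. f (orbit 0 \<omega>) :: real)"
  using integral_distr[OF orbit_measurable assms, of i] integral_distr[OF orbit_measurable assms, of 0]
  by (simp add: distr_orbit[of i])

text \<open>The event that \<open>Q\<close> holds for infinitely many shifts of the sequence is a tail event.  By the
  hypothesis it is almost surely contained in \<open>Q\<close>, and by stationarity it is not less likely.\<close>

lemma zero_one:
  assumes A [measurable]: "Measurable.pred seqs Q"
    and inv: "AE \<omega> in M. \<forall>i. Q (orbit i \<omega>) \<longrightarrow> Q (orbit 0 \<omega>)"
  shows "prob {\<omega>\<in>space M. Q (orbit 0 \<omega>)} \<in> {0, 1}"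
proof -
  define B where "B i = {\<omega>\<in>space M. Q (orbit i \<omega>)}" for i
  define U where "U n = (\<Union>i\<in>{n..}. B i)" for n
  define E where "E = (\<Inter>n. U n)"
  have [measurable]: "B i \<in> events" for i unfolding B_def by measurable
  have [measurable]: "U n \<in> events" for n unfolding U_def by measurable
  have [measurable]: "E \<in> events" unfolding E_def by measurable
  define F where "F k = sigma_sets (space M) {Z k -` A \<inter> space M | A. A \<in> sets S}" for k
  have F_sub: "F k \<subseteq> Pow (space M)" for k
  proof
    fix A assume "A \<in> F k"
    then have "A \<subseteq> space M" unfolding F_def by (rule sigma_sets_into_sp[rotated]) auto
    then show "A \<in> Pow (space M)" by simp
  qed
  have "E \<in> tail_events F"
    unfolding tail_events_def
  proof
    fix n
    define N where "N = sigma (space M) (\<Union> (F ` {n..}))"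
    have sub: "\<Union> (F ` {n..}) \<subseteq> Pow (space M)" using F_sub by auto
    have spN: "space N = space M" by (simp add: N_def space_measure_of_conv)
    have setsN: "sets N = sigma_sets (space M) (\<Union> (F ` {n..}))" unfolding N_def by (rule sets_measure_of[OF sub])
    have ZN: "Z k \<in> measurable N S" if "n \<le> k" for k
    proof (rule measurableI)
      show "Z k \<omega> \<in> space S" if "\<omega> \<in> space N" for \<omega>
        using that measurable_space[OF Z_measurable] by (simp add: spN)
      show "Z k -` A \<inter> space N \<in> sets N" if "A \<in> sets S" for A
        unfolding setsN spN using that \<open>n \<le> k\<close>
        by (intro sigma_sets.Basic UN_I[of k]) (auto simp: F_def intro!: sigma_sets.Basic)
    qed
    have pN: "orbit i \<in> measurable N seqs" if "n \<le> i" for i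
      unfolding orbit_def using that
      by (intro measurable_PiM_single' ZN)
        (auto simp: spN measurable_space[OF Z_measurable])
    have B: "B i \<in> sets N" if "n \<le> i" for i
    proof -
      have [measurable]: "orbit i \<in> measurable N seqs" by (rule pN[OF that])
      have "{\<omega>\<in>space N. Q (orbit i \<omega>)} \<in> sets N" by measurable
      then show ?thesis by (simp add: B_def spN)
    qed
    have "E = (\<Inter>m\<in>{n..}. U m)"
    proof
      show "(\<Inter>m\<in>{n..}. U m) \<subseteq> E"
      proof
        fix \<omega> assume \<omega>: "\<omega> \<in> (\<Inter>m\<in>{n..}. U m)"
        have "\<omega> \<in> U m" for m
        proof -
          have "\<omega> \<in> U (max n m)" using \<omega> by auto
          also have "U (max n m) \<subseteq> U m" unfolding U_def by (intro UN_mono) auto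
          finally show ?thesis .
        qed
        then show "\<omega> \<in> E" by (simp add: E_def)
      qed
    qed (auto simp: E_def)
    also have "\<dots> \<in> sets N"
    proof (rule sets.countable_INT')
      have "U m \<in> sets N" if "n \<le> m" for m
        unfolding U_def by (rule sets.countable_UN') (use that B in auto)
      then show "U ` {n..} \<subseteq> sets N" by auto
    qed auto
    finally show "E \<in> sigma_sets (space M) (\<Union> (F ` {n..}))" by (simp add: setsN)
  qed
  moreover have "indep_sets F UNIV" using indep unfolding indep_vars_def F_def by simp
  moreover have "sigma_algebra (space M) (F i)" for i
    unfolding F_def by (rule sigma_algebra_sigma_sets) auto
  ultimately have 01: "prob E = 0 \<or> prob E = 1" by (intro kolmogorov_0_1_law)
  have "prob E = prob (B 0)"
  proof (rule antisym)
    show "prob E \<le> prob (B 0)"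
    proof (rule finite_measure_mono_AE)
      show "AE \<omega> in M. \<omega> \<in> E \<longrightarrow> \<omega> \<in> B 0"
        using inv by eventually_elim (auto simp: E_def U_def B_def)
    qed simp
    have "(\<lambda>n. prob (U n)) \<longlonglongrightarrow> prob E"
      unfolding E_def
    proof (rule finite_Lim_measure_decseq)
      show "decseq U" unfolding decseq_def U_def by (intro allI impI UN_mono) auto
    qed auto
    moreover have "prob (B 0) \<le> prob (U n)" for n
    proof -
      have "prob (B 0) = prob (B n)" unfolding B_def by (rule prob_orbit[symmetric]) simp
      also have "\<dots> \<le> prob (U n)" by (intro finite_measure_mono) (auto simp: U_def)
      finally show ?thesis .
    qed
    ultimately show "prob (B 0) \<le> prob E" by (intro LIMSEQ_le_const) auto
  qed
  then show ?thesis using 01 by (auto simp: B_def)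
qed

text \<open>For large \<open>K\<close> an index is bad only with small probability \<open>\<delta>\<close>.  Taking expectations in
  \<open>subadditive_covering\<close> and dividing by \<open>N\<close> bounds the expected rate by \<open>\<beta> + (C - \<beta>) \<delta>\<close> in the
  limit.\<close>

lemma subadditive_returns_bound:
  fixes G :: "nat \<Rightarrow> (nat \<Rightarrow> 's) \<Rightarrow> real"
  assumes G [measurable]: "\<And>n. G n \<in> borel_measurable seqs"
    and sub: "AE \<omega> in M. \<forall>i n m. G (n + m) (orbit i \<omega>) \<le> G n (orbit i \<omega>) + G m (orbit (i + n) \<omega>)"
    and one: "AE \<omega> in M. \<forall>i. G 1 (orbit i \<omega>) \<le> C"
    and int: "\<And>n. n \<ge> 1 \<Longrightarrow> integrable M (\<lambda>\<omega>. G n (orbit 0 \<omega>))"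
    and low: "\<And>n. n \<ge> 1 \<Longrightarrow> real n * \<mu> \<le> expectation (\<lambda>\<omega>. G n (orbit 0 \<omega>))"
    and returns: "AE \<omega> in M. \<exists>n\<ge>1. G n (orbit 0 \<omega>) < real n * \<beta>"
  shows "\<mu> \<le> \<beta>"
proof (cases "\<beta> \<le> C")
  case False
  have "expectation (\<lambda>\<omega>. G 1 (orbit 0 \<omega>)) \<le> expectation (\<lambda>_. C)"
    using one by (intro integral_mono_AE int) auto
  then show ?thesis using low[of 1] False by (simp add: prob_space)
next
  case True
  define c where "c = C - \<beta>"
  have c: "0 \<le> c" using True by (simp add: c_def)
  define bad where "bad K i \<omega> \<longleftrightarrow> (\<forall>n\<in>{1..K}. real n * \<beta> \<le> G n (orbit i \<omega>))" for K :: nat and i \<omega>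
  have [measurable]: "Measurable.pred M (bad K i)" for K i unfolding bad_def by measurable
  define \<delta> where "\<delta> K = prob {\<omega>\<in>space M. bad K 0 \<omega>}" for K
  have \<delta>: "expectation (\<lambda>\<omega>. of_bool (bad K i \<omega>)) = \<delta> K" for K i
  proof -
    have "prob {\<omega>\<in>space M. bad K i \<omega>} = \<delta> K"
      unfolding bad_def \<delta>_def by (rule prob_orbit) measurable
    moreover have "expectation (\<lambda>\<omega>. of_bool (bad K i \<omega>)) =
        expectation (\<lambda>\<omega>. indicator {\<omega>\<in>space M. bad K i \<omega>} \<omega>)"
      by (intro Bochner_Integration.integral_cong) (auto simp: indicator_def)
    moreover have "\<dots> = prob ({\<omega>\<in>space M. bad K i \<omega>} \<inter> space M)" by (rule Bochner_Integration.integral_indicator)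
    moreover have "{\<omega>\<in>space M. bad K i \<omega>} \<inter> space M = {\<omega>\<in>space M. bad K i \<omega>}" by auto
    ultimately show ?thesis by metis
  qed
  have bound: "real N * \<mu> \<le> real N * \<beta> + c * (real K + real N * \<delta> K)" if N: "N \<ge> 1" for N K
  proof -
    have ib: "integrable M (\<lambda>\<omega>. of_bool (bad K i \<omega>) :: real)" for i
      by (rule integrable_const_bound[of _ 1]) auto
    define s where "s \<omega> = (\<Sum>k<N. of_bool (bad K k \<omega>) :: real)" for \<omega>
    have s: "integrable M s" "expectation s = real N * \<delta> K"
    proof -
      show "integrable M s" unfolding s_def by (intro Bochner_Integration.integrable_sum ib)
      have "expectation s = (\<Sum>k<N. expectation (\<lambda>\<omega>. of_bool (bad K k \<omega>)))"
        unfolding s_def by (rule Bochner_Integration.integral_sum) (rule ib)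
      then show "expectation s = real N * \<delta> K" by (simp add: \<delta>)
    qed
    have "AE \<omega> in M. G N (orbit 0 \<omega>) \<le> real N * \<beta> + c * (real K + s \<omega>)"
      using sub one
    proof eventually_elim
      case (elim \<omega>)
      then show ?case
        using subadditive_covering[of "\<lambda>i n. G n (orbit i \<omega>)" C \<beta> N 0 K] True N
        by (simp add: c_def bad_def s_def)
    qed
    then have "expectation (\<lambda>\<omega>. G N (orbit 0 \<omega>)) \<le>
      expectation (\<lambda>\<omega>. real N * \<beta> + c * (real K + s \<omega>))"
      by (intro integral_mono_AE int N Bochner_Integration.integrable_add integrable_mult_right
          s) auto
    also have "\<dots> = real N * \<beta> + c * (real K + real N * \<delta> K)"
      using s by (simp add: prob_space)
    finally show ?thesis using low[OF N] by simp
  qed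
  have "\<mu> \<le> \<beta> + c * \<delta> K" for K
  proof (rule LIMSEQ_le_const)
    have "(\<lambda>N. \<beta> + c * (real K * (1 / real N) + \<delta> K)) \<longlonglongrightarrow> \<beta> + c * (real K * 0 + \<delta> K)"
      by (intro tendsto_intros lim_1_over_n)
    then show "(\<lambda>N. \<beta> + c * (real K * (1 / real N) + \<delta> K)) \<longlonglongrightarrow> \<beta> + c * \<delta> K" by simp
    show "\<exists>N. \<forall>n\<ge>N. \<mu> \<le> \<beta> + c * (real K * (1 / real n) + \<delta> K)"
    proof (intro exI allI impI)
      fix n :: nat assume n: "1 \<le> n"
      then have "real n * \<mu> \<le> real n * (\<beta> + c * (real K * (1 / real n) + \<delta> K))"
        using bound[OF n, of K] n by (simp add: distrib_left mult_ac)
      then show "\<mu> \<le> \<beta> + c * (real K * (1 / real n) + \<delta> K)" using n by simp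
    qed
  qed
  moreover have "(\<lambda>K. \<beta> + c * \<delta> K) \<longlonglongrightarrow> \<beta> + c * 0"
  proof (intro tendsto_intros)
    have "\<delta> \<longlonglongrightarrow> prob (\<Inter>K. {\<omega>\<in>space M. bad K 0 \<omega>})"
      unfolding \<delta>_def
    proof (rule finite_Lim_measure_decseq)
      show "decseq (\<lambda>K. {\<omega> \<in> space M. bad K 0 \<omega>})"
        by (auto simp: decseq_def bad_def)
    qed auto
    also have "prob (\<Inter>K. {\<omega>\<in>space M. bad K 0 \<omega>}) = 0"
    proof (rule prob_eq_0[THEN iffD2])
      show "AE \<omega> in M. \<omega> \<notin> (\<Inter>K. {\<omega>\<in>space M. bad K 0 \<omega>})"
        using returns
      proof eventually_elim
        case (elim \<omega>)
        then obtain n where "n \<ge> 1" "G n (orbit 0 \<omega>) < real n * \<beta>" by blast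
        then have "\<not> bad n 0 \<omega>" by (auto simp: bad_def not_le)
        then show ?case by auto
      qed
    qed auto
    finally show "\<delta> \<longlonglongrightarrow> 0" .
  qed
  ultimately show "\<mu> \<le> \<beta>" by (intro LIMSEQ_le_const[where a = \<mu> and x = \<beta>]) auto
qed

text \<open>Otherwise, by the zero-one law, the array would almost surely fall below the line of some slope
  \<open>\<gamma> < \<mu>\<close> again and again, which contradicts \<open>subadditive_returns_bound\<close>.\<close>

lemma subadditive_liminf:
  fixes G :: "nat \<Rightarrow> (nat \<Rightarrow> 's) \<Rightarrow> real"
  assumes G [measurable]: "\<And>n. G n \<in> borel_measurable seqs"
    and sub: "AE \<omega> in M. \<forall>i n m. G (n + m) (orbit i \<omega>) \<le> G n (orbit i \<omega>) + G m (orbit (i + n) \<omega>)"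
    and one: "AE \<omega> in M. \<forall>i. G 1 (orbit i \<omega>) \<le> C"
    and int: "\<And>n. n \<ge> 1 \<Longrightarrow> integrable M (\<lambda>\<omega>. G n (orbit 0 \<omega>))"
    and low: "\<And>n. n \<ge> 1 \<Longrightarrow> real n * \<mu> \<le> expectation (\<lambda>\<omega>. G n (orbit 0 \<omega>))"
    and \<beta>: "\<beta> < \<mu>"
  shows "AE \<omega> in M. \<forall>\<^sub>F n in sequentially. real n * \<beta> \<le> G n (orbit 0 \<omega>)"
proof -
  obtain \<gamma> where \<gamma>: "\<beta> < \<gamma>" "\<gamma> < \<mu>" using dense[OF \<beta>] by blast
  \<comment> \<open>The increasing slopes \<open>r k\<close> express that the lower rate is strictly below \<open>\<gamma>\<close>.  The gap between two
    of them absorbs the initial part of the orbit, so that the event \<open>Q\<close> is inherited from a shifted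
    orbit by the orbit itself.\<close>
  define r where "r k = \<gamma> - 1 / real (Suc k)" for k
  define Q where "Q z \<longleftrightarrow> (\<exists>k. \<forall>N. \<exists>n\<ge>N. G n z < real n * r k)" for z
  have [measurable]: "Measurable.pred seqs Q" unfolding Q_def by measurable
  have "AE \<omega> in M. \<forall>i. Q (orbit i \<omega>) \<longrightarrow> Q (orbit 0 \<omega>)"
    using sub
  proof eventually_elim
    case (elim \<omega>)
    show ?case
    proof (intro allI impI)
      fix i assume "Q (orbit i \<omega>)"
      then obtain k where k: "\<forall>N. \<exists>n\<ge>N. G n (orbit i \<omega>) < real n * r k"
        unfolding Q_def by blast
      define e where "e = r (Suc (2 * k)) - r k"
      have e0: "e > 0" unfolding e_def r_def by (simp add: frac_less2)
      define b where "b = G i (orbit 0 \<omega>) - real i * r (Suc (2 * k))"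
      have "\<exists>n\<ge>N. G n (orbit 0 \<omega>) < real n * r (Suc (2 * k))" for N
      proof -
        obtain n where n: "n \<ge> max N (nat \<lceil>b / e\<rceil> + 1)" "G n (orbit i \<omega>) < real n * r k"
          using k by blast
        have "b / e < real n" using n(1) by linarith
        then have b: "b < real n * e" using e0 by (simp add: field_simps)
        have "G (i + n) (orbit 0 \<omega>) \<le> G i (orbit 0 \<omega>) + G n (orbit (0 + i) \<omega>)" using elim by blast
        also have "\<dots> < G i (orbit 0 \<omega>) + real n * r k" using n(2) by simp
        also have "\<dots> = b + real i * r (Suc (2 * k)) + real n * (r (Suc (2 * k)) - e)"
          by (simp add: b_def e_def)
        also have "\<dots> < real (i + n) * r (Suc (2 * k))" using b by (simp add: algebra_simps)
        finally have "G (i + n) (orbit 0 \<omega>) < real (i + n) * r (Suc (2 * k))" .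
        then show ?thesis using n(1) by (intro exI[of _ "i + n"]) auto
      qed
      then show "Q (orbit 0 \<omega>)" unfolding Q_def by blast
    qed
  qed
  then have 01: "prob {\<omega>\<in>space M. Q (orbit 0 \<omega>)} \<in> {0, 1}" by (intro zero_one) auto
  have "prob {\<omega>\<in>space M. Q (orbit 0 \<omega>)} \<noteq> 1"
  proof
    assume "prob {\<omega>\<in>space M. Q (orbit 0 \<omega>)} = 1"
    then have "AE \<omega> in M. Q (orbit 0 \<omega>)" by (subst (asm) prob_Collect_eq_1) auto
    then have "AE \<omega> in M. \<exists>n\<ge>1. G n (orbit 0 \<omega>) < real n * \<gamma>"
    proof eventually_elim
      case (elim \<omega>)
      then obtain k n where "n \<ge> 1" "G n (orbit 0 \<omega>) < real n * r k"
        unfolding Q_def by blast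
      moreover have "real n * r k \<le> real n * \<gamma>" by (intro mult_left_mono) (auto simp: r_def)
      ultimately show ?case by (intro exI[of _ n] conjI) linarith+
    qed
    from subadditive_returns_bound[OF G sub one int low this] \<gamma>(2) show False by simp
  qed
  then have "prob {\<omega>\<in>space M. Q (orbit 0 \<omega>)} = 0" using 01 by blast
  then have "AE \<omega> in M. \<not> Q (orbit 0 \<omega>)" by (subst (asm) prob_Collect_eq_0) auto
  then show ?thesis
  proof eventually_elim
    case (elim \<omega>)
    obtain k where "1 / real (Suc k) < \<gamma> - \<beta>"
      using \<gamma>(1) nat_approx_posE[of "\<gamma> - \<beta>"] by auto
    then have k: "\<beta> \<le> r k" by (simp add: r_def)
    from elim obtain N where N: "\<And>n. n \<ge> N \<Longrightarrow> real n * r k \<le> G n (orbit 0 \<omega>)"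
      unfolding Q_def by (meson not_le)
    have "real n * \<beta> \<le> G n (orbit 0 \<omega>)" if "n \<ge> N" for n
      using N[OF that] mult_left_mono[OF k, of "real n"] by linarith
    then show ?case by (auto simp: eventually_sequentially)
  qed
qed

text \<open>One half of the law of large numbers; the other half is the same statement for \<open>- h\<close>.  Here \<open>h\<close>
  may depend on the whole future of the sequence, so that the summands need not be independent.\<close>

lemma bounded_averages_ge:
  fixes h :: "(nat \<Rightarrow> 's) \<Rightarrow> real"
  assumes h [measurable]: "h \<in> borel_measurable seqs" and bd: "\<And>z. \<bar>h z\<bar> \<le> C"
    and \<beta>: "\<beta> < expectation (\<lambda>\<omega>. h (orbit 0 \<omega>))"
  shows "AE \<omega> in M. \<forall>\<^sub>F n in sequentially. real n * \<beta> \<le> (\<Sum>k<n. h (orbit k \<omega>))"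
proof -
  define G where "G n z = (\<Sum>k<n. h (\<lambda>j. z (k + j)))" for n z
  have [measurable]: "(\<lambda>z j. z (k + j)) \<in> measurable seqs seqs" for k :: nat
    using measurable_restrict[of UNIV "\<lambda>j z. z (k + j)" seqs "\<lambda>_. S"] by (simp add: restrict_def)
  have orb: "(\<lambda>j. orbit i \<omega> (k + j)) = orbit (i + k) \<omega>" for i k \<omega>
    by (simp add: orbit_def add.assoc)
  have G: "G n (orbit i \<omega>) = (\<Sum>k<n. h (orbit (i + k) \<omega>))" for n i \<omega>
    by (simp add: G_def orb)
  have int: "integrable M (\<lambda>\<omega>. h (orbit i \<omega>))" for i
    using bd by (intro integrable_const_bound[of _ C]) auto
  have "AE \<omega> in M. \<forall>\<^sub>F n in sequentially. real n * \<beta> \<le> G n (orbit 0 \<omega>)"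
  proof (rule subadditive_liminf[OF _ _ _ _ _ \<beta>])
    show "G n \<in> borel_measurable seqs" for n unfolding G_def by measurable
    show "AE \<omega> in M. \<forall>i n m. G (n + m) (orbit i \<omega>) \<le> G n (orbit i \<omega>) + G m (orbit (i + n) \<omega>)"
    proof (intro AE_I2 allI)
      fix \<omega> i n m
      have "G (n + m) (orbit i \<omega>) = G n (orbit i \<omega>) + G m (orbit (i + n) \<omega>)"
        unfolding G by (induction m) (simp_all add: add.assoc)
      then show "G (n + m) (orbit i \<omega>) \<le> G n (orbit i \<omega>) + G m (orbit (i + n) \<omega>)" by simp
    qed
    show "AE \<omega> in M. \<forall>i. G 1 (orbit i \<omega>) \<le> C"
      using abs_le_D1[OF bd] by (simp add: G)
    show "integrable M (\<lambda>\<omega>. G n (orbit 0 \<omega>))" for n using int by (simp add: G)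
    show "real n * expectation (\<lambda>\<omega>. h (orbit 0 \<omega>)) \<le> expectation (\<lambda>\<omega>. G n (orbit 0 \<omega>))" for n
    proof -
      have "expectation (\<lambda>\<omega>. G n (orbit 0 \<omega>)) = (\<Sum>k<n. expectation (\<lambda>\<omega>. h (orbit k \<omega>)))"
        using int by (simp add: G)
      also have "\<dots> = (\<Sum>k<n. expectation (\<lambda>\<omega>. h (orbit 0 \<omega>)))"
        by (intro sum.cong refl expectation_orbit h)
      finally show ?thesis by simp
    qed
  qed
  then show ?thesis by (simp add: G)
qed

text \<open>By \<open>subadditive_averaging\<close> the array grows at most like the averages of its entries \<open>g i m\<close> for a
  fixed block length \<open>m\<close>.  These are bounded above, and truncating them from below makes the law of
  large numbers for bounded functions applicable.\<close>

lemma subadditive_limsup: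
  fixes G :: "nat \<Rightarrow> (nat \<Rightarrow> 's) \<Rightarrow> real"
  assumes G [measurable]: "\<And>n. G n \<in> borel_measurable seqs"
    and sub: "AE \<omega> in M. \<forall>i n m. G (n + m) (orbit i \<omega>) \<le> G n (orbit i \<omega>) + G m (orbit (i + n) \<omega>)"
    and one: "AE \<omega> in M. \<forall>i. G 1 (orbit i \<omega>) \<le> C"
    and int: "\<And>n. integrable M (\<lambda>\<omega>. G n (orbit 0 \<omega>))"
    and m: "m \<ge> 1" and \<gamma>: "expectation (\<lambda>\<omega>. G m (orbit 0 \<omega>)) < real m * \<gamma>"
  shows "AE \<omega> in M. \<forall>\<^sub>F n in sequentially. G n (orbit 0 \<omega>) \<le> real n * \<gamma>"
proof -
  define D where "D = real m * C"
  have GD: "AE \<omega> in M. \<forall>i. G m (orbit i \<omega>) \<le> D"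
    using sub one
  proof eventually_elim
    case (elim \<omega>)
    then show ?case
      using subadditive_linear_bound[of "\<lambda>i n. G n (orbit i \<omega>)" C m] m by (simp add: D_def)
  qed
  \<comment> \<open>Truncation from below is harmless for an upper bound; truncation at \<open>D\<close> has no effect almost
    surely and makes \<open>h\<close> bounded everywhere.\<close>
  define h where "h K z = min (max (G m z) (- real K)) D" for K z
  have [measurable]: "h K \<in> borel_measurable seqs" for K unfolding h_def by measurable
  have "(\<lambda>K. expectation (\<lambda>\<omega>. h K (orbit 0 \<omega>))) \<longlonglongrightarrow> expectation (\<lambda>\<omega>. G m (orbit 0 \<omega>))"
  proof (rule integral_dominated_convergence[where w = "\<lambda>\<omega>. \<bar>G m (orbit 0 \<omega>)\<bar> + \<bar>D\<bar>"])
    show "integrable M (\<lambda>\<omega>. \<bar>G m (orbit 0 \<omega>)\<bar> + \<bar>D\<bar>)" using int by simp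
    show "AE \<omega> in M. (\<lambda>K. h K (orbit 0 \<omega>)) \<longlonglongrightarrow> G m (orbit 0 \<omega>)"
      using GD
    proof eventually_elim
      case (elim \<omega>)
      have "\<forall>\<^sub>F K in sequentially. max (- D) (- G m (orbit 0 \<omega>)) \<le> real K"
        using filterlim_real_sequentially unfolding filterlim_at_top by blast
      then have "\<forall>\<^sub>F K in sequentially. h K (orbit 0 \<omega>) = G m (orbit 0 \<omega>)"
        by eventually_elim (use elim in \<open>auto simp: h_def\<close>)
      then show ?case by (rule tendsto_eventually)
    qed
    show "AE \<omega> in M. norm (h K (orbit 0 \<omega>)) \<le> \<bar>G m (orbit 0 \<omega>)\<bar> + \<bar>D\<bar>" for K
      using GD by eventually_elim (auto simp: h_def)
  qed auto
  then have "\<forall>\<^sub>F K in sequentially. expectation (\<lambda>\<omega>. h K (orbit 0 \<omega>)) < real m * \<gamma>"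
    using \<gamma> by (rule order_tendstoD(2))
  then obtain K where K: "expectation (\<lambda>\<omega>. h K (orbit 0 \<omega>)) < real m * \<gamma>"
    by (auto simp: eventually_sequentially)
  then obtain \<eta> where \<eta>: "expectation (\<lambda>\<omega>. h K (orbit 0 \<omega>)) < \<eta>" "\<eta> < real m * \<gamma>"
    using dense by blast
  have "AE \<omega> in M. \<forall>\<^sub>F n in sequentially. real n * (- \<eta>) \<le> (\<Sum>k<n. - h K (orbit k \<omega>))"
  proof (rule bounded_averages_ge)
    show "\<bar>- h K z\<bar> \<le> real K + \<bar>D\<bar>" for z by (auto simp: h_def)
    show "- \<eta> < expectation (\<lambda>\<omega>. - h K (orbit 0 \<omega>))" using \<eta>(1) by simp
  qed auto
  then show ?thesis
    using sub one GD
  proof eventually_elim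
    case (elim \<omega>)
    obtain B where B: "\<And>n. real m * G (n + m) (orbit 0 \<omega>) \<le> (\<Sum>i<n. G m (orbit i \<omega>)) + B"
      using subadditive_averaging[of "\<lambda>i n. G n (orbit i \<omega>)" C m] elim(2,3) by blast
    have "G m (orbit i \<omega>) \<le> h K (orbit i \<omega>)" for i
      using elim(4) by (auto simp: h_def)
    then have "(\<Sum>i<n. G m (orbit i \<omega>)) \<le> (\<Sum>i<n. h K (orbit i \<omega>))" for n
      by (intro sum_mono)
    note B' = order.trans[OF B add_right_mono[OF this]]
    from elim(1) have "\<forall>\<^sub>F n in sequentially. real m * G (n + m) (orbit 0 \<omega>) \<le> real n * \<eta> + B"
    proof eventually_elim
      case (elim n)
      then show ?case using B'[of n] by (simp add: sum_negf)
    qed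
    then show ?case by (rule eventually_linear_bound[OF m _ \<eta>(2)])
  qed
qed

text \<open>The limit \<open>\<mu>\<close> is the infimum of the mean rates.  The convergence of these rates to their infimum
  (Fekete's lemma) is again an instance of \<open>subadditive_averaging\<close>, for an array independent of \<open>i\<close>.\<close>

lemma subadditive_ergodic:
  fixes G :: "nat \<Rightarrow> (nat \<Rightarrow> 's) \<Rightarrow> real"
  assumes G [measurable]: "\<And>n. G n \<in> borel_measurable seqs"
    and sub: "AE \<omega> in M. \<forall>i n m. G (n + m) (orbit i \<omega>) \<le> G n (orbit i \<omega>) + G m (orbit (i + n) \<omega>)"
    and one: "AE \<omega> in M. \<forall>i. G 1 (orbit i \<omega>) \<le> C"
    and int: "\<And>n. integrable M (\<lambda>\<omega>. G n (orbit 0 \<omega>))"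
    and low: "\<And>n. real n * L \<le> expectation (\<lambda>\<omega>. G n (orbit 0 \<omega>))"
  obtains \<mu> where "(\<lambda>n. expectation (\<lambda>\<omega>. G n (orbit 0 \<omega>)) / real n) \<longlonglongrightarrow> \<mu>"
    "AE \<omega> in M. (\<lambda>n. G n (orbit 0 \<omega>) / real n) \<longlonglongrightarrow> \<mu>"
proof -
  define u where "u n = expectation (\<lambda>\<omega>. G n (orbit 0 \<omega>))" for n
  define V where "V = (\<lambda>n. u n / real n) ` {1..}"
  define \<mu> where "\<mu> = Inf V"
  have V: "bdd_below V" "V \<noteq> {}"
    using low by (auto simp: V_def u_def field_simps intro!: bdd_belowI2[of _ L])
  have ge: "real n * \<mu> \<le> u n" if "n \<ge> 1" for n
  proof -
    have "\<mu> \<le> u n / real n" unfolding \<mu>_def using V that by (intro cInf_lower) (auto simp: V_def)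
    then show ?thesis using that by (simp add: field_simps)
  qed
  have approx: "\<exists>m\<ge>1. u m < real m * \<gamma>" if less: "\<mu> < \<gamma>" for \<gamma>
  proof -
    obtain v where "v \<in> V" "v < \<gamma>" using cInf_lessD[OF V(2), of \<gamma>] less unfolding \<mu>_def by blast
    then obtain m where "m \<ge> 1" "u m / real m < \<gamma>" by (auto simp: V_def)
    then show ?thesis by (intro exI[of _ m]) (simp add: field_simps)
  qed
  have intE: "integrable M (\<lambda>\<omega>. G n (orbit i \<omega>))" for n i using int integrable_orbit[OF G] by blast
  have usub: "u (n + m) \<le> u n + u m" for n m
  proof -
    have "AE \<omega> in M. G (n + m) (orbit 0 \<omega>) \<le> G n (orbit 0 \<omega>) + G m (orbit (0 + n) \<omega>)"
      using sub by eventually_elim blast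
    then have "u (n + m) \<le> expectation (\<lambda>\<omega>. G n (orbit 0 \<omega>) + G m (orbit (0 + n) \<omega>))"
      unfolding u_def by (intro integral_mono_AE Bochner_Integration.integrable_add intE)
    also have "\<dots> = u n + u m"
      using intE expectation_orbit[OF G, of m n] by (simp add: u_def)
    finally show ?thesis .
  qed
  have upper: "\<forall>\<^sub>F n in sequentially. u n \<le> real n * \<gamma>" if \<gamma>: "\<mu> < \<gamma>" for \<gamma>
  proof -
    obtain m where m: "m \<ge> 1" "u m < real m * \<gamma>" using approx[OF \<gamma>] by blast
    obtain B where "\<And>n. real m * u (n + m) \<le> (\<Sum>i<n. u m) + B"
      using subadditive_averaging[of "\<lambda>_. u" "u 1" m] usub by auto
    then show ?thesis
      by (intro eventually_linear_bound[OF m(1) _ m(2), of _ B] always_eventually) auto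
  qed
  have limI: "(\<lambda>n. v n / real n) \<longlonglongrightarrow> \<mu>"
    if "\<And>k. \<forall>\<^sub>F n in sequentially. v n \<le> real n * (\<mu> + 1 / real (Suc k))"
       "\<And>k. \<forall>\<^sub>F n in sequentially. real n * (\<mu> - 1 / real (Suc k)) \<le> v n" for v
  proof (rule tendstoI)
    fix e :: real assume "0 < e"
    then obtain k where k: "1 / real (Suc k) < e" using nat_approx_posE by blast
    show "\<forall>\<^sub>F n in sequentially. dist (v n / real n) \<mu> < e"
      using that(1)[of k] that(2)[of k] eventually_gt_at_top[of 0]
    proof eventually_elim
      case (elim n)
      then have "v n / real n \<le> \<mu> + 1 / real (Suc k)" "\<mu> - 1 / real (Suc k) \<le> v n / real n"
        by (simp_all add: divide_le_eq le_divide_eq mult.commute)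
      then show ?case using k by (simp add: dist_real_def abs_less_iff)
    qed
  qed
  have "(\<lambda>n. u n / real n) \<longlonglongrightarrow> \<mu>"
  proof (rule limI)
    fix k
    show "\<forall>\<^sub>F n in sequentially. u n \<le> real n * (\<mu> + 1 / real (Suc k))" by (rule upper) simp
    show "\<forall>\<^sub>F n in sequentially. real n * (\<mu> - 1 / real (Suc k)) \<le> u n"
      using eventually_ge_at_top[of 1]
    proof eventually_elim
      case (elim n)
      have "real n * (\<mu> - 1 / real (Suc k)) \<le> real n * \<mu>" by (intro mult_left_mono) auto
      then show ?case using ge[OF elim] by linarith
    qed
  qed
  moreover have "AE \<omega> in M. (\<lambda>n. G n (orbit 0 \<omega>) / real n) \<longlonglongrightarrow> \<mu>"
  proof -
    have "AE \<omega> in M. \<forall>k. \<forall>\<^sub>F n in sequentially. G n (orbit 0 \<omega>) \<le> real n * (\<mu> + 1 / real (Suc k))"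
      unfolding AE_all_countable
    proof
      fix k
      obtain m where "m \<ge> 1" "u m < real m * (\<mu> + 1 / real (Suc k))"
        using approx[of "\<mu> + 1 / real (Suc k)"] by auto
      then show "AE \<omega> in M. \<forall>\<^sub>F n in sequentially. G n (orbit 0 \<omega>) \<le> real n * (\<mu> + 1 / real (Suc k))"
        unfolding u_def by (intro subadditive_limsup[OF G sub one int])
    qed
    moreover have "AE \<omega> in M. \<forall>k. \<forall>\<^sub>F n in sequentially. real n * (\<mu> - 1 / real (Suc k)) \<le> G n (orbit 0 \<omega>)"
      unfolding AE_all_countable
    proof
      fix k
      show "AE \<omega> in M. \<forall>\<^sub>F n in sequentially. real n * (\<mu> - 1 / real (Suc k)) \<le> G n (orbit 0 \<omega>)"
        using ge unfolding u_def by (intro subadditive_liminf[OF G sub one int, of \<mu>]) auto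
    qed
    ultimately show ?thesis
      by eventually_elim (auto intro!: limI)
  qed
  ultimately show ?thesis using that unfolding u_def by blast
qed

end

section \<open>Expectations of logarithms\<close>

lemma elog_pos: "x > 0 \<Longrightarrow> elog x = ereal (ln x)"
  by (simp add: elog_def)

lemma elog_measurable [measurable]: "elog \<in> borel_measurable borel"
  unfolding elog_def by measurable

text \<open>Comparison with an integrable function controls the expectation also of functions of which
  measurability is not known, such as the logarithm of the largest singular value.\<close>

lemma ereal_expectation_bounds:
  fixes f :: "'a \<Rightarrow> ereal"
  assumes "integrable M h"
  shows "AE \<omega> in M. f \<omega> \<le> ereal (h \<omega>) \<Longrightarrow> ereal_expectation M f \<le> ereal (\<integral>\<omega>. h \<omega> \<partial>M)"
    and "AE \<omega> in M. ereal (h \<omega>) \<le> f \<omega> \<Longrightarrow> ereal (\<integral>\<omega>. h \<omega> \<partial>M) \<le> ereal_expectation M f"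
proof -
  let ?p = "\<lambda>f. \<integral>\<^sup>+\<omega>. e2ennreal (f \<omega>) \<partial>M" and ?m = "\<lambda>f. \<integral>\<^sup>+\<omega>. e2ennreal (- f \<omega>) \<partial>M"
  let ?h = "\<lambda>\<omega>. ereal (h \<omega>)"
  have eq: "e2ennreal (ereal r) = ennreal r" for r by (simp add: ennreal.abs_eq e2ennreal_def)
  have mono: "x \<le> ereal r \<Longrightarrow> e2ennreal x \<le> ennreal r" "ereal r \<le> x \<Longrightarrow> ennreal r \<le> e2ennreal x" for x r
    using e2ennreal_mono[of x "ereal r"] e2ennreal_mono[of "ereal r" x] by (simp_all add: eq)
  have "?p ?h = (\<integral>\<^sup>+\<omega>. ennreal (h \<omega>) \<partial>M)" "?m ?h = (\<integral>\<^sup>+\<omega>. ennreal (- h \<omega>) \<partial>M)"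
    by (simp_all add: eq)
  moreover have "(\<integral>\<^sup>+\<omega>. ennreal (h \<omega>) \<partial>M) < \<infinity>" "(\<integral>\<^sup>+\<omega>. ennreal (- h \<omega>) \<partial>M) < \<infinity>"
    using assms by (auto simp: real_integrable_def less_top)
  ultimately obtain p m where pm: "?p ?h = ennreal p" "?m ?h = ennreal m" "0 \<le> p" "0 \<le> m"
    by (metis ennreal_cases infinity_ennreal_def less_irrefl)
  have int: "(\<integral>\<omega>. h \<omega> \<partial>M) = p - m"
    using real_lebesgue_integral_def[OF assms] pm by (simp add: eq)
  { assume le: "AE \<omega> in M. f \<omega> \<le> ?h \<omega>"
    have "?p f \<le> ennreal p" unfolding pm(1)[symmetric]
      using le by (intro nn_integral_mono_AE) (auto elim!: eventually_mono intro: mono simp: eq)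
    then have 1: "enn2ereal (?p f) \<le> ereal p" using pm by (metis enn2ereal_ennreal less_eq_ennreal.rep_eq)
    have "ennreal m \<le> ?m f" unfolding pm(2)[symmetric]
      using le by (intro nn_integral_mono_AE) (auto elim!: eventually_mono intro!: e2ennreal_mono simp: ereal_minus_le_minus simp flip: uminus_ereal.simps)
    then have 2: "ereal m \<le> enn2ereal (?m f)" using pm by (metis enn2ereal_ennreal less_eq_ennreal.rep_eq)
    show "ereal_expectation M f \<le> ereal (\<integral>\<omega>. h \<omega> \<partial>M)"
      unfolding ereal_expectation_def int using ereal_minus_mono[OF 1 2] by simp }
  { assume le: "AE \<omega> in M. ?h \<omega> \<le> f \<omega>"
    have "ennreal p \<le> ?p f" unfolding pm(1)[symmetric]
      using le by (intro nn_integral_mono_AE) (auto elim!: eventually_mono intro: mono simp: eq)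
    then have 1: "ereal p \<le> enn2ereal (?p f)" using pm by (metis enn2ereal_ennreal less_eq_ennreal.rep_eq)
    have "?m f \<le> ennreal m" unfolding pm(2)[symmetric]
      using le by (intro nn_integral_mono_AE) (auto elim!: eventually_mono intro!: e2ennreal_mono simp: ereal_minus_le_minus simp flip: uminus_ereal.simps)
    then have 2: "enn2ereal (?m f) \<le> ereal m" using pm by (metis enn2ereal_ennreal less_eq_ennreal.rep_eq)
    show "ereal (\<integral>\<omega>. h \<omega> \<partial>M) \<le> ereal_expectation M f"
      unfolding ereal_expectation_def int using ereal_minus_mono[OF 1 2] by simp }
qed

lemma finite_expected_log:
  fixes f :: "'a \<Rightarrow> real"
  assumes [measurable]: "f \<in> borel_measurable M" and le: "AE \<omega> in M. f \<omega> \<le> 1"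
    and fin: "ereal_expectation M (\<lambda>\<omega>. elog (f \<omega>)) > -\<infinity>"
  shows "AE \<omega> in M. f \<omega> > 0" and "integrable M (\<lambda>\<omega>. ln (f \<omega>))"
proof -
  have "(\<integral>\<^sup>+\<omega>. e2ennreal (elog (f \<omega>)) \<partial>M) = (\<integral>\<^sup>+\<omega>. 0 \<partial>M)"
  proof (rule nn_integral_cong_AE)
    show "AE \<omega> in M. e2ennreal (elog (f \<omega>)) = 0"
      using le
    proof eventually_elim
      case (elim \<omega>)
      then have "elog (f \<omega>) \<le> 0" by (auto simp: elog_def)
      then show ?case by (rule e2ennreal_neg)
    qed
  qed
  then have finite: "(\<integral>\<^sup>+\<omega>. e2ennreal (- elog (f \<omega>)) \<partial>M) \<noteq> \<infinity>"
    using fin unfolding ereal_expectation_def by (auto simp: zero_ennreal.rep_eq)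
  then have "AE \<omega> in M. e2ennreal (- elog (f \<omega>)) \<noteq> \<infinity>"
    by (intro nn_integral_PInf_AE) auto
  then show pos: "AE \<omega> in M. f \<omega> > 0"
    by eventually_elim (auto simp: elog_def split: if_splits)
  show "integrable M (\<lambda>\<omega>. ln (f \<omega>))"
  proof (rule integrableI_bounded)
    have "(\<integral>\<^sup>+\<omega>. ennreal (norm (ln (f \<omega>))) \<partial>M) = (\<integral>\<^sup>+\<omega>. e2ennreal (- elog (f \<omega>)) \<partial>M)"
    proof (rule nn_integral_cong_AE)
      show "AE \<omega> in M. ennreal (norm (ln (f \<omega>))) = e2ennreal (- elog (f \<omega>))"
        using pos le
        by eventually_elim (auto simp: elog_def ennreal.abs_eq e2ennreal_def)
    qed
    then show "(\<integral>\<^sup>+\<omega>. ennreal (norm (ln (f \<omega>))) \<partial>M) < \<infinity>"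
      using finite by (simp add: less_top)
  qed simp
qed

section \<open>Independent splitting ratios\<close>

text \<open>The complement of the support is covered by those members of a countable basis that carry no mass.\<close>

lemma (in prob_space) AE_in_rv_support:
  assumes [measurable]: "X \<in> borel_measurable M"
  shows "AE \<omega> in M. X \<omega> \<in> rv_support M X"
proof -
  obtain B :: "real set set" where B: "countable B" "topological_basis B"
    using ex_countable_basis by blast
  define B0 where "B0 = {b\<in>B. prob {\<omega>\<in>space M. X \<omega> \<in> b} = 0}"
  have "AE \<omega> in M. \<forall>b\<in>B0. X \<omega> \<notin> b"
  proof (subst AE_ball_countable)
    show "countable B0" using B(1) by (simp add: B0_def)
    show "\<forall>b\<in>B0. AE \<omega> in M. X \<omega> \<notin> b"
    proof
      fix b assume b: "b \<in> B0"
      then have "open b" using B(2) by (auto simp: B0_def topological_basis_open)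
      then have [measurable]: "b \<in> sets borel" by simp
      show "AE \<omega> in M. X \<omega> \<notin> b"
        using b by (subst prob_Collect_eq_0[symmetric]) (auto simp: B0_def)
    qed
  qed
  then show ?thesis
  proof eventually_elim
    case (elim \<omega>)
    show ?case
    proof (rule ccontr)
      assume "X \<omega> \<notin> rv_support M X"
      then obtain U where U: "open U" "X \<omega> \<in> U" "\<not> prob {\<omega>\<in>space M. X \<omega> \<in> U} > 0"
        by (auto simp: rv_support_def)
      then obtain b where b: "b \<in> B" "X \<omega> \<in> b" "b \<subseteq> U"
        using topological_basisE[OF B(2) U(1,2)] by metis
      have [measurable]: "U \<in> sets borel" using U(1) by simp
      have "prob {\<omega>\<in>space M. X \<omega> \<in> b} \<le> prob {\<omega>\<in>space M. X \<omega> \<in> U}"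
        using b(3) by (intro finite_measure_mono) auto
      then have "b \<in> B0" using U(3) b(1) by (simp add: B0_def) (meson measure_nonneg not_le order_antisym order_trans)
      then show False using elim b(2) by blast
    qed
  qed
qed

text \<open>Identically distributed independent families over the same index set have the same joint law; this
  transports the assumption on the variables \<open>Y\<close> to the ratios used in a step.\<close>

lemma (in prob_space) distr_iid_tuple:
  assumes "iid_copies M \<xi> V J" "J \<noteq> {}"
  shows "distr M (\<Pi>\<^sub>M i\<in>J. borel) (\<lambda>\<omega>. \<lambda>i\<in>J. V i \<omega>) = (\<Pi>\<^sub>M i\<in>J. distr M borel \<xi>)"
proof -
  have "distr M (\<Pi>\<^sub>M i\<in>J. borel) (\<lambda>\<omega>. \<lambda>i\<in>J. V i \<omega>) = (\<Pi>\<^sub>M i\<in>J. distr M borel (V i))"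
    using assms by (intro indep_vars_iff_distr_eq_PiM'[THEN iffD1])
      (auto simp: iid_copies_def indep_vars_def2)
  also have "\<dots> = (\<Pi>\<^sub>M i\<in>J. distr M borel \<xi>)"
    using assms by (intro PiM_cong) (auto simp: iid_copies_def)
  finally show ?thesis .
qed

text \<open>The ratios used in one step form a row, and the rows form an i.i.d. sequence.  The index \<open>k\<close> starts
  at \<open>0\<close>, whereas the first subdivision has number \<open>1\<close>.\<close>

lemma (in prob_space) iid_sequence_rows:
  fixes X :: "nat \<Rightarrow> nat \<Rightarrow> 'a \<Rightarrow> real"
  assumes \<xi>: "\<xi> \<in> borel_measurable M"
    and iid: "iid_copies M \<xi> (\<lambda>(n, j). X n j) ({1..} \<times> {..<d})" and d: "d > 0"
  defines "S \<equiv> \<Pi>\<^sub>M j\<in>{..<d}. borel" and "Z \<equiv> \<lambda>k \<omega>. \<lambda>j\<in>{..<d}. X (Suc k) j \<omega>"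
  shows "iid_sequence M S Z" and "distr M S (Z k) = (\<Pi>\<^sub>M j\<in>{..<d}. distr M borel \<xi>)"
proof -
  let ?I = "{1..} \<times> {..<d} :: (nat \<times> nat) set"
  let ?X = "\<lambda>\<omega>. \<lambda>p\<in>?I. X (fst p) (snd p) \<omega>"
  have case_eq: "(\<lambda>(n, j). X n j) = (\<lambda>p. X (fst p) (snd p))" by auto
  have ind: "indep_vars (\<lambda>_. borel) (\<lambda>p. X (fst p) (snd p)) ?I"
    using iid by (simp add: iid_copies_def case_eq)
  then have X: "X n j \<in> borel_measurable M" if "n \<ge> 1" "j < d" for n j
    using that unfolding indep_vars_def2 by force
  have D: "distr M (\<Pi>\<^sub>M p\<in>?I. borel) ?X = (\<Pi>\<^sub>M p\<in>?I. distr M borel \<xi>)"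
  proof -
    have "?I \<noteq> {}" using d by auto
    from distr_iid_tuple[OF iid this] show ?thesis by (simp only: case_eq)
  qed
  have Xm: "?X \<in> measurable M (\<Pi>\<^sub>M p\<in>?I. borel)" by (rule measurable_restrict) (auto intro: X)
  show ident: "distr M S (Z k) = (\<Pi>\<^sub>M j\<in>{..<d}. distr M borel \<xi>)" for k
  proof -
    let ?p = "\<lambda>z. \<lambda>j\<in>{..<d}. z (Suc k, j)"
    have pm: "?p \<in> measurable (\<Pi>\<^sub>M p\<in>?I. borel) S"
      unfolding S_def by (intro measurable_restrict measurable_component_singleton) auto
    have "distr M S (Z k) = distr (distr M (\<Pi>\<^sub>M p\<in>?I. borel) ?X) S ?p"
      unfolding distr_distr[OF pm Xm] by (intro distr_cong) (auto simp: Z_def)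
    also have "\<dots> = distr (\<Pi>\<^sub>M p\<in>?I. distr M borel \<xi>) (\<Pi>\<^sub>M j\<in>{..<d}. distr M borel \<xi>) ?p"
      unfolding D by (rule distr_cong) (auto simp: S_def intro!: sets_PiM_cong)
    also have "\<dots> = (\<Pi>\<^sub>M j\<in>{..<d}. distr M borel \<xi>)"
      using distr_PiM_reindex[of ?I "\<lambda>_. distr M borel \<xi>" "\<lambda>j. (Suc k, j)" "{..<d}"] \<xi>
      by (auto simp: inj_on_def intro: prob_space_distr)
    finally show ?thesis .
  qed
  have "indep_vars (\<lambda>k. \<Pi>\<^sub>M p\<in>{Suc k} \<times> {..<d}. borel)
      (\<lambda>k \<omega>. restrict (\<lambda>p. X (fst p) (snd p) \<omega>) ({Suc k} \<times> {..<d})) UNIV"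
    by (rule indep_vars_restrict[OF ind]) (auto simp: disjoint_family_on_def)
  then have "indep_vars (\<lambda>_. S)
      (\<lambda>k \<omega>. \<lambda>j\<in>{..<d}. restrict (\<lambda>p. X (fst p) (snd p) \<omega>) ({Suc k} \<times> {..<d}) (Suc k, j)) UNIV"
  proof (rule indep_vars_compose2)
    show "(\<lambda>z. \<lambda>j\<in>{..<d}. z (Suc k, j)) \<in> measurable (\<Pi>\<^sub>M p\<in>{Suc k} \<times> {..<d}. borel) S" for k
      unfolding S_def by (intro measurable_restrict measurable_component_singleton) simp
  qed
  also have "(\<lambda>k \<omega>. \<lambda>j\<in>{..<d}. restrict (\<lambda>p. X (fst p) (snd p) \<omega>) ({Suc k} \<times> {..<d}) (Suc k, j)) = Z"
    by (auto simp: Z_def fun_eq_iff)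
  finally show "iid_sequence M S Z"
    by unfold_locales (auto simp: ident)
qed

section \<open>Growth of the random matrix product\<close>

lemma split_det_measurable [measurable]:
  "split_det d \<in> borel_measurable (\<Pi>\<^sub>M j\<in>{..<d}. borel)"
proof -
  have [measurable]: "(\<lambda>y. y j) \<in> borel_measurable (\<Pi>\<^sub>M j\<in>{..<d}. borel :: real measure)" if "j < d" for j
    using that by (intro measurable_component_singleton) simp
  show ?thesis unfolding split_det_def[abs_def]
    by (intro borel_measurable_diff borel_measurable_times borel_measurable_prod borel_measurable_const) auto
qed

text \<open>Row \<open>k\<close> contains the ratios that lead from \<open>L\<^sub>k\<close> to \<open>L\<^sub>k\<^sub>+\<^sub>1\<close>.\<close>

locale random_splitting = iid_sequence M "\<Pi>\<^sub>M j\<in>{..<d}. borel" Z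
  for M :: "'a measure" and d :: nat and Z :: "nat \<Rightarrow> 'a \<Rightarrow> nat \<Rightarrow> real" +
  assumes d: "d \<ge> 3"
    and ratios: "AE \<omega> in M. \<forall>k. \<forall>j<d. 0 < Z k \<omega> j \<and> Z k \<omega> j < 1"
    and det_nonzero: "AE \<omega> in M. split_det d (Z 0 \<omega>) \<noteq> 0"
    and det_integrable: "integrable M (\<lambda>\<omega>. ln \<bar>split_det d (Z 0 \<omega>)\<bar>)"
begin

text \<open>Row \<open>0\<close> of \<open>z\<close> is used in step \<open>1\<close>, hence the shift of the index.\<close>

definition mat_of :: "nat \<Rightarrow> (nat \<Rightarrow> nat \<Rightarrow> real) \<Rightarrow> real mat" where
  "mat_of n z = step_mat_prod d (\<lambda>k. z (k - 1)) n"

definition log_norm :: "nat \<Rightarrow> (nat \<Rightarrow> nat \<Rightarrow> real) \<Rightarrow> real" where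
  "log_norm n z = ln (entry_norm (mat_of n z))"

lemma coordinate_measurable:
  assumes "j < d" shows "(\<lambda>z. z k j) \<in> borel_measurable seqs"
proof -
  have "(\<lambda>z. z k) \<in> measurable seqs (\<Pi>\<^sub>M j\<in>{..<d}. borel)" by (rule measurable_component_singleton) simp
  moreover have "(\<lambda>y. y j) \<in> borel_measurable (\<Pi>\<^sub>M j\<in>{..<d}. borel :: real measure)"
    using assms by (intro measurable_component_singleton) simp
  ultimately show ?thesis by (rule measurable_compose)
qed

lemma log_norm_measurable [measurable]: "log_norm n \<in> borel_measurable seqs"
proof -
  have F: "(\<lambda>z. split_seq d (\<lambda>k. z (k - 1)) f n j) \<in> borel_measurable seqs" if "j < d" for f j
    using that
  proof (induction n arbitrary: j)
    case (Suc n)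
    have "Suc j mod d < d" using d by simp
    then have [measurable]: "(\<lambda>z. split_seq d (\<lambda>k. z (k - 1)) f n j) \<in> borel_measurable seqs"
      "(\<lambda>z. split_seq d (\<lambda>k. z (k - 1)) f n (Suc j mod d)) \<in> borel_measurable seqs"
      "(\<lambda>z. z n j) \<in> borel_measurable seqs"
      using Suc by (auto intro: coordinate_measurable)
    show ?case unfolding split_seq.simps split_step_def diff_Suc_1 by measurable
  qed simp
  have d2: "d \<ge> 2" using d by simp
  show ?thesis
    unfolding log_norm_def[abs_def] mat_of_def entry_norm_step_mat_prod[OF d2]
    by (intro borel_measurable_ln borel_measurable_sum borel_measurable_abs borel_measurable_diff F) auto
qed

lemma det_orbit:
  shows "AE \<omega> in M. \<forall>k. split_det d (Z k \<omega>) \<noteq> 0"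
    and "integrable M (\<lambda>\<omega>. ln \<bar>split_det d (Z k \<omega>)\<bar>)"
    and "expectation (\<lambda>\<omega>. ln \<bar>split_det d (Z k \<omega>)\<bar>) = expectation (\<lambda>\<omega>. ln \<bar>split_det d (Z 0 \<omega>)\<bar>)"
proof -
  have comp [measurable]: "(\<lambda>z. z 0) \<in> measurable seqs (\<Pi>\<^sub>M j\<in>{..<d}. borel)"
    by (rule measurable_component_singleton) simp
  let ?f = "\<lambda>z. ln \<bar>split_det d (z 0)\<bar>"
  have orb: "orbit k \<omega> 0 = Z k \<omega>" for k \<omega> by (simp add: orbit_def)
  have f: "?f \<in> borel_measurable seqs" by measurable
  show "integrable M (\<lambda>\<omega>. ln \<bar>split_det d (Z k \<omega>)\<bar>)"
    using integrable_orbit[OF f, of k] det_integrable by (simp add: orb)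
  show "expectation (\<lambda>\<omega>. ln \<bar>split_det d (Z k \<omega>)\<bar>) = expectation (\<lambda>\<omega>. ln \<bar>split_det d (Z 0 \<omega>)\<bar>)"
    using expectation_orbit[OF f, of k] by (simp add: orb)
  have Q: "Measurable.pred seqs (\<lambda>z. split_det d (z 0) = 0)" by measurable
  have "AE \<omega> in M. split_det d (Z k \<omega>) \<noteq> 0" for k
  proof -
    have "prob {\<omega>\<in>space M. split_det d (Z k \<omega>) = 0} = 0"
      using prob_orbit[OF Q, of k] det_nonzero by (simp add: orb prob_Collect_eq_0)
    then show ?thesis by (simp add: prob_Collect_eq_0)
  qed
  then show "AE \<omega> in M. \<forall>k. split_det d (Z k \<omega>) \<noteq> 0" by (simp add: AE_all_countable)
qed

lemma mat_of_orbit: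
  "mat_of n (orbit i \<omega>) = step_mat_prod d (\<lambda>k. Z (i + (k - 1)) \<omega>) n"
  by (simp add: mat_of_def orbit_def)

lemma mat_of_bounds:
  assumes Z: "\<forall>k. \<forall>j<d. 0 < Z k \<omega> j \<and> Z k \<omega> j < 1"
  shows "(\<Prod>k<n. \<bar>split_det d (Z (i + k) \<omega>)\<bar> / (2 * real d)) \<le> entry_norm (mat_of n (orbit i \<omega>))"
    and "entry_norm (mat_of n (orbit i \<omega>)) \<le> (real d)\<^sup>2"
proof -
  have d2: "d \<ge> 2" using d by simp
  let ?x = "\<lambda>k. Z (i + (k - 1)) \<omega>"
  have x: "0 \<le> ?x (Suc n) j \<and> ?x (Suc n) j \<le> 1" if "j < d" for n j
    using Z that by (simp add: less_imp_le)
  show "(\<Prod>k<n. \<bar>split_det d (Z (i + k) \<omega>)\<bar> / (2 * real d)) \<le> entry_norm (mat_of n (orbit i \<omega>))"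
    using entry_norm_step_mat_prod_ge[of d ?x n, OF d2 x] by (simp add: mat_of_orbit)
  show "entry_norm (mat_of n (orbit i \<omega>)) \<le> (real d)\<^sup>2"
    using entry_norm_step_mat_prod_le[of d ?x n, OF d2 x] by (simp add: mat_of_orbit)
qed

text \<open>The lower bound is integrable and additive in \<open>n\<close>, which makes the growth rate finite.\<close>

lemma log_norm_bounds:
  assumes Z: "\<forall>k. \<forall>j<d. 0 < Z k \<omega> j \<and> Z k \<omega> j < 1" and nz: "\<forall>k. split_det d (Z k \<omega>) \<noteq> 0"
  shows "0 < entry_norm (mat_of n (orbit i \<omega>))"
    and "log_norm n (orbit i \<omega>) \<le> ln ((real d)\<^sup>2)"
    and "(\<Sum>k<n. ln \<bar>split_det d (Z (i + k) \<omega>)\<bar> - ln (2 * real d)) \<le> log_norm n (orbit i \<omega>)"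
proof -
  let ?c = "\<lambda>k. \<bar>split_det d (Z (i + k) \<omega>)\<bar> / (2 * real d)"
  have c: "0 < ?c k" for k using nz d by auto
  have c0: "?c k \<noteq> 0" for k using c[of k] by linarith
  have p: "0 < (\<Prod>k<n. ?c k)" using c by (intro prod_pos) auto
  then show pos: "0 < entry_norm (mat_of n (orbit i \<omega>))"
    using mat_of_bounds(1)[OF Z, where n = n and i = i] by linarith
  show "log_norm n (orbit i \<omega>) \<le> ln ((real d)\<^sup>2)"
    unfolding log_norm_def using pos mat_of_bounds(2)[OF Z, where n = n and i = i] d
    by (subst ln_le_cancel_iff) auto
  have "(\<Sum>k<n. ln \<bar>split_det d (Z (i + k) \<omega>)\<bar> - ln (2 * real d)) = (\<Sum>k<n. ln (?c k))"
    using nz d by (intro sum.cong refl) (simp add: ln_div)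
  also have "\<dots> = ln (\<Prod>k<n. ?c k)" by (rule ln_prod[symmetric, OF finite_lessThan c0])
  also have "\<dots> \<le> log_norm n (orbit i \<omega>)"
    unfolding log_norm_def using p pos mat_of_bounds(1)[OF Z, where n = n and i = i] by simp
  finally show "(\<Sum>k<n. ln \<bar>split_det d (Z (i + k) \<omega>)\<bar> - ln (2 * real d)) \<le> log_norm n (orbit i \<omega>)" .
qed

lemma log_norm_subadditive:
  assumes Z: "\<forall>k. \<forall>j<d. 0 < Z k \<omega> j \<and> Z k \<omega> j < 1" and nz: "\<forall>k. split_det d (Z k \<omega>) \<noteq> 0"
  shows "log_norm (n + m) (orbit i \<omega>) \<le> log_norm n (orbit i \<omega>) + log_norm m (orbit (i + n) \<omega>)"
proof -
  have d2: "d \<ge> 2" using d by simp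
  let ?x = "\<lambda>k. Z (i + (k - 1)) \<omega>"
  have "mat_of (n + m) (orbit i \<omega>) = step_mat_prod d (\<lambda>k. ?x (n + k)) m * step_mat_prod d ?x n"
    unfolding mat_of_orbit by (rule step_mat_prod_add)
  also have "step_mat_prod d (\<lambda>k. ?x (n + k)) m = mat_of m (orbit (i + n) \<omega>)"
    unfolding mat_of_orbit by (rule step_mat_prod_cong[OF d2]) (simp add: add.assoc)
  finally have "entry_norm (mat_of (n + m) (orbit i \<omega>)) \<le>
      entry_norm (mat_of m (orbit (i + n) \<omega>)) * entry_norm (mat_of n (orbit i \<omega>))"
    unfolding mat_of_orbit by (metis entry_norm_mult step_mat_prod_carrier)
  then have "ln (entry_norm (mat_of (n + m) (orbit i \<omega>))) \<le>
      ln (entry_norm (mat_of m (orbit (i + n) \<omega>)) * entry_norm (mat_of n (orbit i \<omega>)))"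
    using log_norm_bounds(1)[OF Z nz] by simp
  moreover have "entry_norm (mat_of k (orbit l \<omega>)) \<noteq> 0" for k l
    using log_norm_bounds(1)[OF Z nz, where n = k and i = l] by simp
  ultimately show ?thesis by (simp add: log_norm_def ln_mult)
qed

lemma log_norm_integrable: "integrable M (\<lambda>\<omega>. log_norm n (orbit 0 \<omega>))"
proof (rule Bochner_Integration.integrable_bound)
  let ?h = "\<lambda>\<omega>. (\<Sum>k<n. \<bar>ln \<bar>split_det d (Z k \<omega>)\<bar> - ln (2 * real d)\<bar>) + \<bar>ln ((real d)\<^sup>2)\<bar>"
  show "integrable M ?h"
    by (intro Bochner_Integration.integrable_add Bochner_Integration.integrable_sum integrable_abs
        Bochner_Integration.integrable_diff det_orbit) auto
  show "AE \<omega> in M. norm (log_norm n (orbit 0 \<omega>)) \<le> norm (?h \<omega>)"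
    using ratios det_orbit(1)
  proof eventually_elim
    case (elim \<omega>)
    let ?s = "\<Sum>k<n. ln \<bar>split_det d (Z k \<omega>)\<bar> - ln (2 * real d)"
    have "?s \<le> log_norm n (orbit 0 \<omega>)" "log_norm n (orbit 0 \<omega>) \<le> ln ((real d)\<^sup>2)"
      using log_norm_bounds(2,3)[OF elim, where n = n and i = 0] by auto
    moreover have "\<bar>?s\<bar> \<le> (\<Sum>k<n. \<bar>ln \<bar>split_det d (Z k \<omega>)\<bar> - ln (2 * real d)\<bar>)" by (rule sum_abs)
    ultimately show ?case unfolding real_norm_def by linarith
  qed
  show "(\<lambda>\<omega>. log_norm n (orbit 0 \<omega>)) \<in> borel_measurable M" by measurable
qed

text \<open>The theorem of Furstenberg and Kesten for the products of the step matrices.\<close>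

lemma norm_growth:
  obtains \<mu> where "(\<lambda>n. expectation (\<lambda>\<omega>. log_norm n (orbit 0 \<omega>)) / real n) \<longlonglongrightarrow> \<mu>"
    "AE \<omega> in M. (\<lambda>n. log_norm n (orbit 0 \<omega>) / real n) \<longlonglongrightarrow> \<mu>"
proof (rule subadditive_ergodic[where G = log_norm and C = "ln ((real d)\<^sup>2)"
      and L = "expectation (\<lambda>\<omega>. ln \<bar>split_det d (Z 0 \<omega>)\<bar>) - ln (2 * real d)"])
  show "AE \<omega> in M. \<forall>i n m. log_norm (n + m) (orbit i \<omega>) \<le> log_norm n (orbit i \<omega>) + log_norm m (orbit (i + n) \<omega>)"
    using ratios det_orbit(1) by eventually_elim (blast intro: log_norm_subadditive)
  show "AE \<omega> in M. \<forall>i. log_norm 1 (orbit i \<omega>) \<le> ln ((real d)\<^sup>2)"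
    using ratios det_orbit(1) by eventually_elim (blast intro: log_norm_bounds(2))
  fix n
  let ?s = "\<lambda>\<omega>. \<Sum>k<n. ln \<bar>split_det d (Z k \<omega>)\<bar> - ln (2 * real d)"
  have int: "integrable M (\<lambda>\<omega>. ln \<bar>split_det d (Z k \<omega>)\<bar> - ln (2 * real d))" for k
    by (intro Bochner_Integration.integrable_diff det_orbit) auto
  have "real n * (expectation (\<lambda>\<omega>. ln \<bar>split_det d (Z 0 \<omega>)\<bar>) - ln (2 * real d)) =
      (\<Sum>k<n. expectation (\<lambda>\<omega>. ln \<bar>split_det d (Z k \<omega>)\<bar> - ln (2 * real d)))"
  proof -
    have "expectation (\<lambda>\<omega>. ln \<bar>split_det d (Z k \<omega>)\<bar> - ln (2 * real d)) =
        expectation (\<lambda>\<omega>. ln \<bar>split_det d (Z 0 \<omega>)\<bar>) - ln (2 * real d)" for k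
      using det_orbit(2)[of k] det_orbit(3)[of k] by (simp add: prob_space)
    then show ?thesis by simp
  qed
  also have "\<dots> = expectation ?s" using int by (simp add: Bochner_Integration.integral_sum)
  also have "\<dots> \<le> expectation (\<lambda>\<omega>. log_norm n (orbit 0 \<omega>))"
  proof (rule integral_mono_AE[OF Bochner_Integration.integrable_sum[OF int] log_norm_integrable])
    show "AE \<omega> in M. ?s \<omega> \<le> log_norm n (orbit 0 \<omega>)"
      using ratios det_orbit(1)
    proof eventually_elim
      case (elim \<omega>)
      then show ?case using log_norm_bounds(3)[OF elim, where n = n and i = 0] by simp
    qed
  qed
  finally show "real n * (expectation (\<lambda>\<omega>. ln \<bar>split_det d (Z 0 \<omega>)\<bar>) - ln (2 * real d))
      \<le> expectation (\<lambda>\<omega>. log_norm n (orbit 0 \<omega>))" .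
qed (auto intro: log_norm_integrable that)

text \<open>By the law of large numbers the windows starting at different times occur with positive frequency,
  although overlapping windows are dependent.\<close>

lemma recurrent_windows:
  fixes \<eta> :: real
  assumes pos: "0 < prob {\<omega>\<in>space M. \<forall>i<m. \<forall>j<d. \<eta> \<le> Z i \<omega> j \<and> Z i \<omega> j \<le> 1 - \<eta>}"
  shows "AE \<omega> in M. \<forall>N. \<exists>k\<ge>N. \<forall>i<m. \<forall>j<d. \<eta> \<le> Z (k + i) \<omega> j \<and> Z (k + i) \<omega> j \<le> 1 - \<eta>"
proof -
  define W where "W z \<longleftrightarrow> (\<forall>i\<in>{..<m}. \<forall>j\<in>{..<d}. \<eta> \<le> z i j \<and> z i j \<le> 1 - \<eta>)"
    for z :: "nat \<Rightarrow> nat \<Rightarrow> real"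
  have W [measurable]: "Measurable.pred seqs W"
    unfolding W_def
  proof (intro pred_intros_finite pred_intros_logic)
    fix i j assume "j \<in> {..<d}"
    then have [measurable]: "(\<lambda>z. z i j) \<in> borel_measurable seqs" by (intro coordinate_measurable) simp
    show "Measurable.pred seqs (\<lambda>z. \<eta> \<le> z i j)" "Measurable.pred seqs (\<lambda>z. z i j \<le> 1 - \<eta>)"
      by measurable
  qed auto
  let ?h = "\<lambda>z. of_bool (W z) :: real"
  have p: "expectation (\<lambda>\<omega>. ?h (orbit 0 \<omega>)) > 0"
  proof -
    have "expectation (\<lambda>\<omega>. ?h (orbit 0 \<omega>)) = expectation (\<lambda>\<omega>. indicator {\<omega>\<in>space M. W (orbit 0 \<omega>)} \<omega>)"
      by (intro Bochner_Integration.integral_cong) (auto simp: indicator_def)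
    also have "\<dots> = prob ({\<omega>\<in>space M. W (orbit 0 \<omega>)} \<inter> space M)" by (rule Bochner_Integration.integral_indicator)
    also have "{\<omega>\<in>space M. W (orbit 0 \<omega>)} \<inter> space M =
        {\<omega>\<in>space M. \<forall>i<m. \<forall>j<d. \<eta> \<le> Z i \<omega> j \<and> Z i \<omega> j \<le> 1 - \<eta>}"
      by (auto simp: W_def orbit_def)
    finally show ?thesis using pos by simp
  qed
  then obtain \<beta> where \<beta>: "0 < \<beta>" "\<beta> < expectation (\<lambda>\<omega>. ?h (orbit 0 \<omega>))" using dense by blast
  have "AE \<omega> in M. \<forall>\<^sub>F n in sequentially. real n * \<beta> \<le> (\<Sum>k<n. ?h (orbit k \<omega>))"
    by (rule bounded_averages_ge[where C = 1]) (use \<beta> in auto)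
  then show ?thesis
  proof eventually_elim
    case (elim \<omega>)
    show ?case
    proof (rule allI, rule ccontr)
      fix N assume neg: "\<not> (\<exists>k\<ge>N. \<forall>i<m. \<forall>j<d. \<eta> \<le> Z (k + i) \<omega> j \<and> Z (k + i) \<omega> j \<le> 1 - \<eta>)"
      have zero: "?h (orbit k \<omega>) = 0" if "k \<ge> N" for k
      proof -
        have "\<not> W (orbit k \<omega>)"
        proof
          assume "W (orbit k \<omega>)"
          then have "\<forall>i<m. \<forall>j<d. \<eta> \<le> Z (k + i) \<omega> j \<and> Z (k + i) \<omega> j \<le> 1 - \<eta>"
            by (simp add: W_def orbit_def)
          then show False using neg that by blast
        qed
        then show ?thesis by simp
      qed
      have "\<forall>\<^sub>F n in sequentially. (real N + 1) / \<beta> \<le> real n"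
        using filterlim_real_sequentially unfolding filterlim_at_top by blast
      with elim eventually_ge_at_top[of N] have "\<forall>\<^sub>F n in sequentially. False"
      proof eventually_elim
        case (elim n)
        have "(\<Sum>k<n. ?h (orbit k \<omega>)) = (\<Sum>k<N. ?h (orbit k \<omega>))"
          using zero elim(2) by (intro sum.mono_neutral_right) auto
        also have "\<dots> \<le> (\<Sum>k<N. 1)" by (intro sum_mono) auto
        finally have "real n * \<beta> \<le> real N" using elim(1) by simp
        moreover have "real N + 1 \<le> real n * \<beta>" using elim(3) \<beta>(1) by (simp add: field_simps)
        ultimately show False by linarith
      qed
      then show False by simp
    qed
  qed
qed

end

section \<open>Almost sure rate of contraction\<close>

lemma polygon_seq_measurable:
  fixes x :: "nat \<Rightarrow> nat \<Rightarrow> 'a \<Rightarrow> real"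
  assumes x: "\<And>n j. j < d \<Longrightarrow> x (Suc n) j \<in> borel_measurable M" and j: "j < d"
  shows "(\<lambda>\<omega>. polygon_seq d A (\<lambda>n j. x n j \<omega>) n j) \<in> borel_measurable M"
  using j
proof (induction n arbitrary: j)
  case (Suc n)
  have "Suc j mod d < d" using Suc.prems by simp
  then have [measurable]: "(\<lambda>\<omega>. polygon_seq d A (\<lambda>n j. x n j \<omega>) n j) \<in> borel_measurable M"
    "(\<lambda>\<omega>. polygon_seq d A (\<lambda>n j. x n j \<omega>) n (Suc j mod d)) \<in> borel_measurable M"
    "x (Suc n) j \<in> borel_measurable M"
    using Suc x by auto
  show ?case unfolding polygon_seq.simps subdivide_def by measurable
qed simp

text \<open>A bounded factor does not change an exponential rate.\<close>

lemma tendsto_log_ratio: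
  fixes v w :: "nat \<Rightarrow> real"
  assumes w: "\<And>n. 0 < w n" "(\<lambda>n. ln (w n) / real n) \<longlonglongrightarrow> \<mu>" and C: "0 < C"
    and vw: "\<And>n. w n \<le> C * v n" "\<And>n. v n \<le> C * w n"
  shows "(\<lambda>n. elog (v n) / ereal (real n)) \<longlonglongrightarrow> ereal \<mu>"
proof -
  have v: "0 < v n" for n using less_le_trans[OF w(1) vw(1), of n] C by (simp add: zero_less_mult_iff)
  have lv: "ln (w n) - ln C \<le> ln (v n)" "ln (v n) \<le> ln (w n) + ln C" for n
  proof -
    have "ln (w n) \<le> ln (C * v n)" using vw(1)[of n] w(1)[of n] by simp
    then show "ln (w n) - ln C \<le> ln (v n)" using C v[of n] by (simp add: ln_mult)
    have "ln (v n) \<le> ln (C * w n)" using vw(2)[of n] v[of n] by simp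
    then show "ln (v n) \<le> ln (w n) + ln C" using C w(1)[of n] by (simp add: ln_mult)
  qed
  have z: "(\<lambda>n. ln C / real n) \<longlonglongrightarrow> 0" by (rule lim_const_over_n)
  have "(\<lambda>n. ln (v n) / real n) \<longlonglongrightarrow> \<mu>"
  proof (rule tendsto_sandwich)
    show "(\<lambda>n. ln (w n) / real n - ln C / real n) \<longlonglongrightarrow> \<mu>" using tendsto_diff[OF w(2) z] by simp
    show "(\<lambda>n. ln (w n) / real n + ln C / real n) \<longlonglongrightarrow> \<mu>" using tendsto_add[OF w(2) z] by simp
    show "\<forall>\<^sub>F n in sequentially. ln (w n) / real n - ln C / real n \<le> ln (v n) / real n"
      by (intro always_eventually allI) (use lv(1) in \<open>simp add: divide_right_mono flip: diff_divide_distrib\<close>)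
    show "\<forall>\<^sub>F n in sequentially. ln (v n) / real n \<le> ln (w n) / real n + ln C / real n"
      by (intro always_eventually allI) (use lv(2) in \<open>simp add: divide_right_mono flip: add_divide_distrib\<close>)
  qed
  then have "(\<lambda>n. ereal (ln (v n) / real n)) \<longlonglongrightarrow> ereal \<mu>" by simp
  moreover have "\<forall>\<^sub>F n in sequentially. ereal (ln (v n) / real n) = elog (v n) / ereal (real n)"
    using eventually_gt_at_top[of 0] by eventually_elim (simp add: elog_pos[OF v])
  ultimately show ?thesis by (rule Lim_transform_eventually)
qed

text \<open>The logarithm of the largest singular value differs from that of the entry norm by a bounded
  amount, which disappears after division by \<open>n\<close>.\<close>

lemma (in random_splitting) has_top_Lyapunov_exponent_mat_of:
  assumes "(\<lambda>n. expectation (\<lambda>\<omega>. log_norm n (orbit 0 \<omega>)) / real n) \<longlonglongrightarrow> \<mu>"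
  shows "has_top_Lyapunov_exponent M (\<lambda>n \<omega>. mat_of n (orbit 0 \<omega>)) \<mu>"
proof -
  let ?u = "\<lambda>n. expectation (\<lambda>\<omega>. log_norm n (orbit 0 \<omega>))"
  let ?E = "\<lambda>n. ereal_expectation M (\<lambda>\<omega>. elog (largest_singular_value (mat_of n (orbit 0 \<omega>))) / ereal (real n))"
  define c where "c = ln ((real (d - 1))\<^sup>2)"
  have d1: "0 < d - 1" using d by simp
  have bounds: "AE \<omega> in M. ereal ((log_norm n (orbit 0 \<omega>) - c) / real n) \<le>
      elog (largest_singular_value (mat_of n (orbit 0 \<omega>))) / ereal (real n) \<and>
      elog (largest_singular_value (mat_of n (orbit 0 \<omega>))) / ereal (real n) \<le>
      ereal (log_norm n (orbit 0 \<omega>) / real n)" if n: "n > 0" for n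
    using ratios det_orbit(1)
  proof eventually_elim
    case (elim \<omega>)
    let ?B = "mat_of n (orbit 0 \<omega>)"
    let ?s = "largest_singular_value ?B" and ?N = "entry_norm ?B"
    have B: "?B \<in> carrier_mat (d - 1) (d - 1)" unfolding mat_of_def by (rule step_mat_prod_carrier)
    note s = largest_singular_value_bounds[OF B d1]
    have N: "0 < ?N" by (rule log_norm_bounds(1)[OF elim])
    have s0: "0 < ?s"
    proof (rule ccontr)
      assume "\<not> 0 < ?s"
      then have "(real (d - 1))\<^sup>2 * ?s \<le> 0" by (intro mult_nonneg_nonpos) auto
      then show False using s(2) N by linarith
    qed
    have "ln ?s \<le> ln ?N" using s(1) s0 by simp
    moreover have "ln ?N - c \<le> ln ?s"
    proof -
      have "ln ?N \<le> ln ((real (d - 1))\<^sup>2 * ?s)" using s(2) N by simp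
      also have "\<dots> = c + ln ?s" unfolding c_def using s0 d1 by (intro ln_mult_pos) auto
      finally show ?thesis by simp
    qed
    ultimately show ?case using n
      by (simp add: elog_pos[OF s0] log_norm_def divide_right_mono)
  qed
  have Ebounds: "ereal ((?u n - c) / real n) \<le> ?E n \<and> ?E n \<le> ereal (?u n / real n)" if n: "n > 0" for n
  proof
    have "ereal (expectation (\<lambda>\<omega>. (log_norm n (orbit 0 \<omega>) - c) / real n)) \<le> ?E n"
      using bounds[OF n] log_norm_integrable by (intro ereal_expectation_bounds(2)) auto
    then show "ereal ((?u n - c) / real n) \<le> ?E n"
      using log_norm_integrable[of n] by (simp add: prob_space)
    have "?E n \<le> ereal (expectation (\<lambda>\<omega>. log_norm n (orbit 0 \<omega>) / real n))"
      using bounds[OF n] log_norm_integrable by (intro ereal_expectation_bounds(1)) auto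
    then show "?E n \<le> ereal (?u n / real n)" by simp
  qed
  have "?E \<longlonglongrightarrow> ereal \<mu>"
  proof (rule tendsto_sandwich)
    show "\<forall>\<^sub>F n in sequentially. ereal ((?u n - c) / real n) \<le> ?E n"
      using eventually_gt_at_top[of 0] by eventually_elim (use Ebounds in blast)
    show "\<forall>\<^sub>F n in sequentially. ?E n \<le> ereal (?u n / real n)"
      using eventually_gt_at_top[of 0] by eventually_elim (use Ebounds in blast)
    show "(\<lambda>n. ereal (?u n / real n)) \<longlonglongrightarrow> ereal \<mu>" using assms by simp
    have "(\<lambda>n. ?u n / real n - c / real n) \<longlonglongrightarrow> \<mu> - 0"
      by (intro tendsto_diff assms lim_const_over_n)
    then show "(\<lambda>n. ereal ((?u n - c) / real n)) \<longlonglongrightarrow> ereal \<mu>" by (simp add: diff_divide_distrib)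
  qed
  then show ?thesis unfolding has_top_Lyapunov_exponent_def .
qed

lemma (in prob_space) iid_joint_event_pos:
  assumes [measurable]: "\<xi> \<in> borel_measurable M" and iid: "iid_copies M \<xi> V I"
    and J: "finite J" "J \<noteq> {}" "J \<subseteq> I"
    and U [measurable]: "U \<in> sets borel" and pos: "0 < prob {\<omega>\<in>space M. \<xi> \<omega> \<in> U}"
  shows "0 < prob (\<Inter>p\<in>J. V p -` U \<inter> space M)"
proof -
  have ind: "indep_vars (\<lambda>_. borel) V I" and dist: "\<And>p. p \<in> I \<Longrightarrow> distr M borel (V p) = distr M borel \<xi>"
    using iid by (simp_all add: iid_copies_def)
  have eq: "prob (V p -` U \<inter> space M) = prob {\<omega>\<in>space M. \<xi> \<omega> \<in> U}" if "p \<in> I" for p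
  proof -
    have [measurable]: "V p \<in> borel_measurable M" using ind that by (simp add: indep_vars_def2)
    have "prob (V p -` U \<inter> space M) = measure (distr M borel (V p)) U" by (subst measure_distr) auto
    also have "\<dots> = prob (\<xi> -` U \<inter> space M)" unfolding dist[OF that] by (subst measure_distr) auto
    also have "\<xi> -` U \<inter> space M = {\<omega>\<in>space M. \<xi> \<omega> \<in> U}" by auto
    finally show ?thesis .
  qed
  have "prob (\<Inter>p\<in>J. V p -` U \<inter> space M) = (\<Prod>p\<in>J. prob (V p -` U \<inter> space M))"
    by (rule indep_varsD[OF ind J(2,1,3) U])
  also have "\<dots> = (\<Prod>p\<in>J. prob {\<omega>\<in>space M. \<xi> \<omega> \<in> U})"
    using J(3) by (intro prod.cong refl eq) auto
  also have "\<dots> > 0" using pos by (intro prod_pos) auto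
  finally show ?thesis .
qed

theorem theorem4p10:
  fixes M :: "'a measure"
    and d :: nat
    and \<xi> :: "'a \<Rightarrow> real"
    and Y :: "nat \<Rightarrow> 'a \<Rightarrow> real"
    and X :: "nat \<Rightarrow> nat \<Rightarrow> 'a \<Rightarrow> real"
    and A0 :: "nat \<Rightarrow> real^2"
  assumes "prob_space M"
    and "d \<ge> 3"
    and "\<xi> \<in> borel_measurable M"
    and "rv_support M \<xi> \<subseteq> {0..1}"
    and "iid_copies M \<xi> Y {..<d}"
    and "measure M {\<omega> \<in> space M. \<xi> \<omega> \<in> {0, 1}} = 0"
    and "\<exists>a b. a \<noteq> b \<and> {a, b} \<subseteq> rv_support M \<xi> \<inter> {0<..<1}"
    and "ereal_expectation M
           (\<lambda>\<omega>. elog \<bar>(\<Prod>i<d. 1 - Y i \<omega>) - (- 1) ^ d * (\<Prod>i<d. Y i \<omega>)\<bar>) > -\<infinity>"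
    and "nondegenerate_convex_polygon d A0"
    and "iid_copies M \<xi> (\<lambda>(n, j). X n j) ({1..} \<times> {..<d})"
  shows "\<exists>(P :: 'a \<Rightarrow> real^2) (\<mu>\<^sub>1 :: real).
    P \<in> borel_measurable M \<and>
    has_top_Lyapunov_exponent M (\<lambda>n \<omega>. step_mat_prod d (\<lambda>n j. X n j \<omega>) n) \<mu>\<^sub>1 \<and>
    (AE \<omega> in M.
       P \<omega> \<in> interior (convex hull (A0 ` {..<d})) \<and>
       (\<forall>j<d. (\<lambda>n. polygon_seq d A0 (\<lambda>n j. X n j \<omega>) n j) \<longlonglongrightarrow> P \<omega>) \<and>
       (\<lambda>n. elog (Max ((\<lambda>j. dist (P \<omega>) (polygon_seq d A0 (\<lambda>n j. X n j \<omega>) n j)) ` {..<d}))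
              / ereal (real n)) \<longlonglongrightarrow> ereal \<mu>\<^sub>1)"
proof -
  interpret prob_space M by fact
  note \<xi> [measurable] = assms(3)
  have d0: "d > 0" and d2: "d \<ge> 2" using assms(2) by auto
  let ?S = "\<Pi>\<^sub>M j\<in>{..<d}. (borel :: real measure)"
  define Z where "Z k \<omega> = (\<lambda>j\<in>{..<d}. X (Suc k) j \<omega>)" for k \<omega>
  note rows = iid_sequence_rows[OF \<xi> assms(10) d0, folded Z_def]
  have "\<forall>p\<in>{1..} \<times> {..<d}. (case p of (n, j) \<Rightarrow> X n j) \<in> borel_measurable M"
    using assms(10) unfolding iid_copies_def indep_vars_def2 by (elim conjE)
  moreover have "\<forall>p\<in>{1..} \<times> {..<d}. distr M borel (case p of (n, j) \<Rightarrow> X n j) = distr M borel \<xi>"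
    using assms(10) unfolding iid_copies_def by (elim conjE)
  ultimately have Xm: "X n j \<in> borel_measurable M" and Xd: "distr M borel (X n j) = distr M borel \<xi>"
    if "n \<ge> 1" "j < d" for n j
    using that bspec[of "{1..} \<times> {..<d}" _ "(n, j)"] by simp_all
  have Ym: "Y j \<in> borel_measurable M" and Yd: "distr M borel (Y j) = distr M borel \<xi>" if "j < d" for j
    using assms(5) that unfolding iid_copies_def indep_vars_def2 by auto
  have "AE \<omega> in M. \<xi> \<omega> \<notin> {0, 1}"
    using assms(6) by (subst (asm) prob_Collect_eq_0) auto
  with AE_in_rv_support[OF \<xi>] have \<xi>01: "AE \<omega> in M. 0 < \<xi> \<omega> \<and> \<xi> \<omega> < 1"
  proof eventually_elim
    case (elim \<omega>)
    then have "\<xi> \<omega> \<in> {0..1}" using assms(4) by blast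
    then show ?case using elim by auto
  qed
  have transfer: "AE \<omega> in M. 0 < V \<omega> \<and> V \<omega> < 1"
    if [measurable]: "V \<in> borel_measurable M" and "distr M borel V = distr M borel \<xi>" for V
  proof -
    have "AE x in distr M borel \<xi>. 0 < x \<and> x < 1" using \<xi>01 by (subst AE_distr_iff) auto
    then have "AE x in distr M borel V. 0 < x \<and> x < 1" by (simp only: that(2))
    then show ?thesis by (subst (asm) AE_distr_iff) auto
  qed
  have Y01: "AE \<omega> in M. \<forall>j<d. 0 < Y j \<omega> \<and> Y j \<omega> < 1"
    using transfer[OF Ym Yd] by (subst AE_all_countable) auto
  have X01: "AE \<omega> in M. \<forall>n. \<forall>j<d. 0 < X (Suc n) j \<omega> \<and> X (Suc n) j \<omega> < 1"
    using transfer[OF Xm Xd] by (auto simp: AE_all_countable)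
  have det_restrict: "split_det d (\<lambda>j\<in>{..<d}. t j) = split_det d t" for t
    by (simp add: split_det_def)
  let ?Y = "\<lambda>\<omega>. \<lambda>j\<in>{..<d}. Y j \<omega>"
  have Ymeas: "?Y \<in> measurable M ?S" by (intro measurable_restrict Ym) simp
  have Zmeas: "Z 0 \<in> measurable M ?S" unfolding Z_def by (intro measurable_restrict Xm) auto
  have same: "distr M ?S ?Y = distr M ?S (Z 0)"
    using distr_iid_tuple[OF assms(5)] rows(2)[of 0] d0 by force
  have detY: "(\<lambda>\<omega>. \<bar>split_det d (?Y \<omega>)\<bar>) \<in> borel_measurable M"
    using measurable_compose[OF Ymeas split_det_measurable] by simp
  have "AE \<omega> in M. \<bar>split_det d (?Y \<omega>)\<bar> \<le> 1"
    using Y01 by eventually_elim (auto simp: det_restrict less_imp_le intro!: abs_split_det_le_1 d0)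
  moreover have "ereal_expectation M (\<lambda>\<omega>. elog \<bar>split_det d (?Y \<omega>)\<bar>) > -\<infinity>"
    using assms(8) by (simp add: det_restrict split_det_def)
  ultimately have Ypos: "AE \<omega> in M. 0 < \<bar>split_det d (?Y \<omega>)\<bar>"
    and Yint: "integrable M (\<lambda>\<omega>. ln \<bar>split_det d (?Y \<omega>)\<bar>)"
    by (rule finite_expected_log[OF detY])+
  interpret R: random_splitting M d Z
  proof (intro random_splitting.intro random_splitting_axioms.intro)
    show "iid_sequence M ?S Z" by (rule rows(1))
    show "AE \<omega> in M. \<forall>k. \<forall>j<d. 0 < Z k \<omega> j \<and> Z k \<omega> j < 1"
      using X01 by eventually_elim (simp add: Z_def)
    have "AE y in distr M ?S ?Y. split_det d y \<noteq> 0" using Ypos Ymeas by (subst AE_distr_iff) auto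
    then show "AE \<omega> in M. split_det d (Z 0 \<omega>) \<noteq> 0"
      unfolding same using Zmeas by (subst (asm) AE_distr_iff) auto
    have "integrable (distr M ?S ?Y) (\<lambda>y. ln \<bar>split_det d y\<bar>)"
      using Yint Ymeas by (subst integrable_distr_eq) auto
    then show "integrable M (\<lambda>\<omega>. ln \<bar>split_det d (Z 0 \<omega>)\<bar>)"
      unfolding same using Zmeas by (subst (asm) integrable_distr_eq) auto
  qed (rule assms(2))
  have mat: "R.mat_of n (R.orbit 0 \<omega>) = step_mat_prod d (\<lambda>n j. X n j \<omega>) n" for n \<omega>
    unfolding R.mat_of_orbit by (rule step_mat_prod_cong[OF d2]) (simp add: Z_def)
  obtain \<mu> where \<mu>: "(\<lambda>n. expectation (\<lambda>\<omega>. R.log_norm n (R.orbit 0 \<omega>)) / real n) \<longlonglongrightarrow> \<mu>"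
    "AE \<omega> in M. (\<lambda>n. R.log_norm n (R.orbit 0 \<omega>) / real n) \<longlonglongrightarrow> \<mu>"
    using R.norm_growth by blast
  \<comment> \<open>A point of the support inside the unit interval provides the margin \<open>\<eta>\<close> for contracting windows.\<close>
  obtain a where a: "a \<in> rv_support M \<xi>" "0 < a" "a < 1" using assms(7) by auto
  define \<eta> where "\<eta> = min a (1 - a) / 2"
  have \<eta>: "0 < \<eta>" "\<eta> < a" "a < 1 - \<eta>" using a by (auto simp: \<eta>_def min_def field_simps)
  have window: "0 < prob {\<omega>\<in>space M. \<forall>i<d-1. \<forall>j<d. \<eta> \<le> Z i \<omega> j \<and> Z i \<omega> j \<le> 1 - \<eta>}"
  proof -
    let ?J = "{1..d-1} \<times> {..<d}"
    let ?E = "\<Inter>p\<in>?J. (\<lambda>(n, j). X n j) p -` {\<eta>..1 - \<eta>} \<inter> space M"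
    have J: "(1, 0) \<in> ?J" using assms(2) by simp
    have "0 < prob {\<omega>\<in>space M. \<xi> \<omega> \<in> {\<eta><..<1 - \<eta>}}"
    proof -
      have "\<forall>U. open U \<and> a \<in> U \<longrightarrow> 0 < prob {\<omega>\<in>space M. \<xi> \<omega> \<in> U}"
        using a(1) by (simp only: rv_support_def mem_Collect_eq)
      from spec[OF this, of "{\<eta><..<1 - \<eta>}"] show ?thesis using \<eta> by simp
    qed
    also have "\<dots> \<le> prob {\<omega>\<in>space M. \<xi> \<omega> \<in> {\<eta>..1 - \<eta>}}" by (intro finite_measure_mono) auto
    finally have pos: "0 < prob {\<omega>\<in>space M. \<xi> \<omega> \<in> {\<eta>..1 - \<eta>}}" .
    have "?J \<noteq> {}" using J by blast
    then have "0 < prob ?E"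
      using pos by (intro iid_joint_event_pos[OF \<xi> assms(10)]) auto
    also have "prob ?E \<le> prob {\<omega>\<in>space M. \<forall>i<d-1. \<forall>j<d. \<eta> \<le> Z i \<omega> j \<and> Z i \<omega> j \<le> 1 - \<eta>}"
    proof (rule finite_measure_mono)
      show "?E \<subseteq> {\<omega>\<in>space M. \<forall>i<d-1. \<forall>j<d. \<eta> \<le> Z i \<omega> j \<and> Z i \<omega> j \<le> 1 - \<eta>}"
      proof (intro subsetI CollectI conjI allI impI)
        fix \<omega> i j assume \<omega>: "\<omega> \<in> ?E"
        from INT_D[OF \<omega> J] show "\<omega> \<in> space M" by simp
        assume ij: "i < d - 1" "j < d"
        then have "(Suc i, j) \<in> ?J" by simp
        from INT_D[OF \<omega> this]
        have "X (Suc i) j \<omega> \<in> {\<eta>..1 - \<eta>}" by simp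
        then show "\<eta> \<le> Z i \<omega> j" "Z i \<omega> j \<le> 1 - \<eta>" using ij(2) by (auto simp: Z_def)
      qed
      have "{\<omega>\<in>space M. \<forall>i\<in>{..<d-1}. \<forall>j\<in>{..<d}. \<eta> \<le> Z i \<omega> j \<and> Z i \<omega> j \<le> 1 - \<eta>} \<in> events"
      proof (intro sets.sets_Collect_finite_All)
        fix i j assume "j \<in> {..<d}"
        then have [measurable]: "(\<lambda>\<omega>. Z i \<omega> j) \<in> borel_measurable M" by (simp add: Z_def Xm)
        show "{\<omega>\<in>space M. \<eta> \<le> Z i \<omega> j \<and> Z i \<omega> j \<le> 1 - \<eta>} \<in> events" by measurable
      qed auto
      then show "{\<omega>\<in>space M. \<forall>i<d-1. \<forall>j<d. \<eta> \<le> Z i \<omega> j \<and> Z i \<omega> j \<le> 1 - \<eta>} \<in> events"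
        by (simp only: lessThan_iff Ball_def)
    qed
    finally show ?thesis .
  qed
  define P where "P \<omega> = lim (\<lambda>n. polygon_seq d A0 (\<lambda>n j. X n j \<omega>) n 0)" for \<omega>
  have "P \<in> borel_measurable M"
    unfolding P_def by (intro borel_measurable_lim_metric polygon_seq_measurable Xm d0) auto
  moreover have "has_top_Lyapunov_exponent M (\<lambda>n \<omega>. step_mat_prod d (\<lambda>n j. X n j \<omega>) n) \<mu>"
    using R.has_top_Lyapunov_exponent_mat_of[OF \<mu>(1)] unfolding mat .
  moreover have "AE \<omega> in M.
       P \<omega> \<in> interior (convex hull (A0 ` {..<d})) \<and>
       (\<forall>j<d. (\<lambda>n. polygon_seq d A0 (\<lambda>n j. X n j \<omega>) n j) \<longlonglongrightarrow> P \<omega>) \<and>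
       (\<lambda>n. elog (Max ((\<lambda>j. dist (P \<omega>) (polygon_seq d A0 (\<lambda>n j. X n j \<omega>) n j)) ` {..<d}))
              / ereal (real n)) \<longlonglongrightarrow> ereal \<mu>"
    using X01 \<mu>(2) R.recurrent_windows[OF window] R.ratios R.det_orbit(1)
  proof eventually_elim
    case (elim \<omega>)
    let ?x = "\<lambda>n j. X n j \<omega>"
    have t: "0 < ?x (Suc n) j \<and> ?x (Suc n) j < 1" if "j < d" for n j using elim(1) that by blast
    have t': "0 \<le> ?x (Suc n) j \<and> ?x (Suc n) j \<le> 1" if "j < d" for n j using t[OF that, of n] by simp
    have good: "\<exists>k\<ge>N. \<forall>i<d-1. \<forall>j<d. \<eta> \<le> ?x (Suc (k + i)) j \<and> ?x (Suc (k + i)) j \<le> 1 - \<eta>" for N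
      using elim(3) by (simp add: Z_def)
    have "(\<lambda>n. osc d (split_seq d ?x f n)) \<longlonglongrightarrow> 0" for f
      by (rule osc_tendsto_zero[where x = ?x, OF d0 t' \<eta>(1) good])
    from polygon_diameter_comparable[where x = ?x, OF assms(2,9) t this]
    obtain p C where p: "p \<in> interior (convex hull (A0 ` {..<d}))"
      "\<forall>j<d. (\<lambda>n. polygon_seq d A0 ?x n j) \<longlonglongrightarrow> p" "0 < C"
      "\<And>n. entry_norm (step_mat_prod d ?x n) \<le> C * Max ((\<lambda>j. dist p (polygon_seq d A0 ?x n j)) ` {..<d})"
      "\<And>n. Max ((\<lambda>j. dist p (polygon_seq d A0 ?x n j)) ` {..<d}) \<le> C * entry_norm (step_mat_prod d ?x n)"
      by blast
    have Pp: "P \<omega> = p" unfolding P_def using p(2) d0 by (intro limI) simp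
    have "(\<lambda>n. elog (Max ((\<lambda>j. dist p (polygon_seq d A0 ?x n j)) ` {..<d})) / ereal (real n)) \<longlonglongrightarrow> ereal \<mu>"
    proof (rule tendsto_log_ratio[OF _ _ p(3-5)])
      show "0 < entry_norm (step_mat_prod d ?x n)" for n
        using R.log_norm_bounds(1)[OF elim(4,5), of n 0] by (simp add: mat)
      show "(\<lambda>n. ln (entry_norm (step_mat_prod d ?x n)) / real n) \<longlonglongrightarrow> \<mu>"
        using elim(2) by (simp add: R.log_norm_def mat)
    qed
    then show ?case using p(1,2) by (simp add: Pp)
  qed
  ultimately show ?thesis by blast
qed

end
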